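(* In the setting of the context, fix $x_0\in\mathbb R^n$ and consider the primal–dual gradient dynamics $$\dot w(t)=\mathcal Jw(t)-\mathcal R(w(t))-(0,(0,x_0)),\qquad w(0)=w_0,\qquad(\ast)$$ on $\mathcal W$, with Hamiltonian $H(w)=\frac12\|w\|_{\mathcal W}^2$. Then: 1. The dynamics $(\ast)$, that is, the system generated by $(H,\mathcal J,\mathcal R)$, define an autonomous incrementally monotone port-Hamiltonian system. 2. For every initial condition $w_0\in\mathcal W$ there exists a unique mild solution of $(\ast)$. 3. The system $(\ast)$ admits a unique steady state $w^\star=(x^\star,p^\star)\in\mathcal W$, given by the unique solution of the optimality system $\mathcal S(x^\star,p^\star)=(0,(0,x_0))$. 4. For every $w_0\in\mathcal W$ the corresponding solution $w$ satisfies $$H_{w^\star}(w(t))\le H_{w^\star}(w_0),\qquad t\ge0,$$ where $H_{w^\star}(w)=H(w)-H(w^\star)-\langle\nabla H(w^\star),w-w^\star\rangle_{\mathcal W}=\frac12\|w-w^\star\|_{\mathcal W}^2$.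
   Context: Fix $t_f>0$, $n,m\in\mathbb N$. Let $\mathcal X=L^2([0,t_f];\mathbb R^n)$, $\mathcal Y=H^1([0,t_f];\mathbb R^n)$, $\mathcal U=L^2([0,t_f];\mathbb R^m)$, $\mathcal Z=\mathcal X\times\mathbb R^n$, $\mathcal W=\mathcal X\times\mathcal Z$, with the product Hilbert space structures (all spaces real). Let $A\in\mathbb R^{n\times n}$, $B\in\mathbb R^{n\times m}$, $\alpha>0$, $\underline u,\overline u\in\mathbb R^m$ with $\underline u_i<0<\overline u_i$ for all $i$, and $F=\{u\in\mathcal U:\underline u_i\le u_i(t)\le\overline u_i\ \forall i,\text{ a.e. }t\in[0,t_f]\}$. $P_F:\mathcal U\to F$ is the orthogonal projection onto $F$. Let $\ell:\mathbb R^n\to[0,\infty)$ be continuous and convex with $\ell(0)=0$, and let $J:\mathcal X\to\mathbb R$, $J(x)=\int_0^{t_f}\ell(x(\tau))\,d\tau$, be Fréchet differentiable with gradient $\nabla J(x)\in\mathcal X$ satisfying, for some $\mu,L>0$, $\mu\|x-y\|_{\mathcal X}^2\le\langle\nabla J(x)-\nabla J(y),x-y\rangle_{\mathcal X}\le L\|x-y\|_{\mathcal X}^2$ for all $x,y\in\mathcal X$. $\mathcal A:\mathcal X\supset D(\mathcal A)=\mathcal Y\to\mathcal Z$, $\mathcal Ax=(\frac{d}{d\tau}x-Ax,\ x(0))$. Its Hilbert space adjoint has domain $D(\mathcal A^* )=\{(\lambda,\lambda_0)\in\mathcal Y\times\mathbb R^n:\lambda(0)=\lambda_0,\ \lambda(t_f)=0\}$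 and $\mathcal A^*(\lambda,\lambda_0)=-\frac{d}{d\tau}\lambda-A^\top\lambda$. $\mathcal B:\mathcal U\to\mathcal Z$, $\mathcal Bu=(Bu,0)$, with $\mathcal B^*(\lambda,\lambda_0)=B^\top\lambda$. $\mathcal J:\mathcal W\supset D(\mathcal A)\times D(\mathcal A^* )\to\mathcal W$, $\mathcal J(x,p)=(-\mathcal A^*p,\ \mathcal Ax)$; $\mathcal R:\mathcal W\to\mathcal W$, $\mathcal R(x,p)=(\nabla J(x),\ \mathcal BP_F(\tfrac1\alpha\mathcal B^*p))$; $\mathcal S=\mathcal J-\mathcal R$ on $D(\mathcal A)\times D(\mathcal A^* )$. Port-Hamiltonian systems: let $X,U$ be real Hilbert spaces, $H:X\to\mathbb R$ Fréchet differentiable and $\mu_H$-strongly convex for some $\mu_H>0$, $J_0:X\supset D(J_0)\to X$ a possibly nonlinear operator with $\langle J_0(z),z\rangle=0$ for $z\in D(J_0)$, $R_0:X\to X$ continuous and accretive ($\langle R_0(z),z\rangle\ge0$ for all $z\in X$), and $B_0$ a bounded linear operator from $U$ to $X$. The nonlinear port-Hamiltonian system $(H,J_0,R_0,B_0)$ with input $u$ and output $y$ is $\dot x=J_0(\nabla H(x))-R_0(\nabla H(x))+B_0u$, $y=B_0^*\nabla H(x)$. It is called incrementally monotone if, in addition, $J_0$ is linear and skew-adjoint and $R_0$ is monotone ($\langle R_0(z_1)-R_0(z_2),z_1-z_2\rangle\ge0$ for all $z_1,z_2$). Autonomous means without input and output; the system is then denoted $(H,J_0,R_0)$. A mild solution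 of $(\ast)$ is a function $w\in C([0,\infty);\mathcal W)$ with $w(t)=T(t)w_0-\int_0^tT(t-s)\bigl[\mathcal R(w(s))+(0,(0,x_0))\bigr]ds$ for $t\ge 0$, where $(T(t))$ is the unitary $C_0$-group generated by $\mathcal J$. A steady state is $w\in D(\mathcal J)$ with $\mathcal Jw-\mathcal R(w)-(0,(0,x_0))=0$. *)

theory Defs
  imports "HOL-Analysis.Analysis"
begin

section \<open>Square-integrable functions modulo equality almost everywhere\<close>

definition square_integrable :: "(real \<Rightarrow> 'a::euclidean_space) \<Rightarrow> bool" where
  "square_integrable f \<longleftrightarrow>
     f \<in> borel_measurable lborel \<and> integrable lborel (\<lambda>t. (norm (f t))\<^sup>2)"

lemma square_integrable_zero: "square_integrable (\<lambda>_. 0)"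
  by (simp add: square_integrable_def)

lemma square_integrable_bound:
  fixes f :: "real \<Rightarrow> 'a::euclidean_space" and g :: "real \<Rightarrow> 'b::euclidean_space"
  assumes f: "square_integrable f" and g: "g \<in> borel_measurable lborel"
    and le: "\<And>t. norm (g t) \<le> K * norm (f t)"
  shows "square_integrable g"
proof -
  have "integrable lborel (\<lambda>t. K\<^sup>2 * (norm (f t))\<^sup>2)"
    using f by (simp add: square_integrable_def)
  moreover have "(norm (g t))\<^sup>2 \<le> K\<^sup>2 * (norm (f t))\<^sup>2" for t
    using power_mono[OF le[of t], of 2] by (simp add: power_mult_distrib)
  ultimately have "integrable lborel (\<lambda>t. (norm (g t))\<^sup>2)"
    using g by (intro Bochner_Integration.integrable_bound[where
          f = "\<lambda>t. K\<^sup>2 * (norm (f t))\<^sup>2" and g = "\<lambda>t. (norm (g t))\<^sup>2"]) simp_all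
  with g show ?thesis by (simp add: square_integrable_def)
qed

lemma square_integrable_add:
  assumes f: "square_integrable f" and g: "square_integrable g"
  shows "square_integrable (\<lambda>t. f t + g t)"
proof -
  have m: "f \<in> borel_measurable lborel" "g \<in> borel_measurable lborel"
    using f g by (auto simp: square_integrable_def)
  have "integrable lborel (\<lambda>t. 2 * (norm (f t))\<^sup>2 + 2 * (norm (g t))\<^sup>2)"
    using f g by (simp add: square_integrable_def)
  moreover have "(norm (f t + g t))\<^sup>2 \<le> 2 * (norm (f t))\<^sup>2 + 2 * (norm (g t))\<^sup>2" for t
  proof -
    have "(norm (f t + g t))\<^sup>2 \<le> (norm (f t) + norm (g t))\<^sup>2"
      by (intro power_mono norm_triangle_ineq) auto
    also have "\<dots> \<le> 2 * (norm (f t))\<^sup>2 + 2 * (norm (g t))\<^sup>2"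
      using sum_squares_bound[of "norm (f t)" "norm (g t)"] by (simp add: power2_sum)
    finally show ?thesis .
  qed
  ultimately have "integrable lborel (\<lambda>t. (norm (f t + g t))\<^sup>2)"
    using m by (intro Bochner_Integration.integrable_bound[where
          f = "\<lambda>t. 2 * (norm (f t))\<^sup>2 + 2 * (norm (g t))\<^sup>2" and
          g = "\<lambda>t. (norm (f t + g t))\<^sup>2"]) simp_all
  with m show ?thesis by (simp add: square_integrable_def)
qed

lemma square_integrable_scaleR:
  "square_integrable f \<Longrightarrow> square_integrable (\<lambda>t. c *\<^sub>R f t)"
  by (auto simp: square_integrable_def power_mult_distrib)

lemma square_integrable_uminus:
  "square_integrable f \<Longrightarrow> square_integrable (\<lambda>t. - f t)"
  by (auto simp: square_integrable_def)

lemma square_integrable_diff: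
  "square_integrable f \<Longrightarrow> square_integrable g \<Longrightarrow> square_integrable (\<lambda>t. f t - g t)"
  using square_integrable_add[OF _ square_integrable_uminus, of f g] by simp

lemma integrable_inner_square_integrable:
  assumes f: "square_integrable f" and g: "square_integrable g"
  shows "integrable lborel (\<lambda>t. f t \<bullet> g t)"
proof -
  have m: "f \<in> borel_measurable lborel" "g \<in> borel_measurable lborel"
    using f g by (auto simp: square_integrable_def)
  have "integrable lborel (\<lambda>t. (norm (f t))\<^sup>2 + (norm (g t))\<^sup>2)"
    using f g by (simp add: square_integrable_def)
  moreover have "norm (f t \<bullet> g t) \<le> norm ((norm (f t))\<^sup>2 + (norm (g t))\<^sup>2)" for t
  proof -
    have "\<bar>f t \<bullet> g t\<bar> \<le> norm (f t) * norm (g t)"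
      by (rule Cauchy_Schwarz_ineq2)
    also have "\<dots> \<le> (norm (f t))\<^sup>2 + (norm (g t))\<^sup>2"
      using sum_squares_bound[of "norm (f t)" "norm (g t)"]
        mult_nonneg_nonneg[OF norm_ge_zero norm_ge_zero, of "f t" "g t"] by linarith
    finally show ?thesis by simp
  qed
  ultimately show ?thesis
    using m by (intro Bochner_Integration.integrable_bound[where
          f = "\<lambda>t. (norm (f t))\<^sup>2 + (norm (g t))\<^sup>2" and
          g = "\<lambda>t. f t \<bullet> g t"]) simp_all
qed

definition L2_eq :: "(real \<Rightarrow> 'a::euclidean_space) \<Rightarrow> (real \<Rightarrow> 'a) \<Rightarrow> bool" where
  "L2_eq f g \<longleftrightarrow>
     square_integrable f \<and> square_integrable g \<and> (AE t in lborel. f t = g t)"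

quotient_type (overloaded) 'a L2 = "real \<Rightarrow> 'a::euclidean_space" / partial: L2_eq
proof (rule part_equivpI)
  show "\<exists>f::real \<Rightarrow> 'a. L2_eq f f"
    using square_integrable_zero by (auto simp: L2_eq_def)
  show "symp (L2_eq :: (real \<Rightarrow> 'a) \<Rightarrow> _)"
    by (rule sympI) (auto simp: L2_eq_def)
  show "transp (L2_eq :: (real \<Rightarrow> 'a) \<Rightarrow> _)"
    by (rule transpI) (auto simp: L2_eq_def)
qed

instantiation L2 :: (euclidean_space) real_vector
begin

lift_definition zero_L2 :: "'a L2" is "\<lambda>_. 0"
  by (simp add: L2_eq_def square_integrable_zero)

lift_definition plus_L2 :: "'a L2 \<Rightarrow> 'a L2 \<Rightarrow> 'a L2" is "\<lambda>f g t. f t + g t"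
  by (auto simp: L2_eq_def square_integrable_add)

lift_definition scaleR_L2 :: "real \<Rightarrow> 'a L2 \<Rightarrow> 'a L2" is "\<lambda>c f t. c *\<^sub>R f t"
  by (auto simp: L2_eq_def square_integrable_scaleR)

lift_definition uminus_L2 :: "'a L2 \<Rightarrow> 'a L2" is "\<lambda>f t. - f t"
  by (auto simp: L2_eq_def square_integrable_uminus)

lift_definition minus_L2 :: "'a L2 \<Rightarrow> 'a L2 \<Rightarrow> 'a L2" is "\<lambda>f g t. f t - g t"
  by (auto simp: L2_eq_def square_integrable_diff)

instance
proof
  note closed = square_integrable_zero square_integrable_add square_integrable_diff
    square_integrable_uminus square_integrable_scaleR
  fix x y z :: "'a L2" and a b :: real
  show "x + y + z = x + (y + z)"
    by transfer (simp add: L2_eq_def add.assoc closed)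
  show "x + y = y + x"
    by transfer (simp add: L2_eq_def add.commute closed)
  show "0 + x = x"
    by transfer (simp add: L2_eq_def)
  show "- x + x = 0"
    by transfer (simp add: L2_eq_def closed)
  show "x - y = x + - y"
    by transfer (simp add: L2_eq_def closed)
  show "a *\<^sub>R (x + y) = a *\<^sub>R x + a *\<^sub>R y"
    by transfer (simp add: L2_eq_def scaleR_add_right closed)
  show "(a + b) *\<^sub>R x = a *\<^sub>R x + b *\<^sub>R x"
    by transfer (simp add: L2_eq_def scaleR_add_left closed)
  show "a *\<^sub>R b *\<^sub>R x = (a * b) *\<^sub>R x"
    by transfer (simp add: L2_eq_def closed)
  show "1 *\<^sub>R x = x"
    by transfer (simp add: L2_eq_def)
qed

end

instantiation L2 :: (euclidean_space) real_inner
begin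

lift_definition inner_L2 :: "'a L2 \<Rightarrow> 'a L2 \<Rightarrow> real"
  is "\<lambda>f g. LINT t|lborel. f t \<bullet> g t"
  unfolding L2_eq_def by (intro integral_cong_AE) (auto simp: square_integrable_def)

definition norm_L2 :: "'a L2 \<Rightarrow> real" where "norm_L2 x = sqrt (x \<bullet> x)"

definition sgn_L2 :: "'a L2 \<Rightarrow> 'a L2" where "sgn_L2 x = x /\<^sub>R norm x"

definition dist_L2 :: "'a L2 \<Rightarrow> 'a L2 \<Rightarrow> real" where "dist_L2 x y = norm (x - y)"

definition uniformity_L2 :: "('a L2 \<times> 'a L2) filter" where
  "uniformity_L2 = (INF e\<in>{0<..}. principal {(x, y). dist x y < e})"

definition open_L2 :: "'a L2 set \<Rightarrow> bool" where
  "open_L2 U \<longleftrightarrow> (\<forall>x\<in>U. eventually (\<lambda>(x', y). x' = x \<longrightarrow> y \<in> U) uniformity)"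

instance
proof
  fix x y z :: "'a L2" and a :: real
  show "sgn x = x /\<^sub>R norm x" by (rule sgn_L2_def)
  show "norm x = sqrt (x \<bullet> x)" by (rule norm_L2_def)
  show "dist x y = norm (x - y)" by (rule dist_L2_def)
  show "uniformity = (INF e\<in>{0<..}. principal {(x, y). dist (x::'a L2) y < e})"
    by (rule uniformity_L2_def)
  show "open U \<longleftrightarrow> (\<forall>x\<in>U. eventually (\<lambda>(x', y). x' = x \<longrightarrow> y \<in> U) uniformity)"
    for U :: "'a L2 set"
    by (rule open_L2_def)
  show "x \<bullet> y = y \<bullet> x"
    by transfer (simp add: inner_commute)
  show "(x + y) \<bullet> z = x \<bullet> z + y \<bullet> z"
    by transfer (auto simp: L2_eq_def inner_add_left integrable_inner_square_integrable)
  show "(a *\<^sub>R x) \<bullet> y = a * (x \<bullet> y)"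
    by transfer simp
  show "0 \<le> x \<bullet> x"
    by transfer simp
  show "x \<bullet> x = 0 \<longleftrightarrow> x = 0"
  proof transfer
    fix f :: "real \<Rightarrow> 'a" assume "L2_eq f f"
    then have f: "square_integrable f" by (simp add: L2_eq_def)
    show "((LINT t|lborel. f t \<bullet> f t) = 0) = L2_eq f (\<lambda>_. 0)"
      using integral_nonneg_eq_0_iff_AE[OF integrable_inner_square_integrable[OF f f]] f
      by (auto simp: L2_eq_def square_integrable_zero)
  qed
qed

end

text \<open>Multiplication by a matrix, pointwise in time.\<close>

lift_definition matrix_L2 :: "real^'n^'k \<Rightarrow> (real^'n) L2 \<Rightarrow> (real^'k) L2"
  is "\<lambda>M f t. M *v f t"
proof -
  fix M :: "real^'n^'k" and f g :: "real \<Rightarrow> real^'n"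
  assume *: "L2_eq f g"
  have "square_integrable (\<lambda>t. M *v h t)" if h: "square_integrable h" for h
  proof (rule square_integrable_bound[OF h])
    have "h \<in> borel_measurable lborel" using h by (simp add: square_integrable_def)
    then show "(\<lambda>t. M *v h t) \<in> borel_measurable lborel"
      using borel_measurable_continuous_on[OF linear_continuous_on[OF matrix_vector_mul_bounded_linear]]
      by blast
    show "norm (M *v h t) \<le> onorm ((*v) M) * norm (h t)" for t
      by (rule onorm) (rule matrix_vector_mul_bounded_linear)
  qed
  with * show "L2_eq (\<lambda>t. M *v f t) (\<lambda>t. M *v g t)"
    by (auto simp: L2_eq_def)
qed

text \<open>
  \<open>L2_on T\<close> is the space of square-integrable functions on \<open>[0,T]\<close>, realised (by extension by
  zero) as a closed subspace of the square-integrable functions on the real line. For a class \<open>x\<close>,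
  \<open>rep_L2 x\<close> is an arbitrary representative; it is only used in ways that do not depend on the
  choice.
\<close>

definition L2_on :: "real \<Rightarrow> 'a::euclidean_space L2 set" where
  "L2_on T = {x. AE t in lborel. t \<notin> {0..T} \<longrightarrow> rep_L2 x t = 0}"


section \<open>The Sobolev space of order one on an interval\<close>

text \<open>
  Test functions are those of class \<open>C\<^sup>1\<close> with compact support in \<open>(0,T)\<close>. Both \<open>x\<close> and \<open>x'\<close>
  vanish outside of \<open>[0,T]\<close>, so the integrals are integrals over \<open>[0,T]\<close>.
\<close>

definition weak_derivative ::
    "real \<Rightarrow> 'a::euclidean_space L2 \<Rightarrow> 'a L2 \<Rightarrow> bool" where
  "weak_derivative T x x' \<longleftrightarrow> x \<in> L2_on T \<and> x' \<in> L2_on T \<and>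
     (\<forall>\<phi> \<phi>'. (\<forall>t. (\<phi> has_real_derivative \<phi>' t) (at t)) \<and> continuous_on UNIV \<phi>' \<and>
        (\<exists>a b. 0 < a \<and> b < T \<and> (\<forall>t. t \<notin> {a..b} \<longrightarrow> \<phi> t = 0)) \<longrightarrow>
        (LINT t|lborel. \<phi>' t *\<^sub>R rep_L2 x t) = - (LINT t|lborel. \<phi> t *\<^sub>R rep_L2 x' t))"

definition H1_on :: "real \<Rightarrow> 'a::euclidean_space L2 set" where
  "H1_on T = {x. \<exists>x'. weak_derivative T x x'}"

definition deriv_H1 :: "real \<Rightarrow> 'a::euclidean_space L2 \<Rightarrow> 'a L2" where
  "deriv_H1 T x = (THE x'. weak_derivative T x x')"

text \<open>Point evaluation at \<open>t \<in> [0,T]\<close> is that of the continuous representative on \<open>[0,T]\<close>.\<close>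

definition eval_H1 :: "real \<Rightarrow> 'a::euclidean_space L2 \<Rightarrow> real \<Rightarrow> 'a" where
  "eval_H1 T x t = (THE c. \<exists>v. continuous_on {0..T} v \<and>
     (AE s in lborel. s \<in> {0..T} \<longrightarrow> v s = rep_L2 x s) \<and> v t = c)"


section \<open>Operators on Hilbert spaces\<close>

text \<open>
  Hilbert spaces are complete subspaces \<open>X\<close> of an ambient inner product space, and an operator
  from a subset \<open>D\<close> of \<open>X\<close> is a function of which only the values on \<open>D\<close> matter.
\<close>

definition hilbert_space :: "'a::real_inner set \<Rightarrow> bool" where
  "hilbert_space X \<longleftrightarrow> subspace X \<and> complete X"

definition linear_operator ::
    "'a::real_vector set \<Rightarrow> ('a \<Rightarrow> 'b::real_vector) \<Rightarrow> bool" where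
  "linear_operator D A \<longleftrightarrow> subspace D \<and>
     (\<forall>x\<in>D. \<forall>y\<in>D. A (x + y) = A x + A y) \<and> (\<forall>c. \<forall>x\<in>D. A (c *\<^sub>R x) = c *\<^sub>R A x)"

definition adjoint_domain ::
    "'a::real_inner set \<Rightarrow> 'b::real_inner set \<Rightarrow> 'a set \<Rightarrow> ('a \<Rightarrow> 'b) \<Rightarrow> 'b set" where
  "adjoint_domain X Z D A = {z\<in>Z. \<exists>y\<in>X. \<forall>x\<in>D. A x \<bullet> z = x \<bullet> y}"

definition adjoint_operator ::
    "'a::real_inner set \<Rightarrow> 'a set \<Rightarrow> ('a \<Rightarrow> 'b::real_inner) \<Rightarrow> 'b \<Rightarrow> 'a" where
  "adjoint_operator X D A z = (THE y. y \<in> X \<and> (\<forall>x\<in>D. A x \<bullet> z = x \<bullet> y))"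

definition skew_adjoint :: "'a::real_inner set \<Rightarrow> 'a set \<Rightarrow> ('a \<Rightarrow> 'a) \<Rightarrow> bool" where
  "skew_adjoint X D J \<longleftrightarrow> D \<subseteq> X \<and> J ` D \<subseteq> X \<and> X \<subseteq> closure D \<and>
     adjoint_domain X X D J = D \<and> (\<forall>z\<in>D. adjoint_operator X D J z = - J z)"

text \<open>The orthogonal projection onto a nonempty closed convex set.\<close>

definition projection_onto :: "'a::real_inner set \<Rightarrow> 'a \<Rightarrow> 'a" where
  "projection_onto F u = (THE v. v \<in> F \<and> (\<forall>z\<in>F. dist u v \<le> dist u z))"

definition has_gradient_on ::
    "'a::real_inner set \<Rightarrow> ('a \<Rightarrow> real) \<Rightarrow> 'a \<Rightarrow> 'a \<Rightarrow> bool" where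
  "has_gradient_on X f g x \<longleftrightarrow>
     g \<in> X \<and> (f has_derivative (\<lambda>h. g \<bullet> h)) (at x within X)"

definition gradient_on :: "'a::real_inner set \<Rightarrow> ('a \<Rightarrow> real) \<Rightarrow> 'a \<Rightarrow> 'a" where
  "gradient_on X f x = (THE g. has_gradient_on X f g x)"

definition strongly_convex_on ::
    "real \<Rightarrow> 'a::real_normed_vector set \<Rightarrow> ('a \<Rightarrow> real) \<Rightarrow> bool" where
  "strongly_convex_on \<mu> X f \<longleftrightarrow> convex X \<and>
     (\<forall>x\<in>X. \<forall>y\<in>X. \<forall>s\<in>{0..1}. f ((1 - s) *\<^sub>R x + s *\<^sub>R y)
        \<le> (1 - s) * f x + s * f y - \<mu> / 2 * s * (1 - s) * (norm (x - y))\<^sup>2)"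


section \<open>Unitary groups and mild solutions\<close>

definition unitary_C0_group :: "'a::real_inner set \<Rightarrow> (real \<Rightarrow> 'a \<Rightarrow> 'a) \<Rightarrow> bool" where
  "unitary_C0_group X S \<longleftrightarrow>
     (\<forall>t. linear_operator X (S t) \<and> S t ` X = X \<and> (\<forall>x\<in>X. norm (S t x) = norm x)) \<and>
     (\<forall>x\<in>X. S 0 x = x) \<and>
     (\<forall>s t. \<forall>x\<in>X. S (s + t) x = S s (S t x)) \<and>
     (\<forall>x\<in>X. continuous_on UNIV (\<lambda>t. S t x))"

definition generates ::
    "'a::real_inner set \<Rightarrow> 'a set \<Rightarrow> ('a \<Rightarrow> 'a) \<Rightarrow> (real \<Rightarrow> 'a \<Rightarrow> 'a) \<Rightarrow> bool" where
  "generates X D J S \<longleftrightarrow>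
     D = {x\<in>X. \<exists>y\<in>X. ((\<lambda>h. (S h x - x) /\<^sub>R h) \<longlongrightarrow> y) (at 0)} \<and>
     (\<forall>x\<in>D. ((\<lambda>h. (S h x - x) /\<^sub>R h) \<longlongrightarrow> J x) (at 0))"

text \<open>The generated group is determined by its generator on \<open>X\<close>, but not outside of \<open>X\<close>.\<close>

definition unitary_group_of ::
    "'a::real_inner set \<Rightarrow> 'a set \<Rightarrow> ('a \<Rightarrow> 'a) \<Rightarrow> real \<Rightarrow> 'a \<Rightarrow> 'a" where
  "unitary_group_of X D J = (SOME S. unitary_C0_group X S \<and> generates X D J S)"

text \<open>Mild solutions in \<open>X\<close> of \<open>w' = J w - R w - c\<close> with \<open>w 0 = w0\<close>.\<close>

definition mild_solution ::
    "'a::real_inner set \<Rightarrow> 'a set \<Rightarrow> ('a \<Rightarrow> 'a) \<Rightarrow> ('a \<Rightarrow> 'a) \<Rightarrow> 'a \<Rightarrow> 'a \<Rightarrow> (real \<Rightarrow> 'a) \<Rightarrow> bool" where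
  "mild_solution X D J R c w0 w \<longleftrightarrow> continuous_on {0..} w \<and> w ` {0..} \<subseteq> X \<and>
     (\<forall>t\<ge>0. w t = unitary_group_of X D J t w0
        - integral {0..t} (\<lambda>s. unitary_group_of X D J (t - s) (R (w s) + c)))"

definition steady_state ::
    "'a::real_vector set \<Rightarrow> ('a \<Rightarrow> 'a) \<Rightarrow> ('a \<Rightarrow> 'a) \<Rightarrow> 'a \<Rightarrow> 'a \<Rightarrow> bool" where
  "steady_state D J R c w \<longleftrightarrow> w \<in> D \<and> J w - R w - c = 0"


section \<open>Autonomous port-Hamiltonian systems\<close>

text \<open>Autonomous systems have neither input nor output, hence no input operator.\<close>

definition port_hamiltonian ::
    "'a::real_inner set \<Rightarrow> ('a \<Rightarrow> real) \<Rightarrow> 'a set \<Rightarrow> ('a \<Rightarrow> 'a) \<Rightarrow> ('a \<Rightarrow> 'a) \<Rightarrow> bool" where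
  "port_hamiltonian X H D J R \<longleftrightarrow>
     hilbert_space X \<and>
     H differentiable_on X \<and> (\<exists>\<mu>>0. strongly_convex_on \<mu> X H) \<and>
     D \<subseteq> X \<and> J ` D \<subseteq> X \<and> (\<forall>z\<in>D. J z \<bullet> z = 0) \<and>
     R ` X \<subseteq> X \<and> continuous_on X R \<and> (\<forall>z\<in>X. R z \<bullet> z \<ge> 0)"

definition incrementally_monotone_port_hamiltonian ::
    "'a::real_inner set \<Rightarrow> ('a \<Rightarrow> real) \<Rightarrow> 'a set \<Rightarrow> ('a \<Rightarrow> 'a) \<Rightarrow> ('a \<Rightarrow> 'a) \<Rightarrow> bool" where
  "incrementally_monotone_port_hamiltonian X H D J R \<longleftrightarrow>
     port_hamiltonian X H D J R \<and>
     linear_operator D J \<and> skew_adjoint X D J \<and>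
     (\<forall>z1\<in>X. \<forall>z2\<in>X. (R z1 - R z2) \<bullet> (z1 - z2) \<ge> 0)"

text \<open>The right-hand side of the system generated by \<open>(H, J, R)\<close>.\<close>

definition port_hamiltonian_rhs ::
    "'a::real_inner set \<Rightarrow> ('a \<Rightarrow> real) \<Rightarrow> ('a \<Rightarrow> 'a) \<Rightarrow> ('a \<Rightarrow> 'a) \<Rightarrow> 'a \<Rightarrow> 'a" where
  "port_hamiltonian_rhs X H J R z = J (gradient_on X H z) - R (gradient_on X H z)"

definition shifted_hamiltonian ::
    "'a::real_inner set \<Rightarrow> ('a \<Rightarrow> real) \<Rightarrow> 'a \<Rightarrow> 'a \<Rightarrow> real" where
  "shifted_hamiltonian X H v w = H w - H v - gradient_on X H v \<bullet> (w - v)"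


section \<open>The primal-dual gradient dynamics\<close>

type_synonym 'n state = "(real^'n) L2"
type_synonym 'n costate = "(real^'n) L2 \<times> (real^'n)"

definition Z_space :: "real \<Rightarrow> 'n::finite costate set" where
  "Z_space T = L2_on T \<times> UNIV"

definition W_space :: "real \<Rightarrow> ('n::finite state \<times> 'n costate) set" where
  "W_space T = L2_on T \<times> Z_space T"

definition box_controls :: "real \<Rightarrow> real^'m \<Rightarrow> real^'m \<Rightarrow> (real^'m::finite) L2 set" where
  "box_controls T ulo uhi = {u \<in> L2_on T. AE t in lborel. t \<in> {0..T} \<longrightarrow>
     (\<forall>i. ulo $ i \<le> rep_L2 u t $ i \<and> rep_L2 u t $ i \<le> uhi $ i)}"

definition running_cost :: "real \<Rightarrow> (real^'n::finite \<Rightarrow> real) \<Rightarrow> 'n state \<Rightarrow> real" where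
  "running_cost T l x = (LINT t:{0..T}|lborel. l (rep_L2 x t))"

definition op_A :: "real \<Rightarrow> real^'n^'n \<Rightarrow> 'n::finite state \<Rightarrow> 'n costate" where
  "op_A T A x = (deriv_H1 T x - matrix_L2 A x, eval_H1 T x 0)"

definition dom_A_adj :: "real \<Rightarrow> real^'n^'n \<Rightarrow> 'n::finite costate set" where
  "dom_A_adj T A = adjoint_domain (L2_on T) (Z_space T) (H1_on T) (op_A T A)"

definition op_A_adj :: "real \<Rightarrow> real^'n^'n \<Rightarrow> 'n::finite costate \<Rightarrow> 'n state" where
  "op_A_adj T A = adjoint_operator (L2_on T) (H1_on T) (op_A T A)"

definition op_B :: "real^'m^'n \<Rightarrow> (real^'m::finite) L2 \<Rightarrow> 'n::finite costate" where
  "op_B B u = (matrix_L2 B u, 0)"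

definition op_B_adj :: "real \<Rightarrow> real^'m^'n \<Rightarrow> 'n::finite costate \<Rightarrow> (real^'m::finite) L2" where
  "op_B_adj T B = adjoint_operator (L2_on T) (L2_on T) (op_B B)"

definition dom_J :: "real \<Rightarrow> real^'n^'n \<Rightarrow> ('n::finite state \<times> 'n costate) set" where
  "dom_J T A = H1_on T \<times> dom_A_adj T A"

definition op_J ::
    "real \<Rightarrow> real^'n^'n \<Rightarrow> 'n::finite state \<times> 'n costate \<Rightarrow> 'n state \<times> 'n costate" where
  "op_J T A = (\<lambda>(x, p). (- op_A_adj T A p, op_A T A x))"

definition op_R ::
    "real \<Rightarrow> real^'m^'n \<Rightarrow> real \<Rightarrow> real^'m \<Rightarrow> real^'m \<Rightarrow> ('n state \<Rightarrow> 'n state) \<Rightarrow>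
     'n::finite state \<times> 'n costate \<Rightarrow> 'n state \<times> 'n costate" where
  "op_R T B \<alpha> ulo uhi gradJ = (\<lambda>(x, p).
     (gradJ x, op_B B (projection_onto (box_controls T ulo uhi) ((1 / \<alpha>) *\<^sub>R op_B_adj T B p))))"

definition op_S ::
    "real \<Rightarrow> real^'n^'n \<Rightarrow> real^'m^'n \<Rightarrow> real \<Rightarrow> real^'m \<Rightarrow> real^'m \<Rightarrow> ('n state \<Rightarrow> 'n state) \<Rightarrow>
     'n::finite state \<times> 'n costate \<Rightarrow> 'n state \<times> 'n costate" where
  "op_S T A B \<alpha> ulo uhi gradJ w = op_J T A w - op_R T B \<alpha> ulo uhi gradJ w"

definition half_norm_sq :: "'a::real_normed_vector \<Rightarrow> real" where
  "half_norm_sq w = (norm w)\<^sup>2 / 2"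

end

theory Submission
  imports Defs
begin

text \<open>
  The operator \<open>A\<close> is inverted by the bounded operator \<open>K\<close> solving the linear initial value problem,
  so \<open>J\<close> has the bounded, injective, skew inverse \<open>G (f, g) = (K g, - K\<^sup>* f)\<close>. This makes \<open>J\<close>
  skew-adjoint without any computation of the adjoint of \<open>A\<close>, and \<open>- G (e\<^sup>2 - G\<^sup>2)\<^sup>-\<^sup>1\<close> are bounded skew
  approximations of \<open>J\<close> whose groups converge to the unitary group \<open>S\<close> generated by \<open>J\<close>. If \<open>w\<close> is a
  mild solution then \<open>z t = S (- t) (w t)\<close> solves an ordinary differential equation with Lipschitz
  right-hand side, and monotonicity of \<open>R\<close> shows that the distance of two mild solutions does not
  increase. This gives existence and uniqueness, and also the decay estimate, because a steady state
  is itself a mild solution. Eliminating the state and the costate, the optimality system becomes a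
  strongly monotone variational inequality for the control, solved by a projected gradient step that
  is a contraction.
\<close>

section \<open>Projections and bounded operators on Hilbert spaces\<close>

text \<open>The spaces of the problem are closed subspaces of a Banach type, and generators and
  groups are meaningful only on them. Hence \<open>G\<close> is a bounded operator on the whole type
  with range in \<open>X\<close>, injective on \<open>X\<close> only, and arguments that need an
  operator on the whole type insert the orthogonal projection onto \<open>X\<close>. In terms of
  \<open>J\<close> the approximation is \<open>J (1 - e^2 J^2)^-1\<close>, the mean of
  \<open>J (1 - e J)^-1\<close> and \<open>J (1 + e J)^-1\<close>. A single one of these Yosida-type
  approximations is not skew; the mean is, so its group preserves the norm for all real times. Two
  obstacles remain in the nonlinear part. The hypotheses bound the product of the increments of
  gradient and argument from above, not the gradient increments themselves; a Lipschitz bound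
  follows because the field is the gradient of a convex function. And \<open>R\<close> is strongly
  monotone in the state only, so uniqueness of the steady state needs a second step: equal states
  have equal gradients, and \<open>K\<^sup>*\<close> determines the costate from the
  gradient.\<close>

lemma closed_subspace_projection:
  fixes S :: "'a::{real_inner,banach} set"
  assumes S: "subspace S" "closed S"
  shows "\<exists>p\<in>S. \<forall>z\<in>S. (x - p) \<bullet> z = 0"
proof -
  define E where "E z = (norm (x - z))\<^sup>2" for z
  define I where "I = Inf (E ` S)"
  have S0: "0 \<in> S" using S by (simp add: subspace_0)
  have bdd: "bdd_below (E ` S)" by (rule bdd_belowI[of _ 0]) (auto simp: E_def)
  have I_le: "I \<le> E z" if "z \<in> S" for z
    unfolding I_def using bdd that by (intro cINF_lower) auto
  have "\<exists>z\<in>S. E z < I + inverse (real (Suc n))" for n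
  proof -
    have "I < I + inverse (real (Suc n))" by simp
    then show ?thesis unfolding I_def using cInf_lessD[of "E ` S"] S0 by fastforce
  qed
  then obtain z where z: "\<And>n. z n \<in> S" "\<And>n. E (z n) < I + inverse (real (Suc n))" by metis
  \<comment> \<open>The parallelogram law: the midpoint of \<open>a\<close> and \<open>b\<close>
    lies in \<open>S\<close>, so its energy is at least \<open>I\<close>. This makes every
    minimising sequence Cauchy.\<close>
  have par: "(norm (a - b))\<^sup>2 \<le> 2 * (E a - I) + 2 * (E b - I)" if "a \<in> S" "b \<in> S" for a b
  proof -
    have "(1/2) *\<^sub>R (a + b) \<in> S" using S that by (simp add: subspace_add subspace_scale)
    then have "I \<le> E ((1/2) *\<^sub>R (a + b))" by (rule I_le)
    moreover have "(norm (a - b))\<^sup>2 = 2 * E a + 2 * E b - 4 * E ((1/2) *\<^sub>R (a + b))"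
      unfolding E_def power2_norm_eq_inner by (simp add: algebra_simps inner_commute)
    ultimately show ?thesis by simp
  qed
  have "Cauchy z"
  proof (rule metric_CauchyI)
    fix e :: real assume e: "e > 0"
    then obtain N where N: "inverse (real (Suc N)) < e\<^sup>2 / 4"
      using reals_Archimedean[of "e\<^sup>2 / 4"] by auto
    show "\<exists>M. \<forall>m\<ge>M. \<forall>n\<ge>M. dist (z m) (z n) < e"
    proof (intro exI allI impI)
      fix m n assume mn: "m \<ge> N" "n \<ge> N"
      have le: "inverse (real (Suc k)) \<le> inverse (real (Suc N))" if "k \<ge> N" for k
        using that by (intro le_imp_inverse_le) auto
      have "(norm (z m - z n))\<^sup>2 < e\<^sup>2"
      proof -
        have "E (z m) - I < e\<^sup>2 / 4" "E (z n) - I < e\<^sup>2 / 4"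
          using less_le_trans[OF z(2)[of m] add_left_mono[OF le[OF mn(1)]]]
            less_le_trans[OF z(2)[of n] add_left_mono[OF le[OF mn(2)]]] N by auto
        then show ?thesis using par[OF z(1) z(1), of m n] by simp
      qed
      then show "dist (z m) (z n) < e"
        using e by (simp add: dist_norm power2_less_imp_less)
    qed
  qed
  then obtain p where p: "z \<longlonglongrightarrow> p" using Cauchy_convergent_iff convergent_def by blast
  have pS: "p \<in> S" using closed_sequentially[OF S(2)] z(1) p by blast
  have "(\<lambda>n. E (z n)) \<longlonglongrightarrow> E p" unfolding E_def by (intro tendsto_intros p)
  moreover have "(\<lambda>n. I + inverse (real (Suc n))) \<longlonglongrightarrow> I + 0"
    by (intro tendsto_intros LIMSEQ_inverse_real_of_nat)
  ultimately have "E p \<le> I + 0"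
    by (rule LIMSEQ_le) (use z(2) in \<open>auto intro!: less_imp_le\<close>)
  then have Ep: "E p \<le> I" by simp
  show ?thesis
  proof (intro bexI[OF _ pS] ballI)
    fix y assume y: "y \<in> S"
    \<comment> \<open>The competitor \<open>p + (d / q) *\<^sub>R y\<close> is nearly the best point
      on the line through \<open>p\<close> in direction \<open>y\<close>; adding 1 to the squared
      norm of \<open>y\<close> keeps the divisor positive when \<open>y = 0\<close>.\<close>
    define d where "d = (x - p) \<bullet> y"
    define q where "q = (norm y)\<^sup>2 + 1"
    have q: "q > 0" unfolding q_def by (simp add: add_nonneg_pos)
    have "p + (d / q) *\<^sub>R y \<in> S" using S pS y by (simp add: subspace_add subspace_scale)
    from I_le[OF this] Ep have "E p \<le> E (p + (d / q) *\<^sub>R y)" by simp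
    also have "E (p + r *\<^sub>R y) = E p - 2 * r * d + r\<^sup>2 * (q - 1)" for r
      unfolding E_def d_def q_def power2_norm_eq_inner
      by (simp add: algebra_simps inner_commute power2_eq_square)
    finally have "2 * (d / q) * d \<le> (d / q)\<^sup>2 * (q - 1)" by simp
    moreover have "2 * (d / q) * d = (d / q)\<^sup>2 * (2 * q)"
      using q by (simp add: power2_eq_square)
    ultimately have "(d / q)\<^sup>2 * (q + 1) \<le> 0" by (simp add: algebra_simps)
    then have "(d / q)\<^sup>2 \<le> 0" using q by (simp add: mult_le_0_iff)
    then show "d = 0" using q by simp
  qed
qed

text \<open>Uniqueness of the orthogonal decomposition gives linearity, Pythagoras the bound by 1.
  Composition with \<open>P\<close> extends to the whole type operators that are linear on the
  subspace only.\<close>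

lemma closed_subspace_bounded_projection:
  fixes S :: "'a::{real_inner,banach} set"
  assumes S: "subspace S" "closed S"
  obtains P where "bounded_linear P" "\<And>x. P x \<in> S" "\<And>x. x \<in> S \<Longrightarrow> P x = x"
    "\<And>x z. z \<in> S \<Longrightarrow> (x - P x) \<bullet> z = 0"
proof -
  obtain P where P: "\<And>x. P x \<in> S" "\<And>x z. z \<in> S \<Longrightarrow> (x - P x) \<bullet> z = 0"
    using closed_subspace_projection[OF S] by metis
  have uniq: "P x = p" if "p \<in> S" "\<And>z. z \<in> S \<Longrightarrow> (x - p) \<bullet> z = 0" for x p
  proof -
    have d: "P x - p \<in> S" using S P that by (simp add: subspace_diff)
    have "(P x - p) \<bullet> (P x - p) = (x - p) \<bullet> (P x - p) - (x - P x) \<bullet> (P x - p)"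
      by (simp add: algebra_simps)
    also have "\<dots> = 0" using P(2)[OF d] that(2)[OF d] by simp
    finally show ?thesis by simp
  qed
  have "bounded_linear P"
  proof (rule bounded_linear_intro)
    show "P (x + y) = P x + P y" for x y
    proof (rule uniq)
      show "P x + P y \<in> S" using S P by (simp add: subspace_add)
      show "(x + y - (P x + P y)) \<bullet> z = 0" if "z \<in> S" for z
        using P(2)[OF that, of x] P(2)[OF that, of y] by (simp add: algebra_simps)
    qed
    show "P (c *\<^sub>R x) = c *\<^sub>R P x" for c x
    proof (rule uniq)
      show "c *\<^sub>R P x \<in> S" using S P by (simp add: subspace_scale)
      show "(c *\<^sub>R x - c *\<^sub>R P x) \<bullet> z = 0" if "z \<in> S" for z
        using P(2)[OF that, of x] by (simp add: algebra_simps)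
    qed
    show "norm (P x) \<le> norm x * 1" for x
    proof -
      have "(norm x)\<^sup>2 = (norm (x - P x))\<^sup>2 + (norm (P x))\<^sup>2"
        using P(2)[OF P(1), of x x] unfolding power2_norm_eq_inner by (simp add: algebra_simps inner_commute)
      then have "(norm (P x))\<^sup>2 \<le> (norm x)\<^sup>2" by simp
      then show ?thesis by simp
    qed
  qed
  with P uniq show ?thesis by (intro that[of P]) auto
qed

text \<open>The kernel has codimension one: the component normal to it of any \<open>x\<close> with
  \<open>f x \<noteq> 0\<close> spans its complement, and a multiple of that component represents
  \<open>f\<close>.\<close>

lemma riesz_representation:
  fixes f :: "'a::{real_inner,banach} \<Rightarrow> real"
  assumes f: "bounded_linear f"
  shows "\<exists>y. \<forall>x. f x = x \<bullet> y"
proof (cases "\<forall>x. f x = 0")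
  case True
  then show ?thesis by (intro exI[of _ 0]) simp
next
  case False
  interpret bounded_linear f by (rule f)
  define S where "S = {x. f x = 0}"
  have "subspace S" by (auto simp: S_def subspace_def add scale zero)
  moreover have "closed S"
    unfolding S_def by (intro closed_Collect_eq linear_continuous_on f continuous_on_const)
  moreover obtain x where x: "f x \<noteq> 0" using False by auto
  ultimately obtain p where p: "p \<in> S" "\<And>z. z \<in> S \<Longrightarrow> (x - p) \<bullet> z = 0"
    using closed_subspace_projection by metis
  define n where "n = x - p"
  have fn: "f n \<noteq> 0" using x p(1) by (simp add: n_def diff S_def)
  have n0: "n \<bullet> n \<noteq> 0" using fn zero by auto
  have "f z = z \<bullet> ((f n / (n \<bullet> n)) *\<^sub>R n)" for z
  proof -
    have "z - (f z / f n) *\<^sub>R n \<in> S" using fn by (simp add: S_def diff scale)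
    then have "n \<bullet> (z - (f z / f n) *\<^sub>R n) = 0" using p(2) by (simp add: n_def)
    then have "n \<bullet> z = (f z / f n) * (n \<bullet> n)" by (simp add: inner_diff_right)
    then show ?thesis using fn n0 by (simp add: inner_commute)
  qed
  then show ?thesis by blast
qed

lemma bounded_linear_adjoint:
  fixes K :: "'a::{real_inner,banach} \<Rightarrow> 'b::real_inner"
  assumes K: "bounded_linear K"
  obtains K' where "bounded_linear K'" "\<And>x y. K x \<bullet> y = x \<bullet> K' y"
proof -
  have "\<exists>y'. \<forall>x. K x \<bullet> y = x \<bullet> y'" for y
    using riesz_representation[OF bounded_linear_compose[OF bounded_linear_inner_left K]] by simp
  then obtain K' where K': "\<And>x y. K x \<bullet> y = x \<bullet> K' y" by metis
  obtain B where B: "\<And>x. norm (K x) \<le> norm x * B" "B > 0"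
    using bounded_linear.pos_bounded[OF K] by blast
  have "bounded_linear K'"
  proof (rule bounded_linear_intro)
    show "K' (x + y) = K' x + K' y" for x y
      by (rule vector_eq_rdot[THEN iffD1]) (simp flip: K' add: inner_add_right inner_commute)
    show "K' (c *\<^sub>R x) = c *\<^sub>R K' x" for c x
      by (rule vector_eq_rdot[THEN iffD1]) (simp flip: K' add: inner_commute)
    show "norm (K' x) \<le> norm x * B" for x
    proof -
      have "(norm (K' x))\<^sup>2 = K (K' x) \<bullet> x" by (simp add: K' power2_norm_eq_inner)
      also have "\<dots> \<le> norm (K (K' x)) * norm x" by (rule norm_cauchy_schwarz)
      also have "\<dots> \<le> norm (K' x) * B * norm x" by (intro mult_right_mono B) simp
      finally have "norm (K' x) * norm (K' x) \<le> norm (K' x) * (norm x * B)"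
        by (simp add: power2_eq_square mult_ac)
      then show ?thesis using B(2)
        by (cases "norm (K' x) = 0") (auto simp: mult_le_cancel_left)
    qed
  qed
  then show ?thesis by (rule that[OF _ K'])
qed

text \<open>Expanding the square shows that a step of length \<open>t\<close> before
  \<open>Q\<close> multiplies squared distances by at most
  \<open>1 - 2 * t * c + t\<^sup>2 * L\<^sup>2\<close>. With \<open>Q\<close> the identity the fixed
  point is a zero of \<open>N\<close>; with \<open>Q\<close> a projection onto a convex set it
  solves the variational inequality for \<open>N\<close>.\<close>

lemma strongly_monotone_projected_fixpoint:
  fixes N Q :: "'a::{real_inner,banach} \<Rightarrow> 'a"
  assumes c: "c > 0"
    and mono: "\<And>x y. c * (norm (x - y))\<^sup>2 \<le> (N x - N y) \<bullet> (x - y)"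
    and lip: "\<And>x y. norm (N x - N y) \<le> L * norm (x - y)"
    and Q: "\<And>x y. norm (Q x - Q y) \<le> norm (x - y)"
  shows "\<exists>\<tau>>0. \<exists>u. Q (u - \<tau> *\<^sub>R N u) = u"
proof -
  \<comment> \<open>The step \<open>c / L\<^sup>2\<close> would minimise the contraction factor;
    adding \<open>c\<^sup>2\<close> to the divisor keeps it positive for \<open>L = 0\<close> and
    keeps \<open>c\<^sup>2 / s\<close> at most 1.\<close>
  define s where "s = L\<^sup>2 + c\<^sup>2"
  have s: "s > 0" using c by (simp add: s_def add_nonneg_pos)
  define t where "t = c / s"
  have t: "t > 0" using c s by (simp add: t_def)
  define q where "q = sqrt (1 - c\<^sup>2 / s)"
  have cs: "0 < c\<^sup>2 / s" "c\<^sup>2 / s \<le> 1" using c s by (auto simp: s_def)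
  have q: "0 \<le> q" "q < 1" using cs by (auto simp: q_def)
  define F where "F u = Q (u - t *\<^sub>R N u)" for u
  have "norm (F x - F y) \<le> q * norm (x - y)" for x y
  proof -
    have lip2: "(norm (N x - N y))\<^sup>2 \<le> L\<^sup>2 * (norm (x - y))\<^sup>2"
      using power_mono[OF lip norm_ge_zero, of x y 2] by (simp add: power_mult_distrib)
    have "(norm (F x - F y))\<^sup>2 \<le> (norm ((x - y) - t *\<^sub>R (N x - N y)))\<^sup>2"
      unfolding F_def using Q[of "x - t *\<^sub>R N x" "y - t *\<^sub>R N y"]
      by (intro power_mono) (auto simp: algebra_simps)
    also have "\<dots> = (norm (x - y))\<^sup>2 - 2 * t * ((N x - N y) \<bullet> (x - y)) + t\<^sup>2 * (norm (N x - N y))\<^sup>2"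
      unfolding power2_norm_eq_inner by (simp add: algebra_simps inner_commute power2_eq_square)
    also have "\<dots> \<le> (norm (x - y))\<^sup>2 - 2 * t * (c * (norm (x - y))\<^sup>2) + t\<^sup>2 * (L\<^sup>2 * (norm (x - y))\<^sup>2)"
      using mono[of x y] lip2 t by (intro add_mono diff_mono mult_left_mono) auto
    also have "\<dots> = (1 - 2 * t * c + t\<^sup>2 * L\<^sup>2) * (norm (x - y))\<^sup>2" by (simp add: algebra_simps)
    also have "\<dots> \<le> (1 - c\<^sup>2 / s) * (norm (x - y))\<^sup>2"
    proof (rule mult_right_mono)
      have "t\<^sup>2 * L\<^sup>2 = c\<^sup>2 / s * (L\<^sup>2 / s)" by (simp add: t_def power2_eq_square)
      also have "\<dots> \<le> c\<^sup>2 / s * 1" using s cs by (intro mult_left_mono) (auto simp: s_def)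
      finally have "t\<^sup>2 * L\<^sup>2 \<le> c\<^sup>2 / s" by simp
      moreover have "t * c = c\<^sup>2 / s" by (simp add: t_def power2_eq_square)
      ultimately show "1 - 2 * t * c + t\<^sup>2 * L\<^sup>2 \<le> 1 - c\<^sup>2 / s" by simp
    qed simp
    also have "\<dots> = (q * norm (x - y))\<^sup>2" using cs by (simp add: q_def power_mult_distrib)
    finally show ?thesis by (rule power2_le_imp_le) (use q in simp)
  qed
  then have "\<exists>!u. F u = u" using q by (intro banach_fix_type[of q]) (auto simp: dist_norm)
  then show ?thesis using t unfolding F_def by blast
qed

text \<open>The equation \<open>M u = f\<close> is the zero problem for the strongly monotone map
  \<open>M u - f\<close>. Coercivity also bounds \<open>M\<close> from below, which gives
  injectivity and the bound \<open>1 / c\<close> for the inverse.\<close>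

lemma lax_milgram:
  fixes M :: "'a::{real_inner,banach} \<Rightarrow> 'a"
  assumes M: "bounded_linear M" and c: "c > 0" and coercive: "\<And>x. c * (norm x)\<^sup>2 \<le> M x \<bullet> x"
  obtains M' where "bounded_linear M'" "\<And>x. M (M' x) = x" "\<And>x. M' (M x) = x"
proof -
  interpret M: bounded_linear M by (rule M)
  obtain B where B: "\<And>x. norm (M x) \<le> norm x * B" using M.bounded by blast
  have "\<exists>u. M u = f" for f
  proof -
    have "\<exists>\<tau>>0. \<exists>u. id (u - \<tau> *\<^sub>R (M u - f)) = u"
    proof (rule strongly_monotone_projected_fixpoint[OF c, where L = B])
      show "c * (norm (x - y))\<^sup>2 \<le> (M x - f - (M y - f)) \<bullet> (x - y)" for x y
        using coercive[of "x - y"] by (simp add: M.diff)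
      show "norm (M x - f - (M y - f)) \<le> B * norm (x - y)" for x y
        using B[of "x - y"] by (simp add: M.diff mult.commute)
    qed simp
    then show ?thesis by force
  qed
  then obtain M' where M': "\<And>x. M (M' x) = x" by metis
  have lower: "c * norm x \<le> norm (M x)" for x
  proof (cases "x = 0")
    case False
    have "(c * norm x) * norm x \<le> norm (M x) * norm x"
      using coercive[of x] norm_cauchy_schwarz[of "M x" x] by (simp add: power2_eq_square mult_ac)
    then show ?thesis using False by simp
  qed (simp add: M.zero)
  have inj: "x = y" if "M x = M y" for x y
    using lower[of "x - y"] that c by (simp add: M.diff mult_le_0_iff)
  have "bounded_linear M'"
  proof (rule bounded_linear_intro)
    show "M' (x + y) = M' x + M' y" for x y by (rule inj) (simp add: M' M.add)
    show "M' (r *\<^sub>R x) = r *\<^sub>R M' x" for r x by (rule inj) (simp add: M' M.scale)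
    show "norm (M' x) \<le> norm x * (1 / c)" for x
      using lower[of "M' x"] c by (simp add: M' field_simps)
  qed
  with M' inj show ?thesis by (intro that[of M']) (auto simp: M')
qed

lemma bounded_linear_nonneg_bound:
  assumes "bounded_linear f"
  obtains K where "K \<ge> 0" "\<And>x. norm (f x) \<le> K * norm x"
  using bounded_linear.nonneg_bounded[OF assms] by (metis mult.commute)

section \<open>Ordinary differential equations in Banach spaces\<close>

text \<open>The primitive of \<open>h\<close> vanishing at 0, on the whole line. For each
  \<open>t\<close> at least one of the two intervals is empty or a point, so a single term survives,
  with the right sign for negative \<open>t\<close>.\<close>

definition signed_integral :: "(real \<Rightarrow> 'a::banach) \<Rightarrow> real \<Rightarrow> 'a" where
  "signed_integral h t = integral {0..t} h - integral {t..0} h"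

lemma signed_integral_0 [simp]: "signed_integral h 0 = 0"
  by (simp add: signed_integral_def)

lemma signed_integral_diff:
  assumes "continuous_on UNIV g" "continuous_on UNIV h"
  shows "signed_integral (\<lambda>s. g s - h s) t = signed_integral g t - signed_integral h t"
proof -
  have "g integrable_on {a..b}" "h integrable_on {a..b}" for a b
    using assms by (auto intro: integrable_continuous_interval continuous_on_subset)
  then show ?thesis by (simp add: signed_integral_def integral_diff)
qed

text \<open>A base point to the left of both 0 and \<open>t\<close> replaces the case distinction by
  one formula, which can then be differentiated at 0 as well.\<close>

lemma signed_integral_eq:
  assumes h: "continuous_on UNIV h" and a: "a \<le> 0" "a \<le> t"
  shows "signed_integral h t = integral {a..t} h - integral {a..0} h"
proof (cases "t \<ge> 0")
  case True
  have "integral {a..0} h + integral {0..t} h = integral {a..t} h"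
    using a True
    by (intro Henstock_Kurzweil_Integration.integral_combine integrable_continuous_interval
        continuous_on_subset[OF h]) auto
  moreover have "integral {t..0} h = 0" using True by (cases "t = 0") auto
  ultimately show ?thesis by (simp add: signed_integral_def algebra_simps)
next
  case False
  have "integral {a..t} h + integral {t..0} h = integral {a..0} h"
    using a False
    by (intro Henstock_Kurzweil_Integration.integral_combine integrable_continuous_interval
        continuous_on_subset[OF h]) auto
  then show ?thesis using False by (simp add: signed_integral_def algebra_simps)
qed

lemma signed_integral_has_vector_derivative:
  assumes h: "continuous_on UNIV h"
  shows "(signed_integral h has_vector_derivative h t) (at t)"
proof -
  define a where "a = - \<bar>t\<bar> - 1"
  define b where "b = \<bar>t\<bar> + 1"
  have t: "t \<in> {a<..<b}" and a: "a \<le> 0" by (auto simp: a_def b_def)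
  have "((\<lambda>u. integral {a..u} h) has_vector_derivative h t) (at t within {a..b})"
    using t by (intro integral_has_vector_derivative continuous_on_subset[OF h]) auto
  moreover have "(at t within {a..b}) = at t"
    using t by (intro at_within_interior) (simp add: interior_atLeastAtMost_real)
  ultimately have "((\<lambda>u. integral {a..u} h - integral {a..0} h) has_vector_derivative h t - 0) (at t)"
    by (intro has_vector_derivative_diff has_vector_derivative_const) simp
  then have "((\<lambda>u. integral {a..u} h - integral {a..0} h) has_vector_derivative h t) (at t)" by simp
  then show ?thesis
    by (rule has_vector_derivative_transform_within_open[where S = "{a<..<b}"])
      (use t a signed_integral_eq[OF h a] in auto)
qed

text \<open>The gain of \<open>1 / k\<close> over the bound for \<open>h\<close> is what makes
  Picard iteration contract in the weighted norm. Negative times reduce to positive ones by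
  reflection.\<close>

lemma signed_integral_exp_bound:
  assumes h: "continuous_on UNIV h" and k: "k > 0" and M: "M \<ge> 0"
    and bound: "\<And>s. norm (h s) \<le> M * exp (k * \<bar>s\<bar>)"
  shows "norm (signed_integral h t) \<le> M / k * exp (k * \<bar>t\<bar>)"
proof -
  have pos: "norm (integral {0..t} g) \<le> M / k * exp (k * t)"
    if g: "continuous_on UNIV g" "\<And>s. norm (g s) \<le> M * exp (k * \<bar>s\<bar>)" and t: "t \<ge> 0"
    for t and g :: "real \<Rightarrow> 'a"
  proof -
    have I: "((\<lambda>s. M * exp (k * s)) has_integral (M / k * exp (k * t) - M / k * exp (k * 0))) {0..t}"
    proof (rule fundamental_theorem_of_calculus[OF t])
      show "((\<lambda>s. M / k * exp (k * s)) has_vector_derivative M * exp (k * x)) (at x within {0..t})" for x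
        using k by (auto intro!: derivative_eq_intros simp flip: has_real_derivative_iff_has_vector_derivative)
    qed
    have "norm (integral {0..t} g) \<le> integral {0..t} (\<lambda>s. M * exp (k * s))"
    proof (rule integral_norm_bound_integral)
      show "norm (g s) \<le> M * exp (k * s)" if "s \<in> {0..t}" for s using g(2)[of s] that by simp
    qed (use I continuous_on_subset[OF g(1)] in \<open>auto intro!: integrable_continuous_interval continuous_intros\<close>)
    also have "integral {0..t} (\<lambda>s. M * exp (k * s)) = M / k * exp (k * t) - M / k" using integral_unique[OF I] by simp
    finally have "norm (integral {0..t} g) \<le> M / k * exp (k * t) - M / k" .
    moreover have "0 \<le> M / k" using M k by simp
    ultimately show ?thesis by linarith
  qed
  show ?thesis
  proof (cases "t \<ge> 0")
    case True
    then have "signed_integral h t = integral {0..t} h" by (cases "t = 0") (auto simp: signed_integral_def)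
    then show ?thesis using pos[OF h bound True] True by simp
  next
    case False
    then have "signed_integral h t = - integral {t..0} h" by (simp add: signed_integral_def)
    also have "integral {t..0} h = integral {0..-t} (\<lambda>s. h (- s))"
      using Henstock_Kurzweil_Integration.integral_reflect_real[of 0 t h] by simp
    finally have eq: "norm (signed_integral h t) = norm (integral {0..-t} (\<lambda>s. h (- s)))" by simp
    have "continuous_on UNIV (\<lambda>s. h (- s))"
      by (rule continuous_on_compose2[OF h]) (auto intro!: continuous_intros)
    from pos[OF this, of "-t"] bound[of "- _"] False show ?thesis unfolding eq by simp
  qed
qed

text \<open>Picard iteration on the whole line at once: in the norm weighted by \<open>exp (- k \<bar>t\<bar>)\<close> with
  \<open>k\<close> large the integral operator is a contraction.\<close>

lemma global_ode_solution:
  fixes f :: "real \<Rightarrow> 'a::banach \<Rightarrow> 'a"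
  assumes cont: "\<And>u. continuous_on UNIV u \<Longrightarrow> continuous_on UNIV (\<lambda>t. f t (u t))"
    and lip: "\<And>t x y. norm (f t x - f t y) \<le> L * norm (x - y)"
    and bdd: "\<And>t. norm (f t 0) \<le> C"
  obtains u where "u 0 = u0" "\<And>t. (u has_vector_derivative f t (u t)) (at t)"
proof -
  define L' where "L' = \<bar>L\<bar> + 1"
  have L': "L' > 0" by (simp add: L'_def)
  have lip': "norm (f t x - f t y) \<le> L' * norm (x - y)" for t x y
    using lip[of t x y] by (rule order_trans) (auto intro!: mult_right_mono simp: L'_def)
  have C: "C \<ge> 0" using bdd[of 0] norm_ge_zero order_trans by blast
  \<comment> \<open>The contraction factor will be \<open>L' / k\<close>, hence 1/2.\<close>
  define k where "k = 2 * L'"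
  have k: "k > 0" using L' by (simp add: k_def)
  define E where "E t = exp (k * \<bar>t\<bar>)" for t :: real
  have E: "E t > 0" "E t \<ge> 1" for t using k by (auto simp: E_def)
  have contE: "continuous_on UNIV E" unfolding E_def by (intro continuous_intros)
  \<comment> \<open>The unknown is \<open>v = u / E\<close>, which is bounded; bounded continuous
    functions form the Banach space in which the fixed point is sought.\<close>
  define h where "h v t = f t (E t *\<^sub>R apply_bcontfun v t)" for v t
  have conth: "continuous_on UNIV (h v)" for v
    unfolding h_def by (intro cont continuous_intros contE) auto
  have contS: "continuous_on UNIV (signed_integral g)" if "continuous_on UNIV g" for g :: "real \<Rightarrow> 'a"
    using has_vector_derivative_continuous[OF signed_integral_has_vector_derivative[OF that]]
    by (simp add: continuous_on_eq_continuous_at)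
  have bh: "norm (h v t) \<le> (C + L' * norm v) * E t" for v t
  proof -
    have "norm (h v t) \<le> norm (h v t - f t 0) + norm (f t 0)"
      using norm_triangle_ineq[of "h v t - f t 0" "f t 0"] by simp
    also have "norm (h v t - f t 0) \<le> L' * (E t * norm v)"
      unfolding h_def using lip'[of t "E t *\<^sub>R apply_bcontfun v t" 0] E(1)[of t] L' norm_bounded[of v t]
      by (smt (verit) diff_zero mult_left_mono norm_scaleR)
    also have "norm (f t 0) \<le> C * E t" using bdd[of t] C E(2)[of t]
      using mult_left_mono[OF E(2)[of t] C] by simp
    finally show ?thesis by (simp add: algebra_simps)
  qed
  define \<Phi> where "\<Phi> v t = (1 / E t) *\<^sub>R (u0 + signed_integral (h v) t)" for v t
  have \<Phi>: "\<Phi> v \<in> bcontfun" for v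
  proof (rule bcontfun_normI)
    show "continuous_on UNIV (\<Phi> v)"
      unfolding \<Phi>_def using E(1) by (intro continuous_intros contE contS conth) (metis less_irrefl)
    show "norm (\<Phi> v t) \<le> norm u0 + (C + L' * norm v) / k" for t
    proof -
      have "norm (signed_integral (h v) t) \<le> (C + L' * norm v) / k * E t"
        unfolding E_def using C L' k bh[unfolded E_def] conth by (intro signed_integral_exp_bound) auto
      moreover have "norm u0 \<le> norm u0 * E t" using E(2)[of t] by (simp add: mult_left_le mult_le_cancel_left1)
      ultimately have "norm (u0 + signed_integral (h v) t) \<le> (norm u0 + (C + L' * norm v) / k) * E t"
        by (smt (verit) norm_triangle_ineq distrib_right)
      then show ?thesis using E(1)[of t] by (simp add: \<Phi>_def divide_simps)
    qed
  qed
  have "\<exists>!v. Bcontfun (\<Phi> v) = v"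
  proof (rule banach_fix_type[of "1/2"])
    show "\<forall>v w. dist (Bcontfun (\<Phi> v)) (Bcontfun (\<Phi> w)) \<le> 1 / 2 * dist v w"
    proof (intro allI dist_bound)
      fix v w :: "real \<Rightarrow>\<^sub>C 'a" and t
      have "norm (h v s - h w s) \<le> L' * dist v w * E s" for s
      proof -
        have "norm (h v s - h w s) \<le> L' * (E s * norm (apply_bcontfun v s - apply_bcontfun w s))"
          unfolding h_def using lip'[of s "E s *\<^sub>R apply_bcontfun v s" "E s *\<^sub>R apply_bcontfun w s"] E(1)[of s]
          by (simp flip: scaleR_diff_right)
        also have "\<dots> \<le> L' * (E s * dist v w)"
          using L' E(1)[of s] dist_bounded[of v s w] by (intro mult_left_mono) (auto simp: dist_norm)
        finally show ?thesis by (simp add: mult_ac)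
      qed
      then have "norm (signed_integral (\<lambda>s. h v s - h w s) t) \<le> L' * dist v w / k * E t"
        unfolding E_def using L' k conth by (intro signed_integral_exp_bound continuous_intros) auto
      then have "norm (signed_integral (h v) t - signed_integral (h w) t) \<le> 1 / 2 * dist v w * E t"
        using L' conth by (simp add: signed_integral_diff k_def)
      moreover have "\<Phi> v t - \<Phi> w t = (1 / E t) *\<^sub>R (signed_integral (h v) t - signed_integral (h w) t)"
        by (simp add: \<Phi>_def flip: scaleR_diff_right)
      ultimately show "dist (apply_bcontfun (Bcontfun (\<Phi> v)) t) (apply_bcontfun (Bcontfun (\<Phi> w)) t)
          \<le> 1 / 2 * dist v w"
        using E(1)[of t] by (simp add: dist_norm Bcontfun_inverse \<Phi> divide_simps mult_ac)
    qed
  qed auto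
  then obtain v where v: "Bcontfun (\<Phi> v) = v" by blast
  define u where "u t = E t *\<^sub>R apply_bcontfun v t" for t
  have u: "u t = u0 + signed_integral (h v) t" for t
  proof -
    have "apply_bcontfun v t = \<Phi> v t" using v \<Phi> Bcontfun_inverse by metis
    then show ?thesis using E(1)[of t] by (simp add: u_def \<Phi>_def)
  qed
  show ?thesis
  proof (rule that[of u])
    show "u 0 = u0" by (simp add: u)
    show "(u has_vector_derivative f t (u t)) (at t)" for t
    proof -
      have "(u has_vector_derivative 0 + h v t) (at t)" unfolding u
        by (intro has_vector_derivative_add has_vector_derivative_const
            signed_integral_has_vector_derivative conth)
      then show ?thesis by (simp add: h_def u_def)
    qed
  qed
qed

section \<open>Norm conservation and the groups of bounded skew operators\<close>

lemma has_real_derivative_norm_squared: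
  fixes v :: "real \<Rightarrow> 'a::real_inner"
  assumes "(v has_vector_derivative v') (at t within S)"
  shows "((\<lambda>t. (norm (v t))\<^sup>2) has_real_derivative 2 * (v' \<bullet> v t)) (at t within S)"
proof -
  have d: "(v has_derivative (\<lambda>h. h *\<^sub>R v')) (at t within S)"
    using assms by (simp add: has_vector_derivative_def)
  show ?thesis
    unfolding has_field_derivative_def power2_norm_eq_inner
    by (rule has_derivative_eq_rhs[OF has_derivative_inner[OF d d]])
      (auto simp: inner_commute fun_eq_iff)
qed

lemma DERIV_bound_imp_abs_diff_le:
  fixes f :: "real \<Rightarrow> real"
  assumes "\<And>s. (f has_real_derivative f' s) (at s)" and "\<And>s. \<bar>f' s\<bar> \<le> B"
  shows "\<bar>f t - f 0\<bar> \<le> B * \<bar>t\<bar>"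
  using field_differentiable_bound[of UNIV f f' B t 0] assms by simp

text \<open>The squared norm has derivative \<open>2 * (B (u t) \<bullet> u t)\<close>, which
  vanishes. \<open>B\<close> may be nonlinear; for \<open>B = 0\<close> this says that a curve with
  zero derivative has constant norm.\<close>

lemma skew_ode_norm_eq:
  fixes u :: "real \<Rightarrow> 'a::real_inner"
  assumes skew: "\<And>x. B x \<bullet> x = 0" and u: "\<And>t. (u has_vector_derivative B (u t)) (at t)"
  shows "norm (u t) = norm (u 0)"
proof -
  have "\<bar>(norm (u t))\<^sup>2 - (norm (u 0))\<^sup>2\<bar> \<le> 0 * \<bar>t\<bar>"
    by (rule DERIV_bound_imp_abs_diff_le[where f' = "\<lambda>s. 2 * (B (u s) \<bullet> u s)"])
      (use has_real_derivative_norm_squared[OF u] skew in auto)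
  then show ?thesis by simp
qed

text \<open>Norm conservation applied to differences gives uniqueness of solutions. Linearity, the
  group law and commutation then hold because both sides solve the same initial value problem. The
  clause on \<open>C\<close> serves to commute the approximate groups with \<open>G\<close>.\<close>

lemma bounded_skew_group:
  fixes B :: "'a::{real_inner,banach} \<Rightarrow> 'a"
  assumes B: "bounded_linear B" and skew: "\<And>x. B x \<bullet> x = 0"
  obtains U :: "real \<Rightarrow> 'a \<Rightarrow> 'a" where "\<And>x. U 0 x = x"
    "\<And>x t. ((\<lambda>t. U t x) has_vector_derivative B (U t x)) (at t)"
    "\<And>t. linear (U t)" "\<And>t x. norm (U t x) = norm x"
    "\<And>s t x. U (s + t) x = U s (U t x)"
    "\<forall>C t x. bounded_linear C \<and> (\<forall>x. C (B x) = B (C x)) \<longrightarrow> C (U t x) = U t (C x)"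
proof -
  interpret B: bounded_linear B by (rule B)
  obtain L where L: "\<And>x. norm (B x) \<le> L * norm x" using bounded_linear_nonneg_bound[OF B] by metis
  have "\<exists>u. u 0 = x \<and> (\<forall>t. (u has_vector_derivative B (u t)) (at t))" for x
  proof -
    obtain u where "u 0 = x" "\<And>t. (u has_vector_derivative B (u t)) (at t)"
    proof (rule global_ode_solution[of "\<lambda>t. B" L 0 x])
      show "continuous_on UNIV (\<lambda>t. B (u t))" if "continuous_on UNIV u" for u :: "real \<Rightarrow> 'a"
        using that by (rule B.continuous_on)
      show "norm (B x - B y) \<le> L * norm (x - y)" for x y using L[of "x - y"] by (simp add: B.diff)
    qed (auto simp: B.zero)
    then show ?thesis by blast
  qed
  then obtain V where V: "\<And>x. V x 0 = x" "\<And>x t. (V x has_vector_derivative B (V x t)) (at t)" by metis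
  have uniq: "u t = V x t" if "u 0 = x" "\<And>t. (u has_vector_derivative B (u t)) (at t)" for u x t
  proof -
    have "norm (u t - V x t) = norm (u 0 - V x 0)"
    proof (rule skew_ode_norm_eq[OF skew])
      show "((\<lambda>t. u t - V x t) has_vector_derivative B (u t - V x t)) (at t)" for t
        unfolding B.diff by (intro has_vector_derivative_diff that V)
    qed
    then show ?thesis using that V by simp
  qed
  define U where "U t x = V x t" for t x
  show ?thesis
  proof (rule that[of U])
    show "U 0 x = x" for x by (simp add: U_def V)
    show "((\<lambda>t. U t x) has_vector_derivative B (U t x)) (at t)" for x t by (simp add: U_def V)
    show "linear (U t)" for t
    proof (rule linearI)
      show "U t (x + y) = U t x + U t y" for x y unfolding U_def
        by (rule uniq[symmetric]) (auto simp: V B.add intro!: has_vector_derivative_add)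
      show "U t (c *\<^sub>R x) = c *\<^sub>R U t x" for c x unfolding U_def
        by (rule uniq[symmetric])
          (auto simp: V B.scale intro!: bounded_linear.has_vector_derivative[OF bounded_linear_scaleR_right])
    qed
    show "norm (U t x) = norm x" for t x
      using skew_ode_norm_eq[OF skew V(2)] V(1) by (simp add: U_def)
    show "U (s + t) x = U s (U t x)" for s t x unfolding U_def
    proof (rule uniq[where u = "\<lambda>s. V x (s + t)"])
      show "((\<lambda>s. V x (s + t)) has_vector_derivative B (V x (s + t))) (at s)" for s
      proof -
        have "((\<lambda>s. s + t) has_vector_derivative 1) (at s)" by (auto intro!: derivative_eq_intros)
        from vector_diff_chain_at[OF this V(2)] show ?thesis by (simp add: o_def)
      qed
    qed simp
    have "C (U t x) = U t (C x)" if "bounded_linear C" "\<And>x. C (B x) = B (C x)" for C t x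
      unfolding U_def
      by (rule uniq[where u = "\<lambda>t. C (V x t)"])
        (use V bounded_linear.has_vector_derivative[OF that(1) V(2)] that(2) in auto)
    then show "\<forall>C t x. bounded_linear C \<and> (\<forall>x. C (B x) = B (C x)) \<longrightarrow> C (U t x) = U t (C x)"
      by blast
  qed
qed

text \<open>The component \<open>u - P u\<close> normal to \<open>X\<close> has zero derivative,
  because \<open>P\<close> fixes \<open>u'\<close>, and it starts at 0.\<close>

lemma closed_subspace_ode_invariant:
  fixes u :: "real \<Rightarrow> 'a::{real_inner,banach}"
  assumes X: "subspace X" "closed X" and u0: "u 0 \<in> X"
    and u: "\<And>t. (u has_vector_derivative u' t) (at t)" "\<And>t. u' t \<in> X"
  shows "u t \<in> X"
proof -
  obtain P where P: "bounded_linear P" "\<And>x. P x \<in> X" "\<And>x. x \<in> X \<Longrightarrow> P x = x"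
    using closed_subspace_bounded_projection[OF X] by metis
  define d where "d t = u t - P (u t)" for t
  have "(d has_vector_derivative 0) (at t)" for t
    using has_vector_derivative_diff[OF u(1) bounded_linear.has_vector_derivative[OF P(1) u(1)], of t]
      P(3)[OF u(2)[of t]] by (simp add: d_def[abs_def])
  then have "norm (d t) = norm (d 0)"
    by (intro skew_ode_norm_eq[where B = "\<lambda>_. 0"]) auto
  then have "d t = 0" using P(3)[OF u0] by (simp add: d_def)
  then show ?thesis using P(2)[of "u t"] by (simp add: d_def)
qed

section \<open>The unitary group generated by an operator with bounded skew inverse\<close>

lemma closure_image_subspace:
  assumes G: "bounded_linear G" and X: "subspace X"
  shows "subspace (closure (G ` X))"
proof -
  interpret G: bounded_linear G by (rule G)
  have GX: "subspace (G ` X)" by (rule linear_subspace_image) (simp_all add: X G.linear)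
  show ?thesis
    unfolding subspace_def
  proof safe
    show "0 \<in> closure (G ` X)" using GX closure_subset subspace_0 by blast
    fix x y assume "x \<in> closure (G ` X)" "y \<in> closure (G ` X)"
    then obtain a b where "\<And>n. a n \<in> G ` X" "a \<longlonglongrightarrow> x" "\<And>n. b n \<in> G ` X" "b \<longlonglongrightarrow> y"
      unfolding closure_sequential by metis
    then have "\<And>n. a n + b n \<in> G ` X" "(\<lambda>n. a n + b n) \<longlonglongrightarrow> x + y"
      using GX by (auto intro!: tendsto_add simp: subspace_add)
    then show "x + y \<in> closure (G ` X)" unfolding closure_sequential by (intro exI conjI) auto
  next
    fix c x assume "x \<in> closure (G ` X)"
    then obtain a where "\<And>n. a n \<in> G ` X" "a \<longlonglongrightarrow> x"
      unfolding closure_sequential by metis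
    then have "\<And>n. c *\<^sub>R a n \<in> G ` X" "(\<lambda>n. c *\<^sub>R a n) \<longlonglongrightarrow> c *\<^sub>R x"
      using GX by (auto intro!: tendsto_scaleR simp: subspace_scale)
    then show "c *\<^sub>R x \<in> closure (G ` X)" unfolding closure_sequential by (intro exI conjI) auto
  qed
qed

text \<open>A densely defined skew-adjoint operator with bounded inverse, described by its inverse \<open>G\<close>.\<close>

locale skew_inverse =
  fixes G :: "'a::{real_inner,banach} \<Rightarrow> 'a" and X :: "'a set"
  assumes X: "subspace X" "closed X"
    and G: "bounded_linear G" and GX: "\<And>x. G x \<in> X"
    and skew: "\<And>x y. G x \<bullet> y = - (x \<bullet> G y)"
    and inj: "\<And>x. x \<in> X \<Longrightarrow> G x = 0 \<Longrightarrow> x = 0"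
begin

interpretation G: bounded_linear G by (rule G)

lemma skew_self: "G x \<bullet> x = 0"
  using skew[of x x] by (simp add: inner_commute)

text \<open>A vector \<open>n\<close> of \<open>X\<close> orthogonal to the range of
  \<open>G\<close> is in particular orthogonal to \<open>G (G n)\<close>. By skewness this says
  \<open>G n \<bullet> G n = 0\<close>, so \<open>n = 0\<close> by injectivity.\<close>

lemma dense: "X \<subseteq> closure (G ` X)"
proof
  fix x assume x: "x \<in> X"
  obtain p where p: "p \<in> closure (G ` X)" "\<And>z. z \<in> closure (G ` X) \<Longrightarrow> (x - p) \<bullet> z = 0"
    using closed_subspace_projection[OF closure_image_subspace[OF G X(1)] closed_closure] by metis
  have "closure (G ` X) \<subseteq> X" using X GX by (intro closure_minimal) auto
  then have n: "x - p \<in> X" using p x X by (auto intro: subspace_diff)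
  have "(x - p) \<bullet> G (G (x - p)) = 0" by (intro p(2) subsetD[OF closure_subset] imageI GX)
  then have "G (x - p) \<bullet> G (x - p) = 0" by (simp add: skew)
  then have "x - p = 0" using inj[OF n] by simp
  then show "x \<in> closure (G ` X)" using p by simp
qed

lemma dense_approx:
  assumes x: "x \<in> X" and e: "e > 0"
  obtains y where "y \<in> X" "norm (x - G y) < e"
proof -
  have "x \<in> closure (G ` X)" using dense x by auto
  then obtain y where "y \<in> X" "dist (G y) x < e" using e by (auto simp: closure_approachable)
  then show ?thesis by (intro that[of y]) (simp_all add: dist_norm norm_minus_commute)
qed

text \<open>For \<open>y\<close> in \<open>X\<close> the vectors \<open>G (G y)\<close> run through
  the domain of the square of the generator, on which the approximate groups converge with an
  explicit rate.\<close>

lemma dense_approx2: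
  assumes x: "x \<in> X" and e: "e > 0"
  obtains y where "y \<in> X" "norm (x - G (G y)) < e"
proof -
  obtain K where K: "K \<ge> 0" "\<And>x. norm (G x) \<le> K * norm x" using bounded_linear_nonneg_bound[OF G] by blast
  obtain z where z: "z \<in> X" "norm (x - G z) < e / 2" using dense_approx[OF x, of "e / 2"] e by auto
  obtain y where y: "y \<in> X" "norm (z - G y) < e / (2 * (K + 1))"
    using dense_approx[OF z(1), of "e / (2 * (K + 1))"] e K by auto
  have "norm (G z - G (G y)) \<le> K * norm (z - G y)" using K(2)[of "z - G y"] by (simp add: G.diff)
  also have "\<dots> \<le> (K + 1) * norm (z - G y)" by (intro mult_right_mono) auto
  also have "\<dots> < (K + 1) * (e / (2 * (K + 1)))" using y K by (intro mult_strict_left_mono) auto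
  also have "\<dots> = e / 2" using K by (simp add: field_simps)
  finally have "norm (x - G (G y)) < e"
    using z norm_triangle_ineq[of "x - G z" "G z - G (G y)"] by simp
  with y show ?thesis by (intro that)
qed

text \<open>By skewness \<open>- G\<^sup>2\<close> is positive, so
  \<open>e\<^sup>2 - G\<^sup>2\<close> is coercive, and \<open>M\<close> is its inverse. The two
  final bounds say that \<open>e\<^sup>2 M\<close> does not increase norms and is of size
  \<open>e\<close> on the range of \<open>G\<close>; they measure the approximation error.\<close>

lemma resolvent:
  assumes e: "e > 0"
  obtains M where "bounded_linear M" "\<And>x. e\<^sup>2 *\<^sub>R M x - G (G (M x)) = x"
    "\<And>x. G (M x) = M (G x)" "\<And>x y. M x \<bullet> y = x \<bullet> M y"
    "\<And>x. e\<^sup>2 * norm (M x) \<le> norm x" "\<And>x. e\<^sup>2 * norm (M (G x)) \<le> e * norm x"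
proof -
  define A where "A x = e\<^sup>2 *\<^sub>R x - G (G x)" for x
  have A: "bounded_linear A" unfolding A_def
    by (intro bounded_linear_sub bounded_linear_scaleR_right bounded_linear_compose[OF G G])
  have form: "A x \<bullet> y = e\<^sup>2 * (x \<bullet> y) + G x \<bullet> G y" for x y by (simp add: A_def inner_diff_left skew)
  have "e\<^sup>2 * (norm x)\<^sup>2 \<le> A x \<bullet> x" for x by (simp add: form power2_norm_eq_inner)
  then obtain M where M: "bounded_linear M" "\<And>x. A (M x) = x" "\<And>x. M (A x) = x"
    using lax_milgram[OF A, of "e\<^sup>2"] e by auto
  interpret M: bounded_linear M by (rule M)
  have comm: "G (M x) = M (G x)" for x
  proof -
    have "A (G (M x)) = G (A (M x))" by (simp add: A_def G.diff G.scale)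
    then show ?thesis using M(2,3) by metis
  qed
  have b1: "e\<^sup>2 * norm (M x) \<le> norm x" for x
  proof (cases "M x = 0")
    case False
    have "e\<^sup>2 * (norm (M x))\<^sup>2 \<le> A (M x) \<bullet> M x" by (simp add: form power2_norm_eq_inner)
    also have "\<dots> \<le> norm x * norm (M x)" unfolding M by (rule norm_cauchy_schwarz)
    finally have "e\<^sup>2 * norm (M x) * norm (M x) \<le> norm x * norm (M x)" by (simp add: power2_eq_square)
    then show ?thesis using False by simp
  qed simp
  have b2: "e\<^sup>2 * norm (M (G x)) \<le> e * norm x" for x
  proof -
    define y where "y = M (G x)"
    \<comment> \<open>The equation \<open>e\<^sup>2 y - G (G y) = G x\<close>, tested with
      \<open>y\<close>.\<close>
    have eq: "e\<^sup>2 * (norm y)\<^sup>2 + (norm (G y))\<^sup>2 = - (x \<bullet> G y)"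
      using form[of y y] skew[of x y] by (simp add: y_def M power2_norm_eq_inner)
    have "- (x \<bullet> G y) \<le> norm x * norm (G y)" using Cauchy_Schwarz_ineq2[of x "G y"] by simp
    then have "e\<^sup>2 * (norm y)\<^sup>2 \<le> norm x * norm (G y) - (norm (G y))\<^sup>2" using eq by simp
    also have "\<dots> \<le> (norm x)\<^sup>2"
      using sum_squares_bound[of "norm x" "norm (G y)"] zero_le_power2[of "norm x"]
        zero_le_power2[of "norm (G y)"] by linarith
    finally have "(e * norm y)\<^sup>2 \<le> (norm x)\<^sup>2" by (simp add: power_mult_distrib)
    then have "e * norm y \<le> norm x" by (rule power2_le_imp_le) simp
    then have "e * (e * norm y) \<le> e * norm x" using e by simp
    then show ?thesis by (simp add: y_def power2_eq_square mult.assoc)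
  qed
  show ?thesis
  proof (rule that[OF M(1) _ comm _ b1 b2])
    show "e\<^sup>2 *\<^sub>R M x - G (G (M x)) = x" for x using M(2)[of x] by (simp add: A_def)
    show "M x \<bullet> y = x \<bullet> M y" for x y
    proof -
      have "M x \<bullet> y = M x \<bullet> A (M y)" by (simp add: M)
      also have "\<dots> = A (M x) \<bullet> M y" using form[of "M x" "M y"] form[of "M y" "M x"] by (simp add: inner_commute)
      finally show ?thesis by (simp add: M)
    qed
  qed
qed

text \<open>\<open>J\<^sub>e = - G (e\<^sup>2 - G\<^sup>2)\<^sup>-\<^sup>1\<close> is a bounded skew approximation of \<open>G\<^sup>-\<^sup>1\<close>, so its group is unitary.\<close>

lemma approximate_group:
  assumes e: "e > 0"
  obtains U M where "\<And>x. U 0 x = x" "\<And>t. linear (U t)" "\<And>t x. norm (U t x) = norm x"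
    "\<And>s t x. U (s + t) x = U s (U t x)" "\<And>t x. G (U t x) = U t (G x)"
    "\<And>t x. x \<in> X \<Longrightarrow> U t x \<in> X"
    "\<And>t x. ((\<lambda>t. U t x) has_vector_derivative - G (M (U t x))) (at t)"
    "\<And>x. - G (M (G x)) = x - e\<^sup>2 *\<^sub>R M x" "\<And>x. G (M x) \<bullet> x = 0"
    "linear M" "\<And>x. e\<^sup>2 * norm (M x) \<le> norm x" "\<And>x. e\<^sup>2 * norm (M (G x)) \<le> e * norm x"
proof -
  obtain M where M: "bounded_linear M" "\<And>x. e\<^sup>2 *\<^sub>R M x - G (G (M x)) = x"
    "\<And>x. G (M x) = M (G x)" "\<And>x y. M x \<bullet> y = x \<bullet> M y"
    "\<And>x. e\<^sup>2 * norm (M x) \<le> norm x" "\<And>x. e\<^sup>2 * norm (M (G x)) \<le> e * norm x"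
    using resolvent[OF e] by blast
  interpret M: bounded_linear M by (rule M)
  have B: "bounded_linear (\<lambda>x. - G (M x))"
    by (intro bounded_linear_minus bounded_linear_compose[OF G M(1)])
  have sk: "G (M x) \<bullet> x = 0" for x
  proof -
    have "G (M x) \<bullet> x = - (M x \<bullet> G x)" by (rule skew)
    also have "M x \<bullet> G x = x \<bullet> M (G x)" by (rule M)
    also have "\<dots> = G (M x) \<bullet> x" by (simp add: M(3) inner_commute)
    finally show ?thesis by simp
  qed
  have sk': "- G (M x) \<bullet> x = 0" for x by (simp add: sk)
  obtain U :: "real \<Rightarrow> 'a \<Rightarrow> 'a" where
    U: "\<And>x. U 0 x = x"
    "\<And>x t. ((\<lambda>t. U t x) has_vector_derivative - G (M (U t x))) (at t)"
    "\<And>t. linear (U t)" "\<And>t x. norm (U t x) = norm x"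
    "\<And>s t x. U (s + t) x = U s (U t x)"
    "\<forall>C t x. bounded_linear C \<and> (\<forall>x. C (- G (M x)) = - G (M (C x))) \<longrightarrow> C (U t x) = U t (C x)"
    by (rule bounded_skew_group[OF B sk'], rule that, assumption+)
  show ?thesis
  proof (rule that[of U M])
    show "G (U t x) = U t (G x)" for t x using U(6) G by (simp add: M(3) G.neg)
    show "- G (M (G x)) = x - e\<^sup>2 *\<^sub>R M x" for x
      using M(2)[of x] by (simp add: M(3)[symmetric] algebra_simps)
    show "U t x \<in> X" if "x \<in> X" for t x
      by (rule closed_subspace_ode_invariant[OF X _ U(2)]) (auto simp: U that GX X subspace_neg)
  qed (use U M sk M.linear in auto)
qed


text \<open>Let \<open>v\<close> be the difference of the two trajectories of
  \<open>x = G (G y)\<close>. Its derivative is a consistency error \<open>w\<close> minus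
  \<open>G (N v)\<close>; the latter is skew and drops out of the derivative of the squared norm.
  The error has size \<open>e + d\<close>, because both generators applied to \<open>U t x\<close>
  have the same leading term \<open>G (U t y)\<close>.\<close>

lemma approximate_groups_close:
  fixes U V :: "real \<Rightarrow> 'a \<Rightarrow> 'a"
  assumes U: "\<And>x. U 0 x = x" "\<And>t x. norm (U t x) = norm x" "\<And>t x. G (U t x) = U t (G x)"
      "\<And>t x. ((\<lambda>t. U t x) has_vector_derivative - G (M (U t x))) (at t)"
      "\<And>x. - G (M (G x)) = x - e\<^sup>2 *\<^sub>R M x" "\<And>x. e\<^sup>2 * norm (M (G x)) \<le> e * norm x"
    and V: "\<And>x. V 0 x = x" "\<And>t x. norm (V t x) = norm x"
      "\<And>t x. ((\<lambda>t. V t x) has_vector_derivative - G (N (V t x))) (at t)"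
      "\<And>x. - G (N (G x)) = x - d\<^sup>2 *\<^sub>R N x" "\<And>x. d\<^sup>2 * norm (N (G x)) \<le> d * norm x"
      "\<And>x. G (N x) \<bullet> x = 0" "linear N"
  shows "(norm (U t (G (G y)) - V t (G (G y))))\<^sup>2 \<le> 4 * (e + d) * norm y * norm (G (G y)) * \<bar>t\<bar>"
proof -
  define x where "x = G (G y)"
  define v where "v t = U t x - V t x" for t
  define w where "w t = d\<^sup>2 *\<^sub>R N (G (U t y)) - e\<^sup>2 *\<^sub>R M (G (U t y))" for t
  have w: "- G (M (U t x)) - - G (N (V t x)) = w t - G (N (v t))" for t
  proof -
    have Ux: "U t x = G (G (U t y))" by (simp add: x_def U(3))
    have "- G (M (U t x)) - (- G (N (U t x))) = w t"
      unfolding Ux U(5) V(4) by (simp add: w_def)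
    moreover have "G (N (v t)) = G (N (U t x)) - G (N (V t x))"
      by (simp add: v_def linear_diff[OF V(7)] G.diff)
    ultimately show ?thesis by (simp add: algebra_simps)
  qed
  have v': "(v has_vector_derivative (w t - G (N (v t)))) (at t)" for t
    unfolding v_def[abs_def] w[symmetric, unfolded v_def] by (intro has_vector_derivative_diff U V)
  have "\<bar>(norm (v t))\<^sup>2 - (norm (v 0))\<^sup>2\<bar> \<le> (4 * (e + d) * norm y * norm x) * \<bar>t\<bar>"
  proof (rule DERIV_bound_imp_abs_diff_le)
    show "((\<lambda>t. (norm (v t))\<^sup>2) has_real_derivative 2 * ((w s - G (N (v s))) \<bullet> v s)) (at s)" for s
      by (rule has_real_derivative_norm_squared[OF v'])
    fix s
    have "norm (w s) \<le> d * norm y + e * norm y"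
      using norm_triangle_ineq4[of "d\<^sup>2 *\<^sub>R N (G (U s y))" "e\<^sup>2 *\<^sub>R M (G (U s y))"]
        U(6)[of "U s y"] V(5)[of "U s y"] U(2) by (simp add: w_def)
    moreover have "norm (v s) \<le> 2 * norm x"
      using norm_triangle_ineq4[of "U s x" "V s x"] U(2) V(2) by (simp add: v_def)
    ultimately have "norm (w s) * norm (v s) \<le> (d * norm y + e * norm y) * (2 * norm x)"
      by (meson mult_mono norm_ge_zero order_trans)
    moreover have "\<bar>w s \<bullet> v s\<bar> \<le> norm (w s) * norm (v s)" by (rule Cauchy_Schwarz_ineq2)
    ultimately show "\<bar>2 * ((w s - G (N (v s))) \<bullet> v s)\<bar> \<le> 4 * (e + d) * norm y * norm x"
      by (simp add: inner_diff_left V(6) abs_mult algebra_simps)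
  qed
  then show ?thesis by (simp add: v_def x_def U V)
qed

text \<open>Isometries are equicontinuous, so convergence on a dense set extends to all of
  \<open>X\<close>.\<close>

lemma Cauchy_transfer:
  fixes S :: "nat \<Rightarrow> 'a \<Rightarrow> 'a"
  assumes S: "\<And>n. linear (S n)" "\<And>n x. norm (S n x) = norm x"
    and C: "\<And>y. Cauchy (\<lambda>n. S n (G (G y)))" and x: "x \<in> X"
  shows "Cauchy (\<lambda>n. S n x)"
proof (rule metric_CauchyI)
  fix e :: real assume "e > 0"
  then have e3: "e / 3 > 0" by simp
  obtain y where y: "norm (x - G (G y)) < e / 3" using dense_approx2[OF x e3] by blast
  obtain N where N: "\<And>m n. m \<ge> N \<Longrightarrow> n \<ge> N \<Longrightarrow> dist (S m (G (G y))) (S n (G (G y))) < e / 3"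
    using C[of y] e3 unfolding Cauchy_def by blast
  show "\<exists>M. \<forall>m\<ge>M. \<forall>n\<ge>M. dist (S m x) (S n x) < e"
  proof (intro exI allI impI)
    fix m n assume mn: "m \<ge> N" "n \<ge> N"
    have d: "dist (S k x) (S k (G (G y))) < e / 3" for k
      using y by (simp add: dist_norm S(2) flip: linear_diff[OF S(1)])
    show "dist (S m x) (S n x) < e"
      using d[of m] d[of n] N[OF mn]
        dist_triangle[of "S m x" "S n x" "S m (G (G y))"]
        dist_triangle[of "S m (G (G y))" "S n x" "S n (G (G y))"]
      by (simp add: dist_commute)
  qed
qed

text \<open>The group is obtained as the strong limit of the approximate groups.\<close>

lemma unitary_group_exists:
  obtains T where "unitary_C0_group X T"
    "\<And>h y z. norm (T h (G y) - G y - h *\<^sub>R y) \<le> \<bar>h\<bar> * (3 * norm (y - G z) + 2 * norm z * \<bar>h\<bar>)"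
proof -
  define e where "e n = inverse (real (Suc n))" for n
  have e: "e n > 0" for n by (simp add: e_def)
  have e0: "e \<longlonglongrightarrow> 0" unfolding e_def by (rule LIMSEQ_inverse_real_of_nat)
  \<comment> \<open>One predicate collects all properties of the pair, so that the sequences
    \<open>S\<close> and \<open>M\<close> can be chosen together.\<close>
  define A where "A n U M \<longleftrightarrow> (\<forall>x. U 0 x = x) \<and> (\<forall>t. linear (U t)) \<and> (\<forall>t x. norm (U t x) = norm x) \<and>
    (\<forall>s t x. U (s + t) x = U s (U t x)) \<and> (\<forall>t x. G (U t x) = U t (G x)) \<and>
    (\<forall>t x. x \<in> X \<longrightarrow> U t x \<in> X) \<and>
    (\<forall>t x. ((\<lambda>t. U t x) has_vector_derivative - G (M (U t x))) (at t)) \<and>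
    (\<forall>x. - G (M (G x)) = x - (e n)\<^sup>2 *\<^sub>R M x) \<and> (\<forall>x. G (M x) \<bullet> x = 0) \<and>
    linear M \<and> (\<forall>x. (e n)\<^sup>2 * norm (M x) \<le> norm x) \<and>
    (\<forall>x. (e n)\<^sup>2 * norm (M (G x)) \<le> e n * norm x)" for n U M
  have "\<exists>U M. A n U M" for n
  proof (rule approximate_group[OF e[of n]], goal_cases)
    case (1 U M)
    show ?case unfolding A_def
      by (intro exI[of _ U] exI[of _ M] conjI allI impI) (assumption | rule 1)+
  qed
  then obtain S M where "\<And>n. A n (S n) (M n)" by metis
  then have S: "\<And>n x. S n 0 x = x" "\<And>n t. linear (S n t)" "\<And>n t x. norm (S n t x) = norm x"
    "\<And>n s t x. S n (s + t) x = S n s (S n t x)" "\<And>n t x. G (S n t x) = S n t (G x)"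
    "\<And>n t x. x \<in> X \<Longrightarrow> S n t x \<in> X"
    "\<And>n t x. ((\<lambda>t. S n t x) has_vector_derivative - G (M n (S n t x))) (at t)"
    "\<And>n x. - G (M n (G x)) = x - (e n)\<^sup>2 *\<^sub>R M n x" "\<And>n x. G (M n x) \<bullet> x = 0"
    "\<And>n. linear (M n)" "\<And>n x. (e n)\<^sup>2 * norm (M n x) \<le> norm x"
    "\<And>n x. (e n)\<^sup>2 * norm (M n (G x)) \<le> e n * norm x"
    unfolding A_def by blast+
  note lin = linear_diff[OF S(2)] linear_add[OF S(2)] linear_scale[OF S(2)]
  have SC: "Cauchy (\<lambda>n. S n t (G (G y)))" for t y
  proof (rule metric_CauchyI)
    fix r :: real assume r: "r > 0"
    define K where "K = 4 * norm y * norm (G (G y)) * \<bar>t\<bar>"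
    have K: "K \<ge> 0" by (simp add: K_def)
    have "r\<^sup>2 / (2 * (K + 1)) > 0" using r K by simp
    then obtain N where N: "inverse (real (Suc N)) < r\<^sup>2 / (2 * (K + 1))" using reals_Archimedean by blast
    have eN: "e n < r\<^sup>2 / (2 * (K + 1))" if "n \<ge> N" for n
    proof -
      have "e n \<le> inverse (real (Suc N))" unfolding e_def using that by (intro le_imp_inverse_le) auto
      with N show ?thesis by simp
    qed
    show "\<exists>N. \<forall>m\<ge>N. \<forall>n\<ge>N. dist (S m t (G (G y))) (S n t (G (G y))) < r"
    proof (intro exI allI impI)
      fix m n assume mn: "m \<ge> N" "n \<ge> N"
      have "(norm (S m t (G (G y)) - S n t (G (G y))))\<^sup>2 \<le> 4 * (e m + e n) * norm y * norm (G (G y)) * \<bar>t\<bar>"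
        by (rule approximate_groups_close[where M = "M m" and N = "M n"]) (rule S)+
      also have "\<dots> = (e m + e n) * K" by (simp add: K_def algebra_simps)
      also have "\<dots> \<le> (e m + e n) * (K + 1)" using e[of m] e[of n] by (intro mult_left_mono) auto
      also have "\<dots> < (r\<^sup>2 / (2 * (K + 1)) + r\<^sup>2 / (2 * (K + 1))) * (K + 1)"
        using eN[OF mn(1)] eN[OF mn(2)] K by (intro mult_strict_right_mono) auto
      also have "\<dots> = r\<^sup>2"
      proof -
        have split: "(r\<^sup>2 / (2 * k) + r\<^sup>2 / (2 * k)) * k = r\<^sup>2" if "k > 0" for k
          using that by (simp add: field_simps)
        show ?thesis by (rule split) (use K in simp)
      qed
      finally show "dist (S m t (G (G y))) (S n t (G (G y))) < r"
        using r by (simp add: dist_norm power2_less_imp_less)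
    qed
  qed
  have C: "Cauchy (\<lambda>n. S n t x)" if "x \<in> X" for t x
    by (rule Cauchy_transfer[of "\<lambda>n. S n t", OF S(2,3) SC that])
  define T where "T t x = lim (\<lambda>n. S n t x)" for t x
  have T: "(\<lambda>n. S n t x) \<longlonglongrightarrow> T t x" if "x \<in> X" for t x
    unfolding T_def using C[OF that] by (simp add: Cauchy_convergent_iff convergent_LIMSEQ_iff)
  have TX: "T t x \<in> X" if "x \<in> X" for t x
    using closed_sequentially[OF X(2) _ T[OF that]] S(6)[OF that] by blast
  have T0: "T 0 x = x" if "x \<in> X" for x
    using T[OF that, of 0] by (simp add: S LIMSEQ_const_iff)
  have Tnorm: "norm (T t x) = norm x" if "x \<in> X" for t x
    using LIMSEQ_unique[OF tendsto_norm[OF T[OF that]], of t "norm x"] by (simp add: S)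
  have Tadd: "T t (x + y) = T t x + T t y" if "x \<in> X" "y \<in> X" for t x y
    using LIMSEQ_unique[OF T[of "x + y" t] ] tendsto_add[OF T[of x t] T[of y t]] that X
    by (simp add: lin subspace_add)
  have Tscale: "T t (c *\<^sub>R x) = c *\<^sub>R T t x" if "x \<in> X" for t x c
    using LIMSEQ_unique[OF T[of "c *\<^sub>R x" t] ] tendsto_scaleR[OF tendsto_const T[of x t]] that X
    by (simp add: lin subspace_scale)
  have Tdiff: "T t (x - y) = T t x - T t y" if "x \<in> X" "y \<in> X" for t x y
    using Tadd[of x "(-1) *\<^sub>R y" t] Tscale[of y t "-1"] that X
    by (simp add: subspace_neg)
  have Tgroup: "T (s + t) x = T s (T t x)" if x: "x \<in> X" for s t x
  proof (rule LIMSEQ_unique[OF T[OF x]])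
    have "(\<lambda>n. norm (S n t x - T t x)) \<longlonglongrightarrow> 0"
      using T[OF x, of t] by (simp add: LIM_zero_iff tendsto_norm_zero_iff)
    then have "(\<lambda>n. S n s (S n t x) - S n s (T t x)) \<longlonglongrightarrow> 0"
      by (subst tendsto_norm_zero_iff[symmetric]) (simp add: S(3) flip: lin)
    from tendsto_add[OF this T[OF TX[OF x]], of s t]
    show "(\<lambda>n. S n (s + t) x) \<longlonglongrightarrow> T s (T t x)" by (simp add: S(4))
  qed
  \<comment> \<open>The Lipschitz constant is uniform in \<open>n\<close>: along the trajectory of
    \<open>G y\<close> the approximate generator takes the value \<open>z - e\<^sup>2 M z\<close>
    with \<open>z = S n r y\<close>, of norm at most \<open>2 * norm y\<close>.\<close>
  have SLip: "norm (S n t (G y) - S n s (G y)) \<le> 2 * norm y * \<bar>t - s\<bar>" for n t s y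
  proof -
    have "norm (S n t (G y) - S n s (G y)) \<le> 2 * norm y * norm (t - s)"
    proof (rule differentiable_bound[where f' = "\<lambda>t h. h *\<^sub>R (- G (M n (S n t (G y))))" and S = UNIV])
      fix r
      show "((\<lambda>t. S n t (G y)) has_derivative (\<lambda>h. h *\<^sub>R (- G (M n (S n r (G y)))))) (at r)"
        using S(7) by (simp add: has_vector_derivative_def)
      have "- G (M n (S n r (G y))) = S n r y - (e n)\<^sup>2 *\<^sub>R M n (S n r y)"
        using S(8)[of n "S n r y"] by (simp add: S(5))
      also have "norm \<dots> \<le> norm (S n r y) + norm ((e n)\<^sup>2 *\<^sub>R M n (S n r y))" by (rule norm_triangle_ineq4)
      also have "\<dots> \<le> 2 * norm y" using S(11)[of n "S n r y"] by (simp add: S(3))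
      finally have b: "norm (- G (M n (S n r (G y)))) \<le> 2 * norm y" .
      show "onorm (\<lambda>h. h *\<^sub>R (- G (M n (S n r (G y))))) \<le> 2 * norm y"
      proof (rule onorm_le)
        show "norm (h *\<^sub>R (- G (M n (S n r (G y))))) \<le> 2 * norm y * norm h" for h
          using mult_left_mono[OF b, of "\<bar>h\<bar>"] by (simp add: mult_ac)
      qed
    qed auto
    then show ?thesis by simp
  qed
  have TLip: "norm (T t (G y) - T s (G y)) \<le> 2 * norm y * \<bar>t - s\<bar>" for t s y
    by (rule LIMSEQ_le_const2[OF tendsto_norm[OF tendsto_diff[OF T[OF GX] T[OF GX]]]])
      (use SLip in blast)
  have Tcont: "continuous_on UNIV (\<lambda>t. T t x)" if x: "x \<in> X" for x
    unfolding continuous_on_iff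
  proof safe
    fix t r :: real assume r: "r > 0"
    then have r4: "r / 4 > 0" by simp
    obtain y where y: "y \<in> X" "norm (x - G y) < r / 4" using dense_approx[OF x r4] by blast
    define d where "d = r / (4 * (norm y + 1))"
    have ny: "norm y + 1 > 0" by (simp add: add_nonneg_pos)
    have d: "d > 0" using r ny by (simp add: d_def)
    show "\<exists>d>0. \<forall>s\<in>UNIV. dist s t < d \<longrightarrow> dist (T s x) (T t x) < r"
    proof (intro exI conjI ballI impI)
      fix s assume s: "dist s t < d"
      have a: "norm (T u x - T u (G y)) < r / 4" for u
        using y x X GX by (simp add: Tnorm subspace_diff flip: Tdiff)
      have "norm (T s (G y) - T t (G y)) \<le> 2 * norm y * \<bar>s - t\<bar>" by (rule TLip)
      also have "\<dots> \<le> 2 * (norm y + 1) * \<bar>s - t\<bar>" by (intro mult_right_mono) auto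
      also have "\<dots> < 2 * (norm y + 1) * d" using s ny by (intro mult_strict_left_mono) (auto simp: dist_real_def)
      also have "\<dots> = r / 2"
      proof -
        have cancel: "2 * q * (r / (4 * q)) = r / 2" if "q > 0" for q
          using that by (simp add: field_simps)
        show ?thesis unfolding d_def by (rule cancel[OF ny])
      qed
      finally have "norm (T s (G y) - T t (G y)) < r / 2" .
      moreover have eq: "T s x - T t x = (T s x - T s (G y)) + ((T s (G y) - T t (G y)) - (T t x - T t (G y)))" by simp
      ultimately show "dist (T s x) (T t x) < r"
        using a[of s] a[of t] norm_triangle_ineq[of "T s x - T s (G y)" "(T s (G y) - T t (G y)) - (T t x - T t (G y))"]
          norm_triangle_ineq4[of "T s (G y) - T t (G y)" "T t x - T t (G y)"]
        unfolding dist_norm eq by linarith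
    qed (rule d)
  qed
  \<comment> \<open>This estimate, uniform in \<open>n\<close>, identifies the generator of the
    limit group. For a general \<open>y\<close> the trajectory is merely continuous, so
    \<open>y\<close> is split into a small part \<open>y - G z\<close> and a part \<open>G z\<close>
    whose trajectory is Lipschitz.\<close>
  have est: "norm (S n h (G y) - G y - h *\<^sub>R y) \<le> (norm (y - G z) * 3 + 2 * norm z * \<bar>h\<bar> + e n * norm z) * \<bar>h\<bar>" for n h y z
  proof -
    have "norm ((S n h (G y) - h *\<^sub>R y) - (S n 0 (G y) - 0 *\<^sub>R y))
        \<le> (norm (y - G z) * 3 + 2 * norm z * \<bar>h\<bar> + e n * norm z) * norm (h - 0)"
    proof (rule differentiable_bound[where f' = "\<lambda>t k. k *\<^sub>R (- G (M n (S n t (G y))) - y)" and S = "{-\<bar>h\<bar>..\<bar>h\<bar>}"])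
      fix r assume r: "r \<in> {-\<bar>h\<bar>..\<bar>h\<bar>}"
      have "((\<lambda>t. S n t (G y) - t *\<^sub>R y) has_vector_derivative (- G (M n (S n r (G y))) - y)) (at r within {-\<bar>h\<bar>..\<bar>h\<bar>})"
        by (rule has_vector_derivative_at_within, rule has_vector_derivative_diff[OF S(7)])
          (auto intro!: derivative_eq_intros)
      then show "((\<lambda>t. S n t (G y) - t *\<^sub>R y) has_derivative (\<lambda>k. k *\<^sub>R (- G (M n (S n r (G y))) - y))) (at r within {-\<bar>h\<bar>..\<bar>h\<bar>})"
        by (simp add: has_vector_derivative_def)
      define q where "q = y - G z"
      have "- G (M n (S n r (G y))) - y = S n r y - y - (e n)\<^sup>2 *\<^sub>R M n (S n r y)"
        using S(8)[of n "S n r y"] by (simp add: S(5))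
      also have "\<dots> = (S n r q - q - (e n)\<^sup>2 *\<^sub>R M n (S n r q)) + ((S n r (G z) - G z) - (e n)\<^sup>2 *\<^sub>R M n (G (S n r z)))"
        by (simp add: q_def S(5) lin linear_diff[OF S(10)] algebra_simps)
      also have "norm \<dots> \<le> (norm (S n r q) + norm q + norm ((e n)\<^sup>2 *\<^sub>R M n (S n r q)))
          + (norm (S n r (G z) - G z) + norm ((e n)\<^sup>2 *\<^sub>R M n (G (S n r z))))"
        by (intro order_trans[OF norm_triangle_ineq] add_mono order_trans[OF norm_triangle_ineq4] norm_triangle_ineq4 order_refl)
      also have "\<dots> \<le> (norm q + norm q + norm q) + (2 * norm z * \<bar>h\<bar> + e n * norm z)"
      proof (intro add_mono)
        show "norm ((e n)\<^sup>2 *\<^sub>R M n (S n r q)) \<le> norm q" using S(11)[of n "S n r q"] by (simp add: S(3))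
        show "norm ((e n)\<^sup>2 *\<^sub>R M n (G (S n r z))) \<le> e n * norm z" using S(12)[of n "S n r z"] by (simp add: S(3))
        have "norm (S n r (G z) - G z) \<le> 2 * norm z * \<bar>r\<bar>" using SLip[of n r z 0] by (simp add: S(1))
        also have "\<dots> \<le> 2 * norm z * \<bar>h\<bar>" using r by (intro mult_left_mono) auto
        finally show "norm (S n r (G z) - G z) \<le> 2 * norm z * \<bar>h\<bar>" .
      qed (simp_all add: S(3))
      finally have b: "norm (- G (M n (S n r (G y))) - y) \<le> norm (y - G z) * 3 + 2 * norm z * \<bar>h\<bar> + e n * norm z"
        by (simp add: q_def)
      show "onorm (\<lambda>k. k *\<^sub>R (- G (M n (S n r (G y))) - y)) \<le> norm (y - G z) * 3 + 2 * norm z * \<bar>h\<bar> + e n * norm z"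
      proof (rule onorm_le)
        show "norm (k *\<^sub>R (- G (M n (S n r (G y))) - y)) \<le> (norm (y - G z) * 3 + 2 * norm z * \<bar>h\<bar> + e n * norm z) * norm k" for k
          using mult_left_mono[OF b, of "\<bar>k\<bar>"] by (simp add: mult.commute)
      qed
    qed auto
    then show ?thesis by (simp add: S(1) algebra_simps)
  qed
  have Test: "norm (T h (G y) - G y - h *\<^sub>R y) \<le> \<bar>h\<bar> * (3 * norm (y - G z) + 2 * norm z * \<bar>h\<bar>)" for h y z
  proof (rule LIMSEQ_le)
    show "(\<lambda>n. norm (S n h (G y) - G y - h *\<^sub>R y)) \<longlonglongrightarrow> norm (T h (G y) - G y - h *\<^sub>R y)"
      by (intro tendsto_intros T GX)
    have "(\<lambda>n. (norm (y - G z) * 3 + 2 * norm z * \<bar>h\<bar> + e n * norm z) * \<bar>h\<bar>) \<longlonglongrightarrow>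
      (norm (y - G z) * 3 + 2 * norm z * \<bar>h\<bar> + 0 * norm z) * \<bar>h\<bar>"
      by (intro tendsto_intros e0)
    then show "(\<lambda>n. (norm (y - G z) * 3 + 2 * norm z * \<bar>h\<bar> + e n * norm z) * \<bar>h\<bar>) \<longlonglongrightarrow>
      \<bar>h\<bar> * (3 * norm (y - G z) + 2 * norm z * \<bar>h\<bar>)" by (simp add: mult.commute)
  qed (use est in blast)
  have "unitary_C0_group X T"
    unfolding unitary_C0_group_def linear_operator_def
  proof (intro conjI allI ballI)
    show "T t ` X = X" for t
    proof
      show "T t ` X \<subseteq> X" using TX by auto
      show "X \<subseteq> T t ` X"
      proof
        fix x assume x: "x \<in> X"
        then have "x = T t (T (-t) x)" using Tgroup[OF x, of t "-t"] T0 by simp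
        then show "x \<in> T t ` X" using TX[OF x] by blast
      qed
    qed
  qed (use X T0 Tnorm Tadd Tscale Tgroup Tcont in auto)
  then show ?thesis using Test by (rule that)
qed

end

section \<open>Identification of the generator, and skew-adjointness\<close>

context skew_inverse
begin

interpretation G: bounded_linear G by (rule G)

text \<open>\<open>unitary_group_of\<close> is a choice, so it suffices to exhibit one group
  generated by \<open>J\<close>. The estimate of the difference quotient puts the range of
  \<open>G\<close> into the domain of the generator; the converse inclusion is a duality
  argument.\<close>

lemma unitary_group_of_inverse:
  assumes D: "D = G ` X" and J: "\<And>y. y \<in> X \<Longrightarrow> J (G y) = y"
  shows "unitary_C0_group X (unitary_group_of X D J)" "generates X D J (unitary_group_of X D J)"
proof -
  obtain T where T: "unitary_C0_group X T"
    and est: "\<And>h y z. norm (T h (G y) - G y - h *\<^sub>R y) \<le> \<bar>h\<bar> * (3 * norm (y - G z) + 2 * norm z * \<bar>h\<bar>)"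
    by (rule unitary_group_exists, rule that, assumption+)
  have lin: "linear_operator X (T t)" and norm: "x \<in> X \<Longrightarrow> norm (T t x) = norm x" for t x
    using T by (auto simp: unitary_C0_group_def)
  have TX: "x \<in> X \<Longrightarrow> T t x \<in> X" for t x
    using T unfolding unitary_C0_group_def by blast
  have T0: "x \<in> X \<Longrightarrow> T 0 x = x" and group: "x \<in> X \<Longrightarrow> T (s + t) x = T s (T t x)" for s t x
    using T by (auto simp: unitary_C0_group_def)
  have Tadd: "T t (x + y) = T t x + T t y" if "x \<in> X" "y \<in> X" for t x y
    using lin that by (simp add: linear_operator_def)
  have inner: "T t x \<bullet> T t y = x \<bullet> y" if "x \<in> X" "y \<in> X" for t x y
    using that X by (simp add: dot_norm norm subspace_add flip: Tadd)
  have lim: "((\<lambda>h. (T h (G y) - G y) /\<^sub>R h) \<longlongrightarrow> y) (at 0)" if y: "y \<in> X" for y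
  proof (rule LIM_I)
    fix r :: real assume r: "r > 0"
    then have r6: "r / 6 > 0" by simp
    obtain z where z: "z \<in> X" "norm (y - G z) < r / 6" using dense_approx[OF y r6] by blast
    define d where "d = r / (4 * (norm z + 1))"
    have nz: "norm z + 1 > 0" by (simp add: add_nonneg_pos)
    show "\<exists>s>0. \<forall>h. h \<noteq> 0 \<and> norm (h - 0) < s \<longrightarrow> norm ((T h (G y) - G y) /\<^sub>R h - y) < r"
    proof (intro exI[of _ d] conjI allI impI)
      show "d > 0" using r nz by (simp add: d_def)
      fix h :: real assume h: "h \<noteq> 0 \<and> norm (h - 0) < d"
      have "(T h (G y) - G y) /\<^sub>R h - y = (T h (G y) - G y - h *\<^sub>R y) /\<^sub>R h"
        using h by (simp add: scaleR_diff_right)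
      then have "norm ((T h (G y) - G y) /\<^sub>R h - y) = norm (T h (G y) - G y - h *\<^sub>R y) / \<bar>h\<bar>"
        by (simp add: divide_inverse_commute)
      also have "\<dots> \<le> \<bar>h\<bar> * (3 * norm (y - G z) + 2 * norm z * \<bar>h\<bar>) / \<bar>h\<bar>"
        using est by (intro divide_right_mono) auto
      also have "\<dots> = 3 * norm (y - G z) + 2 * norm z * \<bar>h\<bar>" using h by simp
      also have "\<dots> < r / 2 + r / 2"
      proof (rule add_strict_mono)
        show "3 * norm (y - G z) < r / 2" using z by simp
        have "2 * norm z * \<bar>h\<bar> \<le> 2 * (norm z + 1) * \<bar>h\<bar>" by (intro mult_right_mono) auto
        also have "\<dots> < 2 * (norm z + 1) * d" using h nz by (intro mult_strict_left_mono) auto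
        also have "\<dots> = r / 2"
        proof -
          have cancel: "2 * q * (r / (4 * q)) = r / 2" if "q > 0" for q
            using that by (simp add: field_simps)
          show ?thesis unfolding d_def by (rule cancel[OF nz])
        qed
        finally show "2 * norm z * \<bar>h\<bar> < r / 2" .
      qed
      finally show "norm ((T h (G y) - G y) /\<^sub>R h - y) < r" by simp
    qed
  qed
  \<comment> \<open>Unitarity moves the difference quotient from \<open>x\<close> to
    \<open>G z\<close>, with time reversed. In the limit
    \<open>y \<bullet> G z = - (x \<bullet> z)\<close> for all \<open>z\<close> in \<open>X\<close>,
    and by skewness the left side is \<open>- (G y \<bullet> z)\<close>.\<close>
  have conv: "x = G y" if x: "x \<in> X" and y: "y \<in> X"
    and l: "((\<lambda>h. (T h x - x) /\<^sub>R h) \<longlongrightarrow> y) (at 0)" for x y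
  proof -
    have "y \<bullet> G z = - (x \<bullet> z)" if z: "z \<in> X" for z
    proof -
      have lim_left: "((\<lambda>h. ((T h x - x) /\<^sub>R h) \<bullet> G z) \<longlongrightarrow> y \<bullet> G z) (at 0)"
        by (intro tendsto_intros l)
      have lim_right: "((\<lambda>h. x \<bullet> - ((T (- h) (G z) - G z) /\<^sub>R (- h))) \<longlongrightarrow> x \<bullet> - z) (at 0)"
      proof (intro tendsto_intros)
        have "filterlim (\<lambda>h::real. - h) (at 0) (at 0)"
          using filtermap_at_minus[of "0::real"] by (simp add: filterlim_def)
        from filterlim_compose[OF lim[OF z] this]
        show "((\<lambda>h. (T (- h) (G z) - G z) /\<^sub>R - h) \<longlongrightarrow> z) (at 0)" .
      qed
      have eq: "((T h x - x) /\<^sub>R h) \<bullet> G z = x \<bullet> - ((T (- h) (G z) - G z) /\<^sub>R (- h))" for h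
      proof -
        have "T h x \<bullet> G z = T h x \<bullet> T h (T (- h) (G z))"
          using group[OF GX, of h "- h" z] T0[OF GX] by simp
        also have "\<dots> = x \<bullet> T (- h) (G z)" by (rule inner[OF x TX[OF GX]])
        finally show ?thesis by (simp add: inner_diff_left inner_diff_right inner_commute)
      qed
      have "y \<bullet> G z = x \<bullet> - z" by (rule LIM_unique[OF lim_left[unfolded eq] lim_right])
      then show ?thesis by simp
    qed
    then have "(x - G y) \<bullet> z = 0" if "z \<in> X" for z
      using skew[of y z] that by (simp add: inner_diff_left)
    moreover have "x - G y \<in> X" using x GX X by (simp add: subspace_diff)
    ultimately show ?thesis by (metis inner_eq_zero_iff right_minus_eq)
  qed
  have "generates X D J T"
    unfolding generates_def
  proof (intro conjI ballI)
    show "D = {x \<in> X. \<exists>y\<in>X. ((\<lambda>h. (T h x - x) /\<^sub>R h) \<longlongrightarrow> y) (at 0)}"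
      using lim conv GX by (auto simp: D)
    show "((\<lambda>h. (T h x - x) /\<^sub>R h) \<longlongrightarrow> J x) (at 0)" if "x \<in> D" for x
      using that lim by (auto simp: D J)
  qed
  with T have "unitary_C0_group X T \<and> generates X D J T" by simp
  then have "unitary_C0_group X (unitary_group_of X D J) \<and> generates X D J (unitary_group_of X D J)"
    unfolding unitary_group_of_def by (rule someI[of "\<lambda>S. unitary_C0_group X S \<and> generates X D J S"])
  then show "unitary_C0_group X (unitary_group_of X D J)" "generates X D J (unitary_group_of X D J)"
    by auto
qed

text \<open>Since the values of \<open>J\<close> exhaust \<open>X\<close>, the adjoint relation
  pairs \<open>z\<close> with \<open>y\<close> exactly when \<open>z = - G y\<close>. Hence the
  adjoint has the domain \<open>G X\<close>, which is \<open>D\<close>, and acts there as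
  \<open>- J\<close>.\<close>

lemma inverse_skew_adjoint:
  assumes D: "D = G ` X" and J: "\<And>y. y \<in> X \<Longrightarrow> J (G y) = y"
  shows "skew_adjoint X D J" "linear_operator D J" "\<And>z. z \<in> D \<Longrightarrow> J z \<bullet> z = 0"
    "D \<subseteq> X" "J ` D \<subseteq> X"
proof -
  show DX: "D \<subseteq> X" and JX: "J ` D \<subseteq> X" using GX by (auto simp: D J)
  show "J z \<bullet> z = 0" if "z \<in> D" for z
    using that skew_self by (auto simp: D J inner_commute)
  show "linear_operator D J"
    unfolding linear_operator_def
  proof (intro conjI ballI allI)
    show "subspace D" unfolding D by (rule linear_subspace_image) (simp_all add: X G.linear)
    show "J (x + y) = J x + J y" if "x \<in> D" "y \<in> D" for x y
      using that X by (auto simp: D J subspace_add simp flip: G.add)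
    show "J (c *\<^sub>R x) = c *\<^sub>R J x" if "x \<in> D" for x c
      using that X by (auto simp: D J subspace_scale simp flip: G.scale)
  qed
  have rel: "(\<forall>x\<in>D. J x \<bullet> z = x \<bullet> y) \<longleftrightarrow> z = - G y" if z: "z \<in> X" for y z
  proof
    assume "\<forall>x\<in>D. J x \<bullet> z = x \<bullet> y"
    then have "s \<bullet> (z + G y) = 0" if "s \<in> X" for s
      using that skew[of s y] by (auto simp: D J inner_add_right)
    moreover have "z + G y \<in> X" using z GX X by (simp add: subspace_add)
    ultimately have "z + G y = 0" by (metis inner_eq_zero_iff)
    then show "z = - G y" by (simp add: add_eq_0_iff2)
  next
    assume "z = - G y"
    then show "\<forall>x\<in>D. J x \<bullet> z = x \<bullet> y" by (auto simp: D J skew)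
  qed
  show "skew_adjoint X D J"
    unfolding skew_adjoint_def
  proof (intro conjI ballI)
    show "X \<subseteq> closure D" using dense by (simp add: D)
    show "adjoint_domain X X D J = D"
    proof (intro set_eqI iffI)
      fix z assume "z \<in> adjoint_domain X X D J"
      then obtain y where "z \<in> X" "y \<in> X" "z = - G y" by (auto simp: adjoint_domain_def rel)
      then have "z = G (- y)" "- y \<in> X" using X by (auto simp: G.neg subspace_neg)
      then show "z \<in> D" by (simp add: D)
    next
      fix z assume "z \<in> D"
      then obtain y where "y \<in> X" "z = G y" by (auto simp: D)
      then have "z \<in> X" "- y \<in> X" "z = - G (- y)" using X GX by (auto simp: G.neg subspace_neg)
      then show "z \<in> adjoint_domain X X D J"
        unfolding adjoint_domain_def using rel[of z "- y"] by blast
    qed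
    show "adjoint_operator X D J z = - J z" if "z \<in> D" for z
    proof -
      obtain y where y: "y \<in> X" "z = G y" using \<open>z \<in> D\<close> by (auto simp: D)
      have zX: "z \<in> X" using y GX by simp
      show ?thesis
        unfolding adjoint_operator_def rel[OF zX]
      proof (rule the_equality)
        show "- J z \<in> X \<and> z = - G (- J z)" using y X by (simp add: J G.neg subspace_neg)
        fix y' assume y': "y' \<in> X \<and> z = - G y'"
        then have "G (y' + y) = 0" using y by (simp add: G.add)
        then have "y' + y = 0" using inj y y' X by (simp add: subspace_add)
        then show "y' = - J z" using y by (simp add: J add_eq_0_iff2)
      qed
    qed
  qed (use DX JX in auto)
qed

end

section \<open>Mild solutions of monotone evolution equations\<close>

locale unitary_group =
  fixes X :: "'a::{real_inner,banach} set" and S :: "real \<Rightarrow> 'a \<Rightarrow> 'a"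
  assumes X: "subspace X" "closed X" and S: "unitary_C0_group X S"
begin

lemma S_closed: "x \<in> X \<Longrightarrow> S t x \<in> X"
  using S unfolding unitary_C0_group_def by blast

lemma S_norm: "x \<in> X \<Longrightarrow> norm (S t x) = norm x"
  using S by (simp add: unitary_C0_group_def)

lemma S_0: "x \<in> X \<Longrightarrow> S 0 x = x"
  using S by (simp add: unitary_C0_group_def)

lemma S_add: "x \<in> X \<Longrightarrow> S s (S t x) = S (s + t) x"
  using S by (simp add: unitary_C0_group_def)

lemma S_plus: "x \<in> X \<Longrightarrow> y \<in> X \<Longrightarrow> S t (x + y) = S t x + S t y"
  using S by (simp add: unitary_C0_group_def linear_operator_def)

lemma S_scale: "x \<in> X \<Longrightarrow> S t (c *\<^sub>R x) = c *\<^sub>R S t x"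
  using S by (simp add: unitary_C0_group_def linear_operator_def)

lemma S_diff: "x \<in> X \<Longrightarrow> y \<in> X \<Longrightarrow> S t (x - y) = S t x - S t y"
  using S_plus[of x "(-1) *\<^sub>R y" t] S_scale[of y t "-1"] X by (simp add: subspace_neg)

lemma S_inner: "x \<in> X \<Longrightarrow> y \<in> X \<Longrightarrow> S t x \<bullet> S t y = x \<bullet> y"
  using X by (simp add: dot_norm S_norm subspace_add flip: S_plus)

lemma continuous_on_S:
  assumes r: "continuous_on A r" and g: "continuous_on A g" "g ` A \<subseteq> X"
  shows "continuous_on A (\<lambda>s. S (r s) (g s))"
  unfolding continuous_on_def
proof
  fix a assume a: "a \<in> A"
  have gX: "g s \<in> X" if "s \<in> A" for s using that g by auto
  have 1: "((\<lambda>s. S (r s) (g a)) \<longlongrightarrow> S (r a) (g a)) (at a within A)"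
  proof -
    have "continuous_on UNIV (\<lambda>t. S t (g a))" using S gX[OF a] by (simp add: unitary_C0_group_def)
    from continuous_on_compose2[OF this r] show ?thesis using a by (auto simp: continuous_on_def)
  qed
  have 2: "((\<lambda>s. S (r s) (g s) - S (r s) (g a)) \<longlongrightarrow> 0) (at a within A)"
  proof (rule tendsto_norm_zero_cancel)
    have "((\<lambda>s. norm (g s - g a)) \<longlongrightarrow> 0) (at a within A)"
      using g(1) a by (simp add: continuous_on_def tendsto_norm_zero LIM_zero)
    then show "((\<lambda>s. norm (S (r s) (g s) - S (r s) (g a))) \<longlongrightarrow> 0) (at a within A)"
    proof (rule Lim_transform_eventually)
      show "\<forall>\<^sub>F s in at a within A. norm (g s - g a) = norm (S (r s) (g s) - S (r s) (g a))"
        using gX a X by (auto simp: eventually_at_filter S_norm subspace_diff simp flip: S_diff)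
    qed
  qed
  from tendsto_add[OF 2 1] show "((\<lambda>s. S (r s) (g s)) \<longlongrightarrow> S (r a) (g a)) (at a within A)" by simp
qed

text \<open>\<open>S t\<close> is linear on \<open>X\<close> only; behind the projection it becomes
  an operator on the whole type, to which the rules for integrals and derivatives apply.\<close>

lemma bounded_linear_S:
  assumes P: "bounded_linear P" "\<And>x. P x \<in> X"
  shows "bounded_linear (\<lambda>x. S t (P x))"
proof -
  interpret P: bounded_linear P by (rule P)
  obtain K where "\<And>x. norm (P x) \<le> norm x * K" using P.bounded by blast
  then show ?thesis
    by (intro bounded_linear_intro[where K = K]) (auto simp: P.add P.scale S_plus S_scale S_norm P(2))
qed

lemma integral_S:
  fixes a b :: real
  assumes g: "continuous_on {a..b} g" "g ` {a..b} \<subseteq> X"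
  shows "integral {a..b} g \<in> X" "S t (integral {a..b} g) = integral {a..b} (\<lambda>s. S t (g s))"
proof -
  obtain P where P: "bounded_linear P" "\<And>x. P x \<in> X" "\<And>x. x \<in> X \<Longrightarrow> P x = x"
    using closed_subspace_bounded_projection[OF X] by metis
  have int: "g integrable_on {a..b}" by (rule integrable_continuous_interval[OF g(1)])
  have "P (integral {a..b} g) = integral {a..b} (P \<circ> g)"
    by (rule integral_linear[OF int P(1), symmetric])
  also have "\<dots> = integral {a..b} g"
    by (rule Henstock_Kurzweil_Integration.integral_cong) (use g P(3) in \<open>auto simp: image_subset_iff\<close>)
  finally show I: "integral {a..b} g \<in> X" using P(2) by metis
  have "integral {a..b} ((\<lambda>x. S t (P x)) \<circ> g) = S t (P (integral {a..b} g))"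
    by (rule integral_linear[OF int bounded_linear_S[OF P(1,2)]])
  also have "integral {a..b} ((\<lambda>x. S t (P x)) \<circ> g) = integral {a..b} (\<lambda>s. S t (g s))"
    by (rule Henstock_Kurzweil_Integration.integral_cong) (use g P(3) in \<open>auto simp: image_subset_iff\<close>)
  finally show "S t (integral {a..b} g) = integral {a..b} (\<lambda>s. S t (g s))" using P(3)[OF I] by simp
qed

text \<open>The group law transports the derivative at 0 to time \<open>t\<close>, through
  \<open>S r x = S t (S (r - t) x)\<close>.\<close>

lemma S_has_vector_derivative:
  assumes gen: "generates X D J S" and x: "x \<in> D"
  shows "((\<lambda>t. S t x) has_vector_derivative S t (J x)) (at t)"
proof -
  have lim: "((\<lambda>h. (S h x - x) /\<^sub>R h) \<longlongrightarrow> J x) (at 0)" and xX: "x \<in> X" 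
    using gen x by (auto simp: generates_def)
  obtain y where y: "y \<in> X" "((\<lambda>h. (S h x - x) /\<^sub>R h) \<longlongrightarrow> y) (at 0)"
    using gen x unfolding generates_def by blast
  \<comment> \<open>\<open>generates\<close> yields some limit in \<open>X\<close>; uniqueness of
    limits identifies it with \<open>J x\<close>.\<close>
  have JX: "J x \<in> X" using LIM_unique[OF lim y(2)] y(1) by simp
  obtain P where P: "bounded_linear P" "\<And>x. P x \<in> X" "\<And>x. x \<in> X \<Longrightarrow> P x = x"
    using closed_subspace_bounded_projection[OF X] by metis
  have "((\<lambda>h. S h x) has_derivative (\<lambda>h. h *\<^sub>R J x)) (at 0)"
    unfolding has_derivative_at
  proof (intro conjI bounded_linear_scaleR_left)
    have "((\<lambda>h. norm ((S h x - x) /\<^sub>R h - J x)) \<longlongrightarrow> 0) (at 0)"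
      using lim by (simp add: tendsto_norm_zero LIM_zero)
    then show "(\<lambda>h. norm (S (0 + h) x - S 0 x - h *\<^sub>R J x) / norm h) \<midarrow>0\<rightarrow> 0"
    proof (rule Lim_transform_eventually)
      show "\<forall>\<^sub>F h in at 0. norm ((S h x - x) /\<^sub>R h - J x) = norm (S (0 + h) x - S 0 x - h *\<^sub>R J x) / norm h"
        unfolding eventually_at_filter
      proof (intro always_eventually allI impI)
        fix h :: real assume h: "h \<noteq> 0"
        have "(S h x - x) /\<^sub>R h - J x = (S h x - x - h *\<^sub>R J x) /\<^sub>R h"
          using h by (simp add: scaleR_diff_right)
        then show "norm ((S h x - x) /\<^sub>R h - J x) = norm (S (0 + h) x - S 0 x - h *\<^sub>R J x) / norm h"
          by (simp add: S_0[OF xX] divide_inverse_commute)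
      qed
    qed
  qed
  then have 0: "((\<lambda>h. S h x) has_vector_derivative J x) (at (t - t))"
    by (simp add: has_vector_derivative_def)
  have "((\<lambda>r. r - t) has_vector_derivative 1) (at t)" by (auto intro!: derivative_eq_intros)
  from vector_diff_chain_at[OF this 0]
  have "((\<lambda>r. S (r - t) x) has_vector_derivative J x) (at t)" by (simp add: o_def)
  from bounded_linear.has_vector_derivative[OF bounded_linear_S[OF P(1,2), of t] this]
  show ?thesis using xX by (simp add: P JX S_closed S_add)
qed

end

locale monotone_evolution = unitary_group X "unitary_group_of X D J"
  for X :: "'a::{real_inner,banach} set" and D J +
  fixes R :: "'a \<Rightarrow> 'a" and c :: 'a and L :: real
  assumes gen: "generates X D J (unitary_group_of X D J)"
    and RX: "\<And>x. x \<in> X \<Longrightarrow> R x \<in> X" and cX: "c \<in> X"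
    and R_lipschitz: "\<And>x y. x \<in> X \<Longrightarrow> y \<in> X \<Longrightarrow> norm (R x - R y) \<le> L * norm (x - y)"
    and R_monotone: "\<And>x y. x \<in> X \<Longrightarrow> y \<in> X \<Longrightarrow> 0 \<le> (R x - R y) \<bullet> (x - y)"
begin

abbreviation "S \<equiv> unitary_group_of X D J"

lemma R_continuous: "continuous_on X R"
proof (rule lipschitz_on_continuous_on)
  show "\<bar>L\<bar>-lipschitz_on X R"
  proof (rule lipschitz_onI)
    show "dist (R x) (R y) \<le> \<bar>L\<bar> * dist x y" if "x \<in> X" "y \<in> X" for x y
      using order_trans[OF R_lipschitz[OF that] mult_right_mono[OF abs_ge_self norm_ge_zero]]
      by (simp add: dist_norm)
  qed simp
qed

lemma continuous_on_forcing:
  assumes "continuous_on A w" "w ` A \<subseteq> X"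
  shows "continuous_on A (\<lambda>s. R (w s) + c)" "(\<lambda>s. R (w s) + c) ` A \<subseteq> X"
  using assms RX cX X
  by (auto intro!: continuous_intros continuous_on_compose2[OF R_continuous] subspace_add)

text \<open>In the variable \<open>S (- t) (w t)\<close> the equation becomes an ordinary differential equation.\<close>

lemma mild_solution_transform:
  assumes w: "mild_solution X D J R c w0 w" and w0: "w0 \<in> X" and t: "t \<ge> 0"
  shows "S (- t) (w t) = w0 - integral {0..t} (\<lambda>s. S (- s) (R (w s) + c))"
proof -
  have w': "continuous_on {0..} w" "w ` {0..} \<subseteq> X"
    "w t = S t w0 - integral {0..t} (\<lambda>s. S (t - s) (R (w s) + c))"
    using w t by (auto simp: mild_solution_def)
  have sub: "{0..t} \<subseteq> {0..}" by auto
  have wt: "continuous_on {0..t} w" "w ` {0..t} \<subseteq> X"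
    using w' sub by (auto intro: continuous_on_subset)
  note f = continuous_on_forcing[OF wt]
  have fX: "R (w s) + c \<in> X" if "s \<in> {0..t}" for s using f(2) that by auto
  have g: "continuous_on {0..t} (\<lambda>s. S (t - s) (R (w s) + c))" "(\<lambda>s. S (t - s) (R (w s) + c)) ` {0..t} \<subseteq> X"
    using f fX by (auto intro!: continuous_on_S continuous_intros S_closed)
  have "S (- t) (w t) = w0 - integral {0..t} (\<lambda>s. S (- t) (S (t - s) (R (w s) + c)))"
    unfolding w'(3) using w0 integral_S[OF g] by (simp add: S_diff S_closed S_add S_0)
  also have "integral {0..t} (\<lambda>s. S (- t) (S (t - s) (R (w s) + c))) = integral {0..t} (\<lambda>s. S (- s) (R (w s) + c))"
    by (rule Henstock_Kurzweil_Integration.integral_cong) (use fX in \<open>simp add: S_add\<close>)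
  finally show ?thesis .
qed

text \<open>Mild solutions need not be differentiable, but \<open>d s = S (- s) (w s - v s)\<close>
  is. By unitarity \<open>d' \<bullet> d\<close> equals
  \<open>- ((R w - R v) \<bullet> (w - v))\<close>, which is nonpositive.\<close>

lemma mild_solution_contraction:
  assumes w: "mild_solution X D J R c w0 w" and v: "mild_solution X D J R c v0 v"
    and w0: "w0 \<in> X" and v0: "v0 \<in> X" and t: "t \<ge> 0"
  shows "norm (w t - v t) \<le> norm (w0 - v0)"
proof (cases "t = 0")
  case True
  then show ?thesis using w v w0 v0 by (simp add: mild_solution_def S_0)
next
  case False
  with t have t: "0 < t" by simp
  have sub: "{0..t} \<subseteq> {0..}" by auto
  have X': "w s \<in> X" "v s \<in> X" if "s \<ge> 0" for s using w v that by (auto simp: mild_solution_def)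
  have cont: "continuous_on {0..t} (\<lambda>s. S (- s) (R (u s) + c))" if "mild_solution X D J R c u0 u" for u u0
  proof -
    have "continuous_on {0..t} u" "u ` {0..t} \<subseteq> X"
      using that sub by (auto simp: mild_solution_def intro: continuous_on_subset)
    from continuous_on_forcing[OF this] show ?thesis by (auto intro!: continuous_on_S continuous_intros)
  qed
  \<comment> \<open>Written with integrals rather than with the group, so that it is visibly
    differentiable.\<close>
  define d where "d s = (w0 - integral {0..s} (\<lambda>s. S (- s) (R (w s) + c)))
      - (v0 - integral {0..s} (\<lambda>s. S (- s) (R (v s) + c)))" for s
  have d: "d s = S (- s) (w s - v s)" if "s \<ge> 0" for s
    using mild_solution_transform[OF w w0 that] mild_solution_transform[OF v v0 that] X'[OF that]
    by (simp add: d_def S_diff)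
  define d' where "d' s = (0 - S (- s) (R (w s) + c)) - (0 - S (- s) (R (v s) + c))" for s
  have deriv: "(d has_vector_derivative d' s) (at s within {0..t})" if "s \<in> {0..t}" for s
    unfolding d_def[abs_def] d'_def
    by (intro has_vector_derivative_diff has_vector_derivative_const integral_has_vector_derivative
        cont[OF w] cont[OF v] that)
  have d'_eq: "d' s \<bullet> d s \<le> 0" if "s \<ge> 0" for s
  proof -
    have "d' s = - S (- s) (R (w s) - R (v s))"
      using S_diff[of "R (w s) + c" "R (v s) + c" "- s"] X'[OF that] RX cX X
      by (simp add: d'_def subspace_add)
    then have "d' s \<bullet> d s = - ((R (w s) - R (v s)) \<bullet> (w s - v s))"
      using X'[OF that] RX X by (simp add: d[OF that] S_inner subspace_diff)
    then show ?thesis using R_monotone X'[OF that] by simp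
  qed
  have "(norm (d t))\<^sup>2 \<le> (norm (d 0))\<^sup>2"
  proof (rule DERIV_nonpos_imp_decreasing_open[of 0 t "\<lambda>s. (norm (d s))\<^sup>2"])
    show "continuous_on {0..t} (\<lambda>s. (norm (d s))\<^sup>2)"
      by (intro continuous_intros continuous_on_vector_derivative[of _ d d'] deriv)
    fix s assume s: "0 < s" "s < t"
    then have "(d has_vector_derivative d' s) (at s)"
      using deriv[of s] at_within_interior[of s "{0..t}"] by (simp add: interior_atLeastAtMost_real)
    then have "((\<lambda>s. (norm (d s))\<^sup>2) has_real_derivative 2 * (d' s \<bullet> d s)) (at s)"
      by (rule has_real_derivative_norm_squared)
    moreover have "2 * (d' s \<bullet> d s) \<le> 0" using d'_eq s by simp
    ultimately show "\<exists>y. ((\<lambda>s. (norm (d s))\<^sup>2) has_real_derivative y) (at s) \<and> y \<le> 0" by blast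
  qed (use t in simp)
  then have "norm (d t) \<le> norm (d 0)" by simp
  moreover have "norm (d t) = norm (w t - v t)"
    using d[of t] t X'[of t] X by (simp add: S_norm subspace_diff)
  ultimately show ?thesis by (simp add: d_def)
qed

text \<open>The transformed equation is solved on the whole type with \<open>P\<close> in front of
  the unknown. Since the right-hand side takes values in \<open>X\<close>, the solution stays there
  and \<open>P\<close> disappears.\<close>

lemma mild_solution_exists:
  assumes w0: "w0 \<in> X"
  shows "\<exists>w. mild_solution X D J R c w0 w"
proof -
  obtain P where P: "bounded_linear P" "\<And>x. P x \<in> X" "\<And>x. x \<in> X \<Longrightarrow> P x = x"
    using closed_subspace_bounded_projection[OF X] by metis
  interpret P: bounded_linear P by (rule P)
  obtain K where K: "K \<ge> 0" "\<And>x. norm (P x) \<le> K * norm x" using bounded_linear_nonneg_bound[OF P(1)] by blast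
  define f where "f t z = - S (- t) (R (S t (P z)) + c)" for t z
  have inX: "R (S t (P z)) + c \<in> X" for t z
    using RX cX X S_closed P by (simp add: subspace_add)
  have fX: "f t z \<in> X" for t z
    unfolding f_def using S_closed[OF inX] X by (simp add: subspace_neg)
  obtain u where u: "u 0 = w0" "\<And>t. (u has_vector_derivative f t (u t)) (at t)"
  proof (rule global_ode_solution[of f "\<bar>L\<bar> * K" "norm (R 0 + c)" w0])
    fix u :: "real \<Rightarrow> 'a" assume u: "continuous_on UNIV u"
    have "continuous_on UNIV (\<lambda>t. S t (P (u t)))"
      using P(2) by (intro continuous_on_S continuous_intros P.continuous_on u) auto
    moreover have "range (\<lambda>t. S t (P (u t))) \<subseteq> X" using S_closed P(2) by auto
    ultimately have "continuous_on UNIV (\<lambda>t. R (S t (P (u t))) + c)" "range (\<lambda>t. R (S t (P (u t))) + c) \<subseteq> X"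
      using continuous_on_forcing by blast+
    then show "continuous_on UNIV (\<lambda>t. f t (u t))"
      unfolding f_def by (intro continuous_on_minus continuous_on_S) (auto intro: continuous_intros)
  next
    fix t x y
    have "f t x - f t y = - (S (- t) (R (S t (P x)) - R (S t (P y))))"
      unfolding f_def using S_diff[OF inX inX] by simp
    then have "norm (f t x - f t y) = norm (R (S t (P x)) - R (S t (P y)))"
      using RX S_closed P X by (simp add: S_norm subspace_diff)
    also have "\<dots> \<le> L * norm (S t (P x) - S t (P y))" by (rule R_lipschitz) (auto intro: S_closed P)
    also have "\<dots> = L * norm (P (x - y))"
      using P X by (simp add: S_norm subspace_diff P.diff flip: S_diff)
    also have "\<dots> \<le> \<bar>L\<bar> * (K * norm (x - y))" using K by (intro mult_mono) auto
    finally show "norm (f t x - f t y) \<le> \<bar>L\<bar> * K * norm (x - y)" by (simp add: mult.assoc)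
  next
    fix t
    have "S t 0 = 0" using S_norm[of 0 t] X by (simp add: subspace_0)
    then show "norm (f t 0) \<le> norm (R 0 + c)" using inX[of t 0] by (simp add: f_def P.zero S_norm)
  qed blast
  have uX: "u t \<in> X" for t by (rule closed_subspace_ode_invariant[OF X _ u(2) fX]) (simp add: u w0)
  define w where "w t = S t (u t)" for t
  have wX: "w t \<in> X" for t by (simp add: w_def S_closed uX)
  have f: "f t (u t) = - S (- t) (R (w t) + c)" for t using uX by (simp add: f_def w_def P)
  have cu: "continuous_on UNIV u" using u(2) has_vector_derivative_continuous by (blast intro: continuous_at_imp_continuous_on)
  then have cw: "continuous_on UNIV w" unfolding w_def using uX by (intro continuous_on_S continuous_intros) auto
  have F: "continuous_on UNIV (\<lambda>s. R (w s) + c)" using continuous_on_forcing[OF cw] wX by blast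
  have FX: "R (w s) + c \<in> X" for s using RX wX cX X by (simp add: subspace_add)
  have cf: "continuous_on UNIV (\<lambda>s. S (- s) (R (w s) + c))"
    by (intro continuous_on_S F) (use FX in \<open>auto intro: continuous_intros\<close>)
  have "w t = S t w0 - integral {0..t} (\<lambda>s. S (t - s) (R (w s) + c))" if t: "t \<ge> 0" for t
  proof -
    have "((\<lambda>s. - S (- s) (R (w s) + c)) has_integral (u t - u 0)) {0..t}"
      using u(2) by (intro fundamental_theorem_of_calculus[OF t]) (simp add: f has_vector_derivative_at_within)
    from integral_unique[OF this, symmetric]
    have "u t - u 0 = - integral {0..t} (\<lambda>s. S (- s) (R (w s) + c))" by simp
    then have ut: "u t = w0 - integral {0..t} (\<lambda>s. S (- s) (R (w s) + c))"
      by (simp add: u algebra_simps)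
    have g: "continuous_on {0..t} (\<lambda>s. S (- s) (R (w s) + c))" "(\<lambda>s. S (- s) (R (w s) + c)) ` {0..t} \<subseteq> X"
      using cf FX by (auto intro: continuous_on_subset S_closed)
    have "w t = S t w0 - integral {0..t} (\<lambda>s. S t (S (- s) (R (w s) + c)))"
      unfolding w_def ut using integral_S[OF g] w0 by (simp add: S_diff w_def[symmetric])
    then show ?thesis using FX by (simp add: S_add)
  qed
  then have "mild_solution X D J R c w0 w"
    unfolding mild_solution_def using wX continuous_on_subset[OF cw, of "{0..}"] by blast
  then show ?thesis by blast
qed

text \<open>\<open>- S (t - s) v\<close> is a primitive in \<open>s\<close> of
  \<open>S (t - s) (J v)\<close>, and \<open>J v = R v + c\<close> makes this the integrand of
  Duhamel's formula.\<close>

lemma steady_state_mild_solution: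
  assumes v: "steady_state D J R c v"
  shows "mild_solution X D J R c v (\<lambda>_. v)"
proof -
  have vD: "v \<in> D" and Jv: "J v = R v + c" using v by (auto simp: steady_state_def algebra_simps)
  have vX: "v \<in> X" using vD gen by (auto simp: generates_def)
  have "integral {0..t} (\<lambda>s. S (t - s) (R v + c)) = S t v - v" if t: "t \<ge> 0" for t
  proof -
    have "((\<lambda>s. S (t - s) (J v)) has_integral (- S (t - t) v - - S (t - 0) v)) {0..t}"
    proof (rule fundamental_theorem_of_calculus[OF t])
      fix s assume "s \<in> {0..t}"
      have "((\<lambda>r. t - r) has_vector_derivative -1) (at s)" by (auto intro!: derivative_eq_intros)
      from vector_diff_chain_at[OF this S_has_vector_derivative[OF gen vD]]
      have "((\<lambda>s. S (t - s) v) has_vector_derivative - S (t - s) (J v)) (at s)" by (simp add: o_def)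
      from has_vector_derivative_minus[OF this]
      show "((\<lambda>s. - S (t - s) v) has_vector_derivative S (t - s) (J v)) (at s within {0..t})"
        by (simp add: has_vector_derivative_at_within)
    qed
    then show ?thesis using vX by (simp add: Jv S_0 integral_unique)
  qed
  then show ?thesis using vX by (auto simp: mild_solution_def)
qed

end

section \<open>Completeness of the space of square-integrable functions\<close>

lemma square_integrable_rep: "square_integrable (rep_L2 x)"
  and abs_rep: "abs_L2 (rep_L2 x) = x"
proof -
  have "L2_eq (rep_L2 x) (rep_L2 x)" "abs_L2 (rep_L2 x) = x"
    using Quotient_L2 by (auto simp: Quotient_def)
  then show "square_integrable (rep_L2 x)" "abs_L2 (rep_L2 x) = x" by (auto simp: L2_eq_def)
qed

lemma rep_measurable [measurable]: "rep_L2 x \<in> borel_measurable lborel"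
  using square_integrable_rep[of x] by (simp add: square_integrable_def)

lemma rep_abs: "square_integrable f \<Longrightarrow> AE t in lborel. rep_L2 (abs_L2 f) t = f t"
proof -
  assume f: "square_integrable f"
  then have "L2_eq f f" by (simp add: L2_eq_def)
  then have "L2_eq (rep_L2 (abs_L2 f)) f" by (rule Quotient_rep_abs[OF Quotient_L2])
  then show ?thesis by (simp add: L2_eq_def)
qed

lemma abs_L2_eqI:
  assumes "square_integrable f" "square_integrable g" "AE t in lborel. f t = g t"
  shows "abs_L2 f = abs_L2 g"
  using assms Quotient_rel_abs[OF Quotient_L2, of f g] by (simp add: L2_eq_def)

lemma L2_eqI: "(AE t in lborel. rep_L2 x t = rep_L2 y t) \<Longrightarrow> x = y"
  using abs_L2_eqI[OF square_integrable_rep square_integrable_rep, of x y] by (simp add: abs_rep)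

lemma abs_L2_arith:
  assumes "square_integrable f" "square_integrable g"
  shows "abs_L2 f + abs_L2 g = abs_L2 (\<lambda>t. f t + g t)"
    "abs_L2 f - abs_L2 g = abs_L2 (\<lambda>t. f t - g t)"
    "c *\<^sub>R abs_L2 f = abs_L2 (\<lambda>t. c *\<^sub>R f t)"
    "abs_L2 f \<bullet> abs_L2 g = (LINT t|lborel. f t \<bullet> g t)"
  using assms
  by (auto intro!: plus_L2.abs_eq minus_L2.abs_eq scaleR_L2.abs_eq inner_L2.abs_eq simp: L2_eq_def)

text \<open>\<open>rep_L2\<close> chooses representatives arbitrarily, so it respects the operations
  only almost everywhere. Identities between classes are proved below by combining such statements
  pointwise and applying \<open>L2_eqI\<close>.\<close>

lemma rep_arith:
  "AE t in lborel. rep_L2 (x + y) t = rep_L2 x t + rep_L2 y t"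
  "AE t in lborel. rep_L2 (x - y) t = rep_L2 x t - rep_L2 y t"
  "AE t in lborel. rep_L2 (c *\<^sub>R x) t = c *\<^sub>R rep_L2 x t"
  "AE t in lborel. rep_L2 (0 :: 'a::euclidean_space L2) t = 0"
  for x y :: "'a::euclidean_space L2"
proof -
  note s = square_integrable_rep[of x] square_integrable_rep[of y]
  show "AE t in lborel. rep_L2 (x + y) t = rep_L2 x t + rep_L2 y t"
    using rep_abs[OF square_integrable_add[OF s]] abs_L2_arith(1)[OF s] by (simp add: abs_rep)
  show "AE t in lborel. rep_L2 (x - y) t = rep_L2 x t - rep_L2 y t"
    using rep_abs[OF square_integrable_diff[OF s]] abs_L2_arith(2)[OF s] by (simp add: abs_rep)
  show "AE t in lborel. rep_L2 (c *\<^sub>R x) t = c *\<^sub>R rep_L2 x t"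
    using rep_abs[OF square_integrable_scaleR[OF s(1)]] abs_L2_arith(3)[OF s] by (simp add: abs_rep)
  show "AE t in lborel. rep_L2 (0 :: 'a L2) t = 0"
    using rep_abs[OF square_integrable_zero] by (simp add: zero_L2_def)
qed

lemma inner_L2_eq: "x \<bullet> y = (LINT t|lborel. rep_L2 x t \<bullet> rep_L2 y t)"
  using abs_L2_arith(4)[OF square_integrable_rep square_integrable_rep, of x y] by (simp add: abs_rep)

lemma norm_L2_squared: "(norm x)\<^sup>2 = (LINT t|lborel. (norm (rep_L2 x t))\<^sup>2)"
  by (simp add: power2_norm_eq_inner inner_L2_eq)

lemma norm_abs_L2_squared: "square_integrable f \<Longrightarrow> (norm (abs_L2 f))\<^sup>2 = (LINT t|lborel. (norm (f t))\<^sup>2)"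
  by (simp add: power2_norm_eq_inner abs_L2_arith(4))

lemma nn_integral_norm_squared:
  "(\<integral>\<^sup>+t. ennreal ((norm (rep_L2 x t))\<^sup>2) \<partial>lborel) = ennreal ((norm x)\<^sup>2)"
  using square_integrable_rep[of x] by (simp add: norm_L2_squared nn_integral_eq_integral square_integrable_def)

text \<open>Riesz--Fischer. If the increments decay like \<open>2\<^sup>-\<^sup>n\<close> in norm then \<open>\<Sum>n. 2\<^sup>n \<bar>D\<^sub>n\<bar>\<^sup>2\<close> is integrable, hence
  finite almost everywhere, so that the increments are pointwise summable.\<close>

lemma L2_fast_Cauchy_converges:
  fixes X :: "nat \<Rightarrow> 'a::euclidean_space L2"
  assumes X: "\<And>n m. n \<le> m \<Longrightarrow> norm (X m - X n) \<le> (1/2) ^ n"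
  shows "convergent X"
proof -
  define f where "f n = rep_L2 (X n)" for n
  have [measurable]: "f n \<in> borel_measurable lborel" for n by (simp add: f_def)
  define D where "D n t = f (Suc n) t - f n t" for n t
  have [measurable]: "D n \<in> borel_measurable lborel" for n unfolding D_def by measurable
  have D: "(\<integral>\<^sup>+t. ennreal ((norm (D n t))\<^sup>2) \<partial>lborel) \<le> ennreal ((1/4) ^ n)" for n
  proof -
    have "(\<integral>\<^sup>+t. ennreal ((norm (D n t))\<^sup>2) \<partial>lborel) =
        (\<integral>\<^sup>+t. ennreal ((norm (rep_L2 (X (Suc n) - X n) t))\<^sup>2) \<partial>lborel)"
      using rep_arith(2)[of "X (Suc n)" "X n"] by (intro nn_integral_cong_AE) (auto simp: D_def f_def)
    also have "\<dots> = ennreal ((norm (X (Suc n) - X n))\<^sup>2)" by (rule nn_integral_norm_squared)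
    also have "\<dots> \<le> ennreal (((1/2) ^ n)\<^sup>2)" by (intro ennreal_leI power_mono X) auto
    also have "((1/2::real) ^ n)\<^sup>2 = (1/4) ^ n" by (simp add: power_mult[symmetric] mult.commute power_mult power2_eq_square flip: power_mult_distrib)
    finally show ?thesis .
  qed
  have "(\<integral>\<^sup>+t. (\<Sum>n. ennreal (2 ^ n * (norm (D n t))\<^sup>2)) \<partial>lborel) =
      (\<Sum>n. \<integral>\<^sup>+t. ennreal (2 ^ n * (norm (D n t))\<^sup>2) \<partial>lborel)"
    by (rule nn_integral_suminf) measurable
  also have "\<dots> \<le> (\<Sum>n. ennreal ((1/2) ^ n))"
  proof (rule suminf_le)
    show "(\<integral>\<^sup>+t. ennreal (2 ^ n * (norm (D n t))\<^sup>2) \<partial>lborel) \<le> ennreal ((1/2) ^ n)" for n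
    proof -
      have "(\<integral>\<^sup>+t. ennreal (2 ^ n * (norm (D n t))\<^sup>2) \<partial>lborel) = ennreal (2 ^ n) * (\<integral>\<^sup>+t. ennreal ((norm (D n t))\<^sup>2) \<partial>lborel)"
        by (subst nn_integral_cmult[symmetric]) (auto simp: ennreal_mult)
      also have "\<dots> \<le> ennreal (2 ^ n) * ennreal ((1/4) ^ n)" by (intro mult_left_mono D) auto
      also have "\<dots> = ennreal ((1/2) ^ n)" by (simp add: ennreal_mult[symmetric] flip: power_mult_distrib)
      finally show ?thesis .
    qed
  qed auto
  also have "\<dots> = ennreal (\<Sum>n. (1/2) ^ n)"
    by (intro suminf_ennreal2 summable_geometric) auto
  also have "\<dots> < \<infinity>" by simp
  finally have "(\<integral>\<^sup>+t. (\<Sum>n. ennreal (2 ^ n * (norm (D n t))\<^sup>2)) \<partial>lborel) \<noteq> \<infinity>" by simp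
  then have "AE t in lborel. (\<Sum>n. ennreal (2 ^ n * (norm (D n t))\<^sup>2)) \<noteq> \<infinity>"
    by (intro nn_integral_PInf_AE) auto
  then have conv: "AE t in lborel. convergent (\<lambda>n. f n t)"
  proof eventually_elim
    case (elim t)
    then have "summable (\<lambda>n. 2 ^ n * (norm (D n t))\<^sup>2)"
      by (intro summable_suminf_not_top) auto
    then have "(\<lambda>n. 2 ^ n * (norm (D n t))\<^sup>2) \<longlonglongrightarrow> 0" by (rule summable_LIMSEQ_zero)
    then have "\<forall>\<^sub>F n in sequentially. 2 ^ n * (norm (D n t))\<^sup>2 < 1" by (rule order_tendstoD) simp
    then have "\<forall>\<^sub>F n in sequentially. norm (D n t) \<le> sqrt (1/2) ^ n"
    proof eventually_elim
      case (elim n)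
      have "(sqrt (1/2) ^ n)\<^sup>2 = (1/2::real) ^ n" by (metis power_commutes power_even_eq power_mult real_sqrt_pow2 zero_le_divide_1_iff zero_le_numeral mult.commute)
      moreover have "(norm (D n t))\<^sup>2 \<le> (1/2) ^ n"
        using elim by (simp add: power_one_over field_simps)
      ultimately have "(norm (D n t))\<^sup>2 \<le> (sqrt (1/2) ^ n)\<^sup>2" by simp
      then show ?case by (rule power2_le_imp_le) simp
    qed
    moreover have "summable (\<lambda>n. sqrt (1/2) ^ n)"
      by (rule summable_geometric) (auto simp: real_sqrt_lt_1_iff)
    ultimately have "summable (\<lambda>n. D n t)"
      using summable_comparison_test_ev[of "\<lambda>n. D n t" "\<lambda>n. sqrt (1/2) ^ n"] by simp
    then have "convergent (\<lambda>n. \<Sum>i<n. D i t)" by (simp add: summable_iff_convergent)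
    then have "convergent (\<lambda>n. (\<Sum>i<n. D i t) + f 0 t)" by (intro convergent_add convergent_const)
    then show ?case using sum_lessThan_telescope[of "\<lambda>i. f i t"] by (simp add: D_def)
  qed
  define g where "g t = lim (\<lambda>n. f n t)" for t
  have [measurable]: "g \<in> borel_measurable lborel"
    unfolding g_def by (rule borel_measurable_lim_metric) simp
  \<comment> \<open>Fatou lets \<open>m\<close> tend to infinity in the Cauchy estimate. This gives
    the square integrability of the limit as well as the rate of convergence.\<close>
  have fatou: "(\<integral>\<^sup>+t. ennreal ((norm (g t - f n t))\<^sup>2) \<partial>lborel) \<le> ennreal ((1/4) ^ n)" for n
  proof -
    have "(\<integral>\<^sup>+t. ennreal ((norm (g t - f n t))\<^sup>2) \<partial>lborel)
        = (\<integral>\<^sup>+t. liminf (\<lambda>m. ennreal ((norm (f m t - f n t))\<^sup>2)) \<partial>lborel)"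
    proof (rule nn_integral_cong_AE)
      show "AE t in lborel. ennreal ((norm (g t - f n t))\<^sup>2) = liminf (\<lambda>m. ennreal ((norm (f m t - f n t))\<^sup>2))"
        using conv
      proof eventually_elim
        case (elim t)
        then have "(\<lambda>m. f m t) \<longlonglongrightarrow> g t" by (simp add: g_def convergent_LIMSEQ_iff)
        then have "(\<lambda>m. ennreal ((norm (f m t - f n t))\<^sup>2)) \<longlonglongrightarrow> ennreal ((norm (g t - f n t))\<^sup>2)"
          by (intro tendsto_intros)
        then show ?case by (intro lim_imp_Liminf[symmetric]) auto
      qed
    qed
    also have "\<dots> \<le> liminf (\<lambda>m. \<integral>\<^sup>+t. ennreal ((norm (f m t - f n t))\<^sup>2) \<partial>lborel)"
      by (rule nn_integral_liminf) measurable
    also have "\<dots> \<le> ennreal ((1/4) ^ n)"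
    proof (rule Liminf_le)
      show "\<forall>\<^sub>F m in sequentially. (\<integral>\<^sup>+t. ennreal ((norm (f m t - f n t))\<^sup>2) \<partial>lborel) \<le> ennreal ((1/4) ^ n)"
        using eventually_ge_at_top[of n]
      proof eventually_elim
        case (elim m)
        have "(\<integral>\<^sup>+t. ennreal ((norm (f m t - f n t))\<^sup>2) \<partial>lborel) =
            (\<integral>\<^sup>+t. ennreal ((norm (rep_L2 (X m - X n) t))\<^sup>2) \<partial>lborel)"
          using rep_arith(2)[of "X m" "X n"] by (intro nn_integral_cong_AE) (auto simp: f_def)
        also have "\<dots> = ennreal ((norm (X m - X n))\<^sup>2)" by (rule nn_integral_norm_squared)
        also have "\<dots> \<le> ennreal (((1/2) ^ n)\<^sup>2)" using elim by (intro ennreal_leI power_mono X) auto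
        also have "((1/2::real) ^ n)\<^sup>2 = (1/4) ^ n" by (simp add: power_mult[symmetric] mult.commute power_mult power2_eq_square flip: power_mult_distrib)
        finally show ?case .
      qed
    qed simp
    finally show ?thesis .
  qed
  have si: "square_integrable (\<lambda>t. g t - f n t)" for n
    unfolding square_integrable_def
  proof
    show "integrable lborel (\<lambda>t. (norm (g t - f n t))\<^sup>2)"
    proof (rule integrableI_nonneg)
      show "(\<integral>\<^sup>+ t. ennreal ((norm (g t - f n t))\<^sup>2) \<partial>lborel) < \<infinity>"
        using fatou[of n] by (simp add: le_less_trans)
    qed auto
  qed measurable
  have g: "square_integrable g"
    using square_integrable_add[OF si[of 0] square_integrable_rep[of "X 0"]] by (simp add: f_def)
  have bound: "norm (abs_L2 g - X n) \<le> (1/2) ^ n" for n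
  proof -
    have "abs_L2 g - X n = abs_L2 (\<lambda>t. g t - f n t)"
      using abs_L2_arith(2)[OF g square_integrable_rep[of "X n"]] by (simp add: abs_rep f_def)
    then have "(norm (abs_L2 g - X n))\<^sup>2 = (LINT t|lborel. (norm (g t - f n t))\<^sup>2)"
      by (simp add: norm_abs_L2_squared si)
    also have "ennreal \<dots> \<le> ennreal ((1/4) ^ n)"
      using fatou[of n] si[of n] by (simp add: nn_integral_eq_integral square_integrable_def)
    finally have "(norm (abs_L2 g - X n))\<^sup>2 \<le> (1/4) ^ n" by (simp add: ennreal_le_iff)
    also have "(1/4::real) ^ n = ((1/2) ^ n)\<^sup>2" by (simp add: power_mult[symmetric] mult.commute power_mult power2_eq_square flip: power_mult_distrib)
    finally show ?thesis by (rule power2_le_imp_le) simp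
  qed
  have "X \<longlonglongrightarrow> abs_L2 g"
  proof (rule Lim_transform2)
    show "(\<lambda>n. abs_L2 g) \<longlonglongrightarrow> abs_L2 g" by simp
    show "(\<lambda>n. abs_L2 g - X n) \<longlonglongrightarrow> 0"
      by (rule Lim_null_comparison[where g = "\<lambda>n. (1/2) ^ n"])
        (use bound in \<open>auto intro: LIMSEQ_power_zero\<close>)
  qed
  then show ?thesis by (rule convergentI)
qed

instance L2 :: (euclidean_space) banach
proof
  fix X :: "nat \<Rightarrow> 'a L2" assume X: "Cauchy X"
  have "\<exists>N. \<forall>m\<ge>N. \<forall>n\<ge>N. norm (X m - X n) < (1/2) ^ k" for k
    using CauchyD[OF X] by simp
  then obtain N where N: "\<And>k m n. m \<ge> N k \<Longrightarrow> n \<ge> N k \<Longrightarrow> norm (X m - X n) < (1/2) ^ k" by metis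
  \<comment> \<open>The sum makes \<open>r\<close> monotone with \<open>r k\<close> at least
    \<open>N k\<close>; the summand \<open>k\<close> makes it strictly monotone.\<close>
  define r where "r k = k + (\<Sum>i\<le>k. N i)" for k
  have rN: "r k \<ge> N k" for k
    unfolding r_def using member_le_sum[of k "{..k}" N] by simp
  have mono: "r j \<le> r k" if "j \<le> k" for j k
    unfolding r_def using that by (intro add_mono sum_mono2) auto
  have sub: "strict_mono r" by (rule strict_monoI_Suc) (simp add: r_def)
  have "convergent (X \<circ> r)"
  proof (rule L2_fast_Cauchy_converges)
    show "norm ((X \<circ> r) m - (X \<circ> r) n) \<le> (1/2) ^ n" if "n \<le> m" for n m
      using N[OF order_trans[OF rN mono[OF that]] rN] by (simp add: less_imp_le)
  qed
  then show "convergent X"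
    using X sub by (metis convergent_def Cauchy_converges_subseq)
qed

section \<open>Test functions on an interval\<close>

lemma borel_real_boxes: "borel = sigma UNIV (range (\<lambda>(a, b). {a<..<b::real}))"
  using borel_eq_box[where ?'a = real] by (simp add: box_real)

text \<open>A function is determined by its integrals over intervals, since these generate the Borel
  \<open>\<sigma>\<close>-algebra.\<close>

lemma AE_zero_of_interval_integrals:
  fixes h :: "real \<Rightarrow> 'a::euclidean_space"
  assumes h: "integrable lborel h"
    and zero: "\<And>a b. (LINT t|lborel. indicator {a<..<b} t *\<^sub>R h t) = 0"
  shows "AE t in lborel. h t = 0"
proof -
  have int: "integrable lborel (\<lambda>t. indicator A t *\<^sub>R h t)" if "A \<in> sets borel" for A
    using h that by (intro integrable_mult_indicator) auto
  \<comment> \<open>The complement step of the induction below needs the total integral, a limit of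
    integrals over \<open>(-n, n)\<close>.\<close>
  have UNIV: "(LINT t|lborel. h t) = 0"
  proof -
    have "(\<lambda>n. LINT t|lborel. indicator {- real n<..<real n} t *\<^sub>R h t) \<longlonglongrightarrow> (LINT t|lborel. h t)"
    proof (rule integral_dominated_convergence[where w = "\<lambda>t. norm (h t)"])
      show "AE t in lborel. (\<lambda>n. indicator {- real n<..<real n} t *\<^sub>R h t) \<longlonglongrightarrow> h t"
      proof (rule AE_I2)
        fix t :: real
        obtain N where N: "\<bar>t\<bar> < real N" using reals_Archimedean2 by blast
        have "\<forall>\<^sub>F n in sequentially. indicator {- real n<..<real n} t *\<^sub>R h t = h t"
          using eventually_ge_at_top[of N]
        proof eventually_elim
          case (elim n)
          then have "t \<in> {- real n<..<real n}" using N by auto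
          then show ?case by simp
        qed
        then show "(\<lambda>n. indicator {- real n<..<real n} t *\<^sub>R h t) \<longlonglongrightarrow> h t" by (rule tendsto_eventually)
      qed
      show "AE t in lborel. norm (indicator {- real n<..<real n} t *\<^sub>R h t) \<le> norm (h t)" for n
        by (auto simp: indicator_def)
    qed (use h int in \<open>auto intro: borel_measurable_integrable integrable_norm\<close>)
    then show ?thesis by (simp add: zero LIMSEQ_const_iff)
  qed
  have "(LINT t|lborel. indicator A t *\<^sub>R h t) = 0" if "A \<in> sets lborel" for A
  proof -
    from that have A: "A \<in> sigma_sets UNIV (range (\<lambda>(a, b). {a<..<b::real}))"
      by (metis borel_real_boxes sets_lborel sets_measure_of top_greatest Pow_UNIV)
    have sets: "B \<in> sets borel" if "B \<in> sigma_sets UNIV (range (\<lambda>(a, b). {a<..<b::real}))" for B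
      using that by (subst borel_real_boxes) (simp add: sets_measure_of)
    show ?thesis
    proof (rule sigma_sets_induct_disjoint[OF _ _ A])
      show "Int_stable (range (\<lambda>(a, b). {a<..<b::real}))"
      proof -
        have "{a<..<b} \<in> range (\<lambda>(a, b). {a<..<b::real})" for a b
          by (rule image_eqI[of _ _ "(a, b)"]) auto
        then show ?thesis by (intro Int_stableI) auto
      qed
      show "(LINT t|lborel. indicator B t *\<^sub>R h t) = 0" if "B \<in> range (\<lambda>(a, b). {a<..<b::real})" for B
        using that zero by auto
      fix B assume B: "B \<in> sigma_sets UNIV (range (\<lambda>(a, b). {a<..<b::real}))"
        and z: "(LINT t|lborel. indicator B t *\<^sub>R h t) = 0"
      have "(LINT t|lborel. indicator (UNIV - B) t *\<^sub>R h t) = (LINT t|lborel. h t - indicator B t *\<^sub>R h t)"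
        by (intro Bochner_Integration.integral_cong) (auto simp: indicator_def)
      also have "\<dots> = (LINT t|lborel. h t) - (LINT t|lborel. indicator B t *\<^sub>R h t)"
        by (intro Bochner_Integration.integral_diff h int sets B)
      finally show "(LINT t|lborel. indicator (UNIV - B) t *\<^sub>R h t) = 0" using z UNIV by simp
    next
      fix B :: "nat \<Rightarrow> real set" assume B: "disjoint_family B"
        "range B \<subseteq> sigma_sets UNIV (range (\<lambda>(a, b). {a<..<b::real}))"
        "\<And>i. (LINT t|lborel. indicator (B i) t *\<^sub>R h t) = 0"
      have Bs: "B i \<in> sets borel" for i using B(2) sets by auto
      have "(LINT t:(\<Union>i. B i)|lborel. h t) = (\<Sum>i. (LINT t:(B i)|lborel. h t))"
        by (rule lebesgue_integral_countable_add)
          (use B(1) Bs int in \<open>auto simp: disjoint_family_on_def set_integrable_def\<close>)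
      then show "(LINT t|lborel. indicator (\<Union>i. B i) t *\<^sub>R h t) = 0"
        by (simp add: set_lebesgue_integral_def B(3))
    qed auto
  qed
  then show ?thesis
    using sigma_finite_measure.density_unique_banach[OF lborel.sigma_finite_measure_axioms h, of "\<lambda>_. 0"]
    by (simp add: set_lebesgue_integral_def)
qed

text \<open>As \<open>n\<close> grows, these \<open>C\<^sup>1\<close> functions increase to the indicator function of \<open>(a,b)\<close>.\<close>

definition bump :: "real \<Rightarrow> real \<Rightarrow> nat \<Rightarrow> real \<Rightarrow> real" where
  "bump a b n t = 1 - 1 / (1 + real n * ((max 0 (t - a))\<^sup>2 * (max 0 (b - t))\<^sup>2))"

definition bump_deriv :: "real \<Rightarrow> real \<Rightarrow> nat \<Rightarrow> real \<Rightarrow> real" where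
  "bump_deriv a b n t = real n * (2 * max 0 (t - a) * (max 0 (b - t))\<^sup>2 - (max 0 (t - a))\<^sup>2 * (2 * max 0 (b - t)))
     / (1 + real n * ((max 0 (t - a))\<^sup>2 * (max 0 (b - t))\<^sup>2))\<^sup>2"

lemma bump_denominator_pos: "0 < 1 + real n * ((max 0 (t - a))\<^sup>2 * (max 0 (b - t))\<^sup>2)"
  by (simp add: add_pos_nonneg)

lemma bump_bounds: "0 \<le> bump a b n t" "bump a b n t \<le> 1"
  using bump_denominator_pos[of n t a b] by (auto simp: bump_def divide_simps)

lemma bump_outside: "t \<notin> {a..b} \<Longrightarrow> bump a b n t = 0" "t \<notin> {a..b} \<Longrightarrow> bump_deriv a b n t = 0"
  by (auto simp: bump_def bump_deriv_def max_def)

text \<open>Squaring removes the kink of the positive part; at 0 the Caratheodory slope function is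
  the positive part itself.\<close>

lemma DERIV_positive_part_squared: "((\<lambda>t. (max 0 t)\<^sup>2) has_real_derivative 2 * max 0 t) (at t)"
proof -
  have pos: "((\<lambda>t. t\<^sup>2) has_real_derivative 2 * t) (at t)" for t :: real
    by (auto intro!: derivative_eq_intros)
  consider "t > 0" | "t < 0" | "t = 0" by linarith
  then show ?thesis
  proof cases
    case 1
    have "((\<lambda>t. (max 0 t)\<^sup>2) has_real_derivative 2 * t) (at t)"
      by (rule DERIV_cong_ev[THEN iffD1, OF refl _ refl pos])
        (use 1 eventually_nhds_in_open[of "{0<..}" t] in \<open>auto elim!: eventually_mono\<close>)
    then show ?thesis using 1 by simp
  next
    case 2
    have "((\<lambda>t. (max 0 t)\<^sup>2) has_real_derivative 0) (at t)"
      by (rule DERIV_cong_ev[THEN iffD1, OF refl _ refl DERIV_const[of 0]])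
        (use 2 eventually_nhds_in_open[of "{..<0}" t] in \<open>auto elim!: eventually_mono\<close>)
    then show ?thesis using 2 by simp
  next
    case 3
    have "((\<lambda>t. (max 0 t)\<^sup>2) has_real_derivative 0) (at 0)"
      unfolding DERIV_caratheodory_within
      by (intro exI[of _ "max 0"]) (auto simp: power2_eq_square max_def intro!: continuous_intros)
    then show ?thesis using 3 by simp
  qed
qed

lemma bump_has_derivative: "(bump a b n has_real_derivative bump_deriv a b n t) (at t)"
proof -
  have 1: "((\<lambda>t. (max 0 (t - a))\<^sup>2) has_real_derivative 2 * max 0 (t - a)) (at t)"
  proof -
    have "((\<lambda>t. t - a) has_real_derivative 1) (at t)" by (auto intro!: derivative_eq_intros)
    from DERIV_chain2[OF DERIV_positive_part_squared this] show ?thesis by simp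
  qed
  have 2: "((\<lambda>t. (max 0 (b - t))\<^sup>2) has_real_derivative - (2 * max 0 (b - t))) (at t)"
  proof -
    have "((\<lambda>t. b - t) has_real_derivative -1) (at t)" by (auto intro!: derivative_eq_intros)
    from DERIV_chain2[OF DERIV_positive_part_squared this] show ?thesis by simp
  qed
  have 3: "((\<lambda>t. 1 + real n * ((max 0 (t - a))\<^sup>2 * (max 0 (b - t))\<^sup>2)) has_real_derivative
      real n * (2 * max 0 (t - a) * (max 0 (b - t))\<^sup>2 - (max 0 (t - a))\<^sup>2 * (2 * max 0 (b - t)))) (at t)"
    by (rule derivative_eq_intros 1 2 refl)+ (simp add: algebra_simps)
  show ?thesis
    unfolding bump_def[abs_def] bump_deriv_def
    by (rule derivative_eq_intros 3 refl)+
      (use bump_denominator_pos[of n t a b] in \<open>auto simp: power2_eq_square\<close>)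
qed

lemma continuous_on_bump: "continuous_on A (bump a b n)"
  by (intro continuous_at_imp_continuous_on ballI DERIV_isCont[OF bump_has_derivative])

lemma continuous_on_bump_deriv: "continuous_on A (bump_deriv a b n)"
  unfolding bump_deriv_def[abs_def]
  by (intro continuous_intros ballI power_not_zero[OF less_imp_neq[OF bump_denominator_pos, THEN not_sym]])

lemma bump_measurable [measurable]: "bump a b n \<in> borel_measurable borel"
  "bump_deriv a b n \<in> borel_measurable borel"
  by (intro borel_measurable_continuous_onI continuous_on_bump continuous_on_bump_deriv)+

lemma bump_tendsto: "(\<lambda>n. bump a b n t) \<longlonglongrightarrow> indicator {a<..<b} t"
proof (cases "t \<in> {a<..<b}")
  case True
  define Q where "Q = (max 0 (t - a))\<^sup>2 * (max 0 (b - t))\<^sup>2"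
  have Q: "Q > 0" using True by (auto simp: Q_def)
  have "filterlim (\<lambda>n. 1 + real n * Q) at_top sequentially"
    by (intro filterlim_tendsto_add_at_top[OF tendsto_const] filterlim_at_top_mult_tendsto_pos[OF tendsto_const Q]
        filterlim_real_sequentially)
  then have "(\<lambda>n. 1 - 1 / (1 + real n * Q)) \<longlonglongrightarrow> 1 - 0"
    by (intro tendsto_diff tendsto_const tendsto_divide_0[OF tendsto_const] filterlim_at_top_imp_at_infinity)
  then show ?thesis using True by (simp add: bump_def Q_def)
next
  case False
  then have "bump a b n t = 0" for n by (auto simp: bump_def max_def)
  then show ?thesis using False by simp
qed

lemma bump_integral_limit:
  fixes g :: "real \<Rightarrow> 'a::euclidean_space"
  assumes g: "integrable lborel g"
  shows "(\<lambda>n. LINT t|lborel. bump a b n t *\<^sub>R g t) \<longlonglongrightarrow> (LINT t|lborel. indicator {a<..<b} t *\<^sub>R g t)"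
proof (rule integral_dominated_convergence[where w = "\<lambda>t. norm (g t)"])
  have [measurable]: "g \<in> borel_measurable lborel" using g by (rule borel_measurable_integrable)
  show "(\<lambda>t. indicator {a<..<b} t *\<^sub>R g t) \<in> borel_measurable lborel" by measurable
  show "(\<lambda>t. bump a b n t *\<^sub>R g t) \<in> borel_measurable lborel" for n by measurable
  show "AE t in lborel. (\<lambda>n. bump a b n t *\<^sub>R g t) \<longlonglongrightarrow> indicator {a<..<b} t *\<^sub>R g t"
    by (intro AE_I2 tendsto_scaleR bump_tendsto tendsto_const)
  show "AE t in lborel. norm (bump a b n t *\<^sub>R g t) \<le> norm (g t)" for n
    using bump_bounds[of a b n] by (intro AE_I2) (simp add: mult_left_le_one_le)
qed (use g in auto)

text \<open>The bumps converge boundedly to indicators, so the integral over \<open>(a, b)\<close>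
  vanishes whenever \<open>0 < a\<close> and \<open>b < T\<close>. Intervals touching an end point
  are exhausted from inside, because test functions must vanish near 0 and \<open>T\<close>.\<close>

lemma fundamental_lemma:
  fixes g :: "real \<Rightarrow> 'a::euclidean_space"
  assumes g: "integrable lborel g"
    and zero: "\<And>a b n. 0 < a \<Longrightarrow> b < T \<Longrightarrow> (LINT t|lborel. bump a b n t *\<^sub>R g t) = 0"
  shows "AE t in lborel. t \<in> {0<..<T} \<longrightarrow> g t = 0"
proof -
  have [measurable]: "g \<in> borel_measurable lborel" using g by (rule borel_measurable_integrable)
  have inner: "(LINT t|lborel. indicator {a<..<b} t *\<^sub>R g t) = 0" if "0 < a" "b < T" for a b
    using bump_integral_limit[OF g, of a b] by (simp add: zero[OF that] LIMSEQ_const_iff)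
  define h where "h t = indicator {0<..<T} t *\<^sub>R g t" for t
  have "AE t in lborel. h t = 0"
  proof (rule AE_zero_of_interval_integrals)
    show "integrable lborel h" unfolding h_def using g by (intro integrable_mult_indicator) auto
    fix a b :: real
    define e where "e n = inverse (real (Suc n))" for n
    have e: "e n > 0" for n by (simp add: e_def)
    have e0: "e \<longlonglongrightarrow> 0" unfolding e_def by (rule LIMSEQ_inverse_real_of_nat)
    have "(\<lambda>n. LINT t|lborel. indicator {max a (e n)<..<min b (T - e n)} t *\<^sub>R g t)
        \<longlonglongrightarrow> (LINT t|lborel. indicator {a<..<b} t *\<^sub>R h t)"
    proof (rule integral_dominated_convergence[where w = "\<lambda>t. norm (g t)"])
      show "(\<lambda>t. indicator {a<..<b} t *\<^sub>R h t) \<in> borel_measurable lborel" unfolding h_def by measurable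
      show "(\<lambda>t. indicator {max a (e n)<..<min b (T - e n)} t *\<^sub>R g t) \<in> borel_measurable lborel" for n by measurable
      show "AE t in lborel. (\<lambda>n. indicator {max a (e n)<..<min b (T - e n)} t *\<^sub>R g t) \<longlonglongrightarrow> indicator {a<..<b} t *\<^sub>R h t"
      proof (rule AE_I2)
        fix t
        show "(\<lambda>n. indicator {max a (e n)<..<min b (T - e n)} t *\<^sub>R g t) \<longlonglongrightarrow> indicator {a<..<b} t *\<^sub>R h t"
        proof (cases "t \<in> {0<..<T}")
          case True
          have "\<forall>\<^sub>F n in sequentially. e n < min t (T - t)"
            using True by (intro order_tendstoD(2)[OF e0]) auto
          then have "\<forall>\<^sub>F n in sequentially. indicator {max a (e n)<..<min b (T - e n)} t *\<^sub>R g t = indicator {a<..<b} t *\<^sub>R h t"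
            by eventually_elim (use True in \<open>auto simp: h_def indicator_def\<close>)
          then show ?thesis by (rule tendsto_eventually)
        next
          case False
          have "t \<notin> {max a (e n)<..<min b (T - e n)}" for n using False e[of n] by auto
          then show ?thesis using False by (simp add: h_def)
        qed
      qed
      show "AE t in lborel. norm (indicator {max a (e n)<..<min b (T - e n)} t *\<^sub>R g t) \<le> norm (g t)" for n
        by (auto simp: indicator_def)
    qed (use g in auto)
    moreover have "(LINT t|lborel. indicator {max a (e n)<..<min b (T - e n)} t *\<^sub>R g t) = 0" for n
      using e[of n] by (intro inner) auto
    ultimately show "(LINT t|lborel. indicator {a<..<b} t *\<^sub>R h t) = 0" by (simp add: LIMSEQ_const_iff)
  qed
  then show ?thesis by eventually_elim (auto simp: h_def)
qed

section \<open>Integration as an operator on square-integrable functions\<close>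

text \<open>Testing the integral \<open>v\<close> against itself reduces the vector-valued
  Cauchy-Schwarz inequality to the inner product of the class of \<open>a t *\<^sub>R v\<close> with
  that of \<open>g\<close>; a factor \<open>(norm v)\<^sup>2\<close> is then cancelled.\<close>

lemma square_integrable_real_weight:
  fixes a :: "real \<Rightarrow> real" and g :: "real \<Rightarrow> 'a::euclidean_space"
  assumes a: "square_integrable a" and g: "square_integrable g"
  shows "integrable lborel (\<lambda>t. a t *\<^sub>R g t)"
    "(norm (LINT t|lborel. a t *\<^sub>R g t))\<^sup>2 \<le> (LINT t|lborel. (a t)\<^sup>2) * (norm (abs_L2 g))\<^sup>2"
proof -
  have [measurable]: "a \<in> borel_measurable lborel" "g \<in> borel_measurable lborel"
    using a g by (auto simp: square_integrable_def)
  show int: "integrable lborel (\<lambda>t. a t *\<^sub>R g t)"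
  proof (rule Bochner_Integration.integrable_bound[where f = "\<lambda>t. (norm (a t))\<^sup>2 + (norm (g t))\<^sup>2"])
    show "integrable lborel (\<lambda>t. (norm (a t))\<^sup>2 + (norm (g t))\<^sup>2)"
      using a g unfolding square_integrable_def by (intro Bochner_Integration.integrable_add) auto
    show "AE t in lborel. norm (a t *\<^sub>R g t) \<le> norm ((norm (a t))\<^sup>2 + (norm (g t))\<^sup>2)"
    proof (rule AE_I2)
      fix t
      have "\<bar>a t\<bar> * norm (g t) \<le> (norm (a t))\<^sup>2 + (norm (g t))\<^sup>2"
        using sum_squares_bound[of "\<bar>a t\<bar>" "norm (g t)"]
          mult_nonneg_nonneg[OF abs_ge_zero norm_ge_zero, of "a t" "g t"]
        unfolding real_norm_def by linarith
      then show "norm (a t *\<^sub>R g t) \<le> norm ((norm (a t))\<^sup>2 + (norm (g t))\<^sup>2)" by simp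
    qed
  qed measurable
  define v where "v = (LINT t|lborel. a t *\<^sub>R g t)"
  have av: "square_integrable (\<lambda>t. a t *\<^sub>R v)"
    by (rule square_integrable_bound[OF a, where K = "norm v"]) auto
  have "v \<bullet> v = (LINT t|lborel. (a t *\<^sub>R g t) \<bullet> v)"
    using integral_inner_left[OF int, of v] by (simp add: v_def[symmetric])
  also have "\<dots> = abs_L2 (\<lambda>t. a t *\<^sub>R v) \<bullet> abs_L2 g"
    unfolding abs_L2_arith(4)[OF av g] by (simp add: inner_commute)
  also have "\<dots> \<le> norm (abs_L2 (\<lambda>t. a t *\<^sub>R v)) * norm (abs_L2 g)" by (rule norm_cauchy_schwarz)
  finally have "(norm v)\<^sup>2 \<le> norm (abs_L2 (\<lambda>t. a t *\<^sub>R v)) * norm (abs_L2 g)"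
    by (simp add: power2_norm_eq_inner)
  then have "((norm v)\<^sup>2)\<^sup>2 \<le> (norm (abs_L2 (\<lambda>t. a t *\<^sub>R v)) * norm (abs_L2 g))\<^sup>2"
    by (rule power_mono) simp
  also have "\<dots> = (norm v)\<^sup>2 * ((LINT t|lborel. (a t)\<^sup>2) * (norm (abs_L2 g))\<^sup>2)"
    by (simp add: power_mult_distrib norm_abs_L2_squared[OF av])
  finally have le: "(norm v)\<^sup>2 * (norm v)\<^sup>2 \<le> (norm v)\<^sup>2 * ((LINT t|lborel. (a t)\<^sup>2) * (norm (abs_L2 g))\<^sup>2)"
    unfolding power2_eq_square[of "(norm v)\<^sup>2"] .
  have "(norm v)\<^sup>2 \<le> (LINT t|lborel. (a t)\<^sup>2) * (norm (abs_L2 g))\<^sup>2"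
  proof (cases "v = 0")
    case False
    then have "0 < (norm v)\<^sup>2" by simp
    then show ?thesis using le by (rule mult_left_le_imp_le[rotated])
  qed (simp add: integral_nonneg_AE)
  then show "(norm (LINT t|lborel. a t *\<^sub>R g t))\<^sup>2 \<le> (LINT t|lborel. (a t)\<^sup>2) * (norm (abs_L2 g))\<^sup>2"
    by (simp only: v_def)
qed

lemma bounded_on_interval_square_integrable:
  fixes f :: "real \<Rightarrow> 'a::euclidean_space"
  assumes [measurable]: "f \<in> borel_measurable lborel" and T: "0 \<le> T"
    and out: "\<And>t. t \<notin> {0..T} \<Longrightarrow> f t = 0" and bound: "\<And>t. t \<in> {0..T} \<Longrightarrow> norm (f t) \<le> B"
  shows "square_integrable f" "(norm (abs_L2 f))\<^sup>2 \<le> T * B\<^sup>2"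
proof -
  have le: "(norm (f t))\<^sup>2 \<le> indicator {0..T} t * B\<^sup>2" for t
    using power_mono[OF bound norm_ge_zero, of t 2] out[of t] by (cases "t \<in> {0..T}") auto
  have I: "integrable lborel (\<lambda>t. indicator {0..T} t * B\<^sup>2)"
    by (intro integrable_mult_left integrable_real_indicator) (auto simp: emeasure_lborel_Icc_eq)
  show f: "square_integrable f"
    unfolding square_integrable_def
    by (intro conjI Bochner_Integration.integrable_bound[OF I]) (use le in auto)
  have "(norm (abs_L2 f))\<^sup>2 = (LINT t|lborel. (norm (f t))\<^sup>2)" by (rule norm_abs_L2_squared[OF f])
  also have "\<dots> \<le> (LINT t|lborel. indicator {0..T} t * B\<^sup>2)"
    using f le I by (intro integral_mono) (auto simp: square_integrable_def)
  also have "\<dots> = T * B\<^sup>2" using T by simp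
  finally show "(norm (abs_L2 f))\<^sup>2 \<le> T * B\<^sup>2" .
qed

lemma exp_weight_bound: "indicator {0..T} t * exp (k * t) \<le> exp (\<bar>k\<bar> * \<bar>T\<bar>)" for t :: real
proof (cases "t \<in> {0..T}")
  case True
  have "k * t \<le> \<bar>k\<bar> * t" using True by (intro mult_right_mono) auto
  also have "\<dots> \<le> \<bar>k\<bar> * \<bar>T\<bar>" using True by (intro mult_left_mono) auto
  finally show ?thesis using True by simp
qed simp

lemma square_integrable_cutoff:
  fixes h :: "real \<Rightarrow> 'a::euclidean_space"
  assumes h: "square_integrable h"
  shows "square_integrable (\<lambda>t. (indicator {0..T} t * exp (k * t)) *\<^sub>R h t)"
proof (rule square_integrable_bound[OF h, where K = "exp (\<bar>k\<bar> * \<bar>T\<bar>)"])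
  have [measurable]: "h \<in> borel_measurable lborel" using h by (simp add: square_integrable_def)
  show "(\<lambda>t. (indicator {0..T} t * exp (k * t)) *\<^sub>R h t) \<in> borel_measurable lborel" by measurable
  show "norm ((indicator {0..T} t * exp (k * t)) *\<^sub>R h t) \<le> exp (\<bar>k\<bar> * \<bar>T\<bar>) * norm (h t)" for t
    using mult_right_mono[OF exp_weight_bound[of T t k] norm_ge_zero[of "h t"]] by (simp add: abs_mult)
qed

text \<open>One operator serves two purposes: for \<open>k = 0\<close> it is the orthogonal
  projection onto \<open>L2_on T\<close>, and on \<open>L2_on T\<close> the operators for
  \<open>k\<close> and \<open>- k\<close> are inverse to each other, which allows conjugation with
  the weight.\<close>

lift_definition cutoff :: "real \<Rightarrow> real \<Rightarrow> 'a::euclidean_space L2 \<Rightarrow> 'a L2"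
  is "\<lambda>T k f t. (indicator {0..T} t * exp (k * t)) *\<^sub>R f t"
  by (auto simp: L2_eq_def square_integrable_cutoff)

lemma rep_cutoff: "AE t in lborel. rep_L2 (cutoff T k x) t = (indicator {0..T} t * exp (k * t)) *\<^sub>R rep_L2 x t"
proof -
  have "cutoff T k (abs_L2 (rep_L2 x)) = abs_L2 (\<lambda>t. (indicator {0..T} t * exp (k * t)) *\<^sub>R rep_L2 x t)"
    by (rule cutoff.abs_eq) (simp add: L2_eq_def square_integrable_rep)
  then show ?thesis
    using rep_abs[OF square_integrable_cutoff[OF square_integrable_rep[of x], of T k]] by (simp add: abs_rep)
qed

lemma norm_L2_le:
  assumes "AE t in lborel. norm (rep_L2 y t) \<le> K * norm (rep_L2 x t)" and K: "K \<ge> 0"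
  shows "norm y \<le> K * norm x"
proof -
  have "(norm y)\<^sup>2 = (LINT t|lborel. (norm (rep_L2 y t))\<^sup>2)" by (rule norm_L2_squared)
  also have "\<dots> \<le> (LINT t|lborel. K\<^sup>2 * (norm (rep_L2 x t))\<^sup>2)"
  proof (rule integral_mono_AE)
    show "AE t in lborel. (norm (rep_L2 y t))\<^sup>2 \<le> K\<^sup>2 * (norm (rep_L2 x t))\<^sup>2"
      using assms(1)
    proof eventually_elim
      case (elim t)
      from power_mono[OF this, of 2] show ?case by (simp add: power_mult_distrib)
    qed
  qed (use square_integrable_rep[of x] square_integrable_rep[of y] in \<open>auto simp: square_integrable_def\<close>)
  also have "\<dots> = (K * norm x)\<^sup>2" by (simp add: norm_L2_squared power_mult_distrib)
  finally show ?thesis by (rule power2_le_imp_le) (simp add: K)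
qed

lemma bounded_linear_cutoff: "bounded_linear (cutoff T k)"
proof (rule bounded_linear_intro[where K = "exp (\<bar>k\<bar> * \<bar>T\<bar>)"])
  show "cutoff T k (x + y) = cutoff T k x + cutoff T k y" for x y :: "'a L2"
    by (rule L2_eqI, use rep_cutoff[of T k "x + y"] rep_cutoff[of T k x] rep_cutoff[of T k y]
        rep_arith(1)[of "cutoff T k x" "cutoff T k y"] rep_arith(1)[of x y] in eventually_elim)
      (simp add: scaleR_add_right)
  show "cutoff T k (c *\<^sub>R x) = c *\<^sub>R cutoff T k x" for c and x :: "'a L2"
    by (rule L2_eqI, use rep_cutoff[of T k "c *\<^sub>R x"] rep_cutoff[of T k x]
        rep_arith(3)[of c "cutoff T k x"] rep_arith(3)[of c x] in eventually_elim) simp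
  show "norm (cutoff T k x) \<le> norm x * exp (\<bar>k\<bar> * \<bar>T\<bar>)" for x :: "'a L2"
    unfolding mult.commute[of "norm x"]
  proof (rule norm_L2_le)
    show "AE t in lborel. norm (rep_L2 (cutoff T k x) t) \<le> exp (\<bar>k\<bar> * \<bar>T\<bar>) * norm (rep_L2 x t)"
      using rep_cutoff[of T k x]
    proof eventually_elim
      case (elim t)
      then show ?case
        using mult_right_mono[OF exp_weight_bound[of T t k] norm_ge_zero[of "rep_L2 x t"]] by (simp add: abs_mult)
    qed
  qed simp
qed

lemma cutoff_cutoff: "cutoff T j (cutoff T k x) = cutoff T (j + k) x"
  by (rule L2_eqI, use rep_cutoff[of T j "cutoff T k x"] rep_cutoff[of T k x] rep_cutoff[of T "j + k" x] in eventually_elim)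
    (auto simp: indicator_def exp_add distrib_right)

text \<open>As the fixed space of a bounded operator \<open>L2_on T\<close> is a closed subspace,
  and membership becomes an equation between classes.\<close>

lemma L2_on_iff: "x \<in> L2_on T \<longleftrightarrow> cutoff T 0 x = x"
proof
  assume "x \<in> L2_on T"
  then have "AE t in lborel. t \<notin> {0..T} \<longrightarrow> rep_L2 x t = 0" by (simp add: L2_on_def)
  then have "AE t in lborel. rep_L2 (cutoff T 0 x) t = rep_L2 x t"
    using rep_cutoff[of T 0 x] by eventually_elim (auto simp: indicator_def)
  then show "cutoff T 0 x = x" by (rule L2_eqI)
next
  assume eq: "cutoff T 0 x = x"
  show "x \<in> L2_on T"
    unfolding L2_on_def mem_Collect_eq
    using rep_cutoff[of T 0 x] unfolding eq by eventually_elim (metis indicator_simps(2) mult_zero_left scale_zero_left)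
qed

lemma cutoff_in_L2_on [simp]: "cutoff T k x \<in> L2_on T"
  by (simp add: L2_on_iff cutoff_cutoff)

lemma L2_on_outside: "x \<in> L2_on T \<Longrightarrow> AE t in lborel. t \<notin> {0..T} \<longrightarrow> rep_L2 x t = 0"
  by (simp add: L2_on_def)

lemma subspace_L2_on: "subspace (L2_on T)"
proof -
  interpret bounded_linear "cutoff T 0" by (rule bounded_linear_cutoff)
  show ?thesis by (auto simp: subspace_def L2_on_iff zero add scale)
qed

lemma closed_L2_on: "closed (L2_on T)"
proof -
  have "closed {x. cutoff T 0 x = x}"
    by (intro closed_Collect_eq linear_continuous_on bounded_linear_cutoff continuous_on_id)
  then show ?thesis by (simp add: L2_on_iff[symmetric])
qed

lemma inner_cutoff: "cutoff T k x \<bullet> y = x \<bullet> cutoff T k y"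
  unfolding inner_L2_eq
proof (rule integral_cong_AE)
  show "AE t in lborel. rep_L2 (cutoff T k x) t \<bullet> rep_L2 y t = rep_L2 x t \<bullet> rep_L2 (cutoff T k y) t"
    using rep_cutoff[of T k x] rep_cutoff[of T k y] by eventually_elim simp
qed measurable

lemma abs_in_L2_on:
  assumes "square_integrable f" "\<And>t. t \<notin> {0..T} \<Longrightarrow> f t = 0"
  shows "abs_L2 f \<in> L2_on T"
  unfolding L2_on_def mem_Collect_eq
  using rep_abs[OF assms(1)] by eventually_elim (simp add: assms(2))

section \<open>Primitives and the initial value problem with zero matrix\<close>

lemma square_integrable_indicator: "square_integrable (indicat_real {a..b})"
  "(LINT s|lborel. (indicat_real {a..b} s)\<^sup>2) = (if a \<le> b then b - a else 0)"
proof -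
  have eq: "(indicat_real {a..b} s)\<^sup>2 = indicat_real {a..b} s" for s by (simp add: indicator_def)
  show "square_integrable (indicat_real {a..b})"
    unfolding square_integrable_def
    by (auto simp: eq intro!: integrable_real_indicator simp: emeasure_lborel_Icc_eq)
  show "(LINT s|lborel. (indicat_real {a..b} s)\<^sup>2) = (if a \<le> b then b - a else 0)"
    by (simp add: eq)
qed

definition primitive :: "'a::euclidean_space L2 \<Rightarrow> real \<Rightarrow> 'a" where
  "primitive g t = (LINT s|lborel. indicat_real {0..t} s *\<^sub>R rep_L2 g s)"

lemma integrable_on_interval: "integrable lborel (\<lambda>s. indicat_real {a..b} s *\<^sub>R rep_L2 g s)"
  by (rule square_integrable_real_weight[OF square_integrable_indicator(1) square_integrable_rep])

lemma integrable_L2_on: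
  assumes "g \<in> L2_on T"
  shows "integrable lborel (rep_L2 g)"
proof -
  have "integrable lborel (\<lambda>s. indicat_real {0..T} s *\<^sub>R rep_L2 g s) \<longleftrightarrow> integrable lborel (rep_L2 g)"
  proof (rule integrable_cong_AE)
    show "AE s in lborel. indicat_real {0..T} s *\<^sub>R rep_L2 g s = rep_L2 g s"
      using L2_on_outside[OF assms] by eventually_elim (auto simp: indicator_def)
  qed measurable
  then show ?thesis using integrable_on_interval by blast
qed

lemma primitive_0 [simp]: "primitive g 0 = 0"
proof -
  have "primitive g 0 = (LINT s|lborel. 0 *\<^sub>R rep_L2 g s)"
    unfolding primitive_def
  proof (rule integral_cong_AE)
    show "AE s in lborel. indicat_real {0..0} s *\<^sub>R rep_L2 g s = 0 *\<^sub>R rep_L2 g s"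
      using AE_lborel_singleton[of 0] by eventually_elim (auto simp: indicator_def)
  qed measurable
  then show ?thesis by simp
qed

lemma primitive_add: "primitive (g + h) t = primitive g t + primitive h t"
proof -
  have "primitive (g + h) t = (LINT s|lborel. indicat_real {0..t} s *\<^sub>R rep_L2 g s + indicat_real {0..t} s *\<^sub>R rep_L2 h s)"
    unfolding primitive_def
  proof (rule integral_cong_AE)
    show "AE s in lborel. indicat_real {0..t} s *\<^sub>R rep_L2 (g + h) s =
        indicat_real {0..t} s *\<^sub>R rep_L2 g s + indicat_real {0..t} s *\<^sub>R rep_L2 h s"
      using rep_arith(1)[of g h] by eventually_elim (simp add: scaleR_add_right)
  qed measurable
  also have "\<dots> = primitive g t + primitive h t"
    unfolding primitive_def by (intro Bochner_Integration.integral_add integrable_on_interval)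
  finally show ?thesis .
qed

lemma primitive_scaleR: "primitive (c *\<^sub>R g) t = c *\<^sub>R primitive g t"
proof -
  have "primitive (c *\<^sub>R g) t = (LINT s|lborel. c *\<^sub>R (indicat_real {0..t} s *\<^sub>R rep_L2 g s))"
    unfolding primitive_def
  proof (rule integral_cong_AE)
    show "AE s in lborel. indicat_real {0..t} s *\<^sub>R rep_L2 (c *\<^sub>R g) s = c *\<^sub>R indicat_real {0..t} s *\<^sub>R rep_L2 g s"
      using rep_arith(3)[of c g] by eventually_elim simp
  qed measurable
  also have "\<dots> = c *\<^sub>R primitive g t"
    unfolding primitive_def by (rule integral_scaleR_right)
  finally show ?thesis .
qed

lemma interval_integral_bound:
  assumes "a \<le> b"
  shows "norm (LINT s|lborel. indicat_real {a..b} s *\<^sub>R rep_L2 g s) \<le> sqrt (b - a) * norm g"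
proof -
  have "(norm (LINT s|lborel. indicat_real {a..b} s *\<^sub>R rep_L2 g s))\<^sup>2 \<le> (b - a) * (norm g)\<^sup>2"
    using square_integrable_real_weight(2)[OF square_integrable_indicator(1)[of a b] square_integrable_rep[of g]]
    by (simp only: square_integrable_indicator(2) abs_rep assms if_True)
  also have "\<dots> = (sqrt (b - a) * norm g)\<^sup>2" using assms by (simp add: power_mult_distrib)
  finally show ?thesis by (rule power2_le_imp_le) (use assms in simp)
qed

lemma primitive_bound: "0 \<le> t \<Longrightarrow> norm (primitive g t) \<le> sqrt t * norm g"
  using interval_integral_bound[of 0 t g] by (simp add: primitive_def)

text \<open>Cauchy-Schwarz on the interval between \<open>s\<close> and \<open>t\<close>, hence
  Hoelder continuity with exponent 1/2.\<close>

lemma primitive_diff_bound: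
  assumes "0 \<le> s" "s \<le> t"
  shows "norm (primitive g t - primitive g s) \<le> sqrt (t - s) * norm g"
proof -
  have "primitive g t - primitive g s = (LINT r|lborel. indicat_real {0..t} r *\<^sub>R rep_L2 g r - indicat_real {0..s} r *\<^sub>R rep_L2 g r)"
    unfolding primitive_def by (intro Bochner_Integration.integral_diff[symmetric] integrable_on_interval)
  also have "\<dots> = (LINT r|lborel. indicat_real {s..t} r *\<^sub>R rep_L2 g r)"
  proof (rule integral_cong_AE)
    show "AE r in lborel. indicat_real {0..t} r *\<^sub>R rep_L2 g r - indicat_real {0..s} r *\<^sub>R rep_L2 g r = indicat_real {s..t} r *\<^sub>R rep_L2 g r"
      using AE_lborel_singleton[of s] by eventually_elim (use assms in \<open>auto simp: indicator_def\<close>)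
  qed measurable
  finally have eq: "primitive g t - primitive g s = (LINT r|lborel. indicat_real {s..t} r *\<^sub>R rep_L2 g r)" .
  show ?thesis
    unfolding eq by (rule interval_integral_bound[OF assms(2)])
qed

lemma continuous_on_primitive: "continuous_on {0..} (primitive g)"
  unfolding continuous_on_iff
proof safe
  fix t e :: real assume t: "0 \<le> t" and e: "e > 0"
  define d where "d = (e / (norm g + 1))\<^sup>2"
  have g: "norm g + 1 > 0" by (simp add: add_nonneg_pos)
  have d: "d > 0" using e g by (simp add: d_def)
  have "norm (primitive g s - primitive g t) < e" if s: "0 \<le> s" "\<bar>s - t\<bar> < d" for s
  proof -
    have "norm (primitive g s - primitive g t) \<le> sqrt \<bar>s - t\<bar> * norm g"
      using primitive_diff_bound[of s t g] primitive_diff_bound[of t s g] s t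
      by (cases "s \<le> t") (auto simp: norm_minus_commute)
    also have "\<dots> \<le> sqrt d * norm g" using s by (intro mult_right_mono) auto
    also have "\<dots> = e / (norm g + 1) * norm g" using e g by (simp add: d_def)
    also have "\<dots> < e / (norm g + 1) * (norm g + 1)" using e g by (intro mult_strict_left_mono) auto
    also have "\<dots> = e" using g by simp
    finally show ?thesis .
  qed
  with d show "\<exists>d>0. \<forall>x'\<in>{0..}. dist x' t < d \<longrightarrow> dist (primitive g x') (primitive g t) < e"
    by (intro exI[of _ d]) (auto simp: dist_norm)
qed

definition solve0_fun :: "real \<Rightarrow> 'a::euclidean_space L2 \<Rightarrow> 'a \<Rightarrow> real \<Rightarrow> 'a" where
  "solve0_fun T g c t = indicat_real {0..T} t *\<^sub>R (c + primitive g t)"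

text \<open>The solution of \<open>x' = g\<close>, \<open>x 0 = c\<close> on \<open>[0, T]\<close>,
  that is, the inverse of \<open>op_A\<close> for the zero matrix.\<close>

definition solve0 :: "real \<Rightarrow> 'a::euclidean_space L2 \<times> 'a \<Rightarrow> 'a L2" where
  "solve0 T z = abs_L2 (solve0_fun T (fst z) (snd z))"

lemma solve0_fun_measurable [measurable]: "solve0_fun T g c \<in> borel_measurable borel"
  unfolding solve0_fun_def[abs_def]
  by (intro borel_measurable_continuous_on_indicator continuous_intros continuous_on_subset[OF continuous_on_primitive]) auto

lemma solve0_fun_square_integrable: "0 \<le> T \<Longrightarrow> square_integrable (solve0_fun T g c)"
proof (rule bounded_on_interval_square_integrable(1)[where T = T and B = "norm c + sqrt T * norm g"])
  show "norm (solve0_fun T g c t) \<le> norm c + sqrt T * norm g" if "t \<in> {0..T}" for t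
  proof -
    have "norm (c + primitive g t) \<le> norm c + sqrt t * norm g"
      using primitive_bound[of t g] that norm_triangle_ineq[of c "primitive g t"] by simp
    also have "\<dots> \<le> norm c + sqrt T * norm g" using that by (intro add_mono mult_right_mono) auto
    finally show ?thesis using that by (simp add: solve0_fun_def)
  qed
qed (auto simp: solve0_fun_def)

lemma rep_solve0: "0 \<le> T \<Longrightarrow> AE t in lborel. rep_L2 (solve0 T (g, c)) t = indicat_real {0..T} t *\<^sub>R (c + primitive g t)"
  using rep_abs[OF solve0_fun_square_integrable, of T g c] by (simp add: solve0_def solve0_fun_def)

lemma solve0_in_L2_on: "0 \<le> T \<Longrightarrow> solve0 T z \<in> L2_on T"
  unfolding solve0_def by (intro abs_in_L2_on solve0_fun_square_integrable) (auto simp: solve0_fun_def)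

lemma bounded_linear_solve0:
  assumes T: "0 \<le> T"
  shows "bounded_linear (solve0 T :: 'a::euclidean_space L2 \<times> 'a \<Rightarrow> 'a L2)"
proof (rule bounded_linear_intro[where K = "sqrt T * (1 + sqrt T)"])
  fix z w :: "'a L2 \<times> 'a" and r :: real
  obtain g c h d where z: "z = (g, c)" and w: "w = (h, d)" by fastforce
  show "solve0 T (z + w) = solve0 T z + solve0 T w"
    unfolding z w
    by (rule L2_eqI, use rep_solve0[OF T, of "g + h" "c + d"] rep_solve0[OF T, of g c] rep_solve0[OF T, of h d]
        rep_arith(1)[of "solve0 T (g, c)" "solve0 T (h, d)"] in eventually_elim)
      (simp add: primitive_add algebra_simps)
  show "solve0 T (r *\<^sub>R z) = r *\<^sub>R solve0 T z"
    unfolding z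
    by (rule L2_eqI, use rep_solve0[OF T, of "r *\<^sub>R g" "r *\<^sub>R c"] rep_solve0[OF T, of g c]
        rep_arith(3)[of r "solve0 T (g, c)"] in eventually_elim)
      (simp add: primitive_scaleR algebra_simps)
  have "(norm (solve0 T z))\<^sup>2 \<le> T * ((1 + sqrt T) * norm z)\<^sup>2"
    unfolding solve0_def
  proof (rule bounded_on_interval_square_integrable(2)[OF _ T])
    show "norm (solve0_fun T (fst z) (snd z) t) \<le> (1 + sqrt T) * norm z" if "t \<in> {0..T}" for t
    proof -
      have "norm (c + primitive g t) \<le> norm c + sqrt t * norm g"
        using primitive_bound[of t g] that norm_triangle_ineq[of c "primitive g t"] by simp
      also have "\<dots> \<le> norm z + sqrt T * norm z"
        using that norm_fst_le[of g c] norm_snd_le[of c g] unfolding z by (intro add_mono mult_mono) auto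
      finally show ?thesis using that by (simp add: z solve0_fun_def algebra_simps)
    qed
  qed (auto simp: solve0_fun_def)
  also have "\<dots> = (norm z * (sqrt T * (1 + sqrt T)))\<^sup>2" using T by (simp add: power_mult_distrib mult_ac)
  finally show "norm (solve0 T z) \<le> norm z * (sqrt T * (1 + sqrt T))"
    by (rule power2_le_imp_le) (use T in simp)
qed

text \<open>For large \<open>k\<close>, conjugation with \<open>exp (k t)\<close> makes the Volterra operator small.\<close>

lemma solve0_conjugate_bound:
  fixes g :: "'a::euclidean_space L2"
  assumes T: "0 \<le> T" and k: "0 < k"
  shows "norm (cutoff T (- k) (solve0 T (cutoff T k g, 0))) \<le> sqrt (T / (2 * k)) * norm g"
proof -
  define f where "f t = indicat_real {0..T} t *\<^sub>R (exp (- k * t) *\<^sub>R primitive (cutoff T k g) t)" for t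
  have f_meas: "f \<in> borel_measurable borel"
    unfolding f_def[abs_def]
    by (intro borel_measurable_continuous_on_indicator continuous_intros continuous_on_subset[OF continuous_on_primitive]) auto
  have bound: "norm (f t) \<le> sqrt (1 / (2 * k)) * norm g" if t: "t \<in> {0..T}" for t
  proof -
    \<comment> \<open>The conjugated Volterra kernel at time \<open>t\<close>. Its square integrates
      to at most \<open>1 / (2 * k)\<close>, the integral of \<open>exp (2 * k * (s - t))\<close>
      over all \<open>s \<le> t\<close>.\<close>
    define a where "a s = indicat_real {0..t} s * exp (k * (s - t))" for s
    have FTC: "has_bochner_integral lborel (\<lambda>s. exp (2 * k * (s - t)) * indicat_real {0..t} s)
        (exp (2 * k * (t - t)) / (2 * k) - exp (2 * k * (0 - t)) / (2 * k))"
      using t k by (intro has_bochner_integral_FTC_Icc_real[where F = "\<lambda>s. exp (2 * k * (s - t)) / (2 * k)"])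
        (auto intro!: derivative_eq_intros)
    have a2: "(a s)\<^sup>2 = exp (2 * k * (s - t)) * indicat_real {0..t} s" for s
      by (simp add: a_def power_mult_distrib indicator_def flip: exp_double)
    have a: "square_integrable a"
      unfolding square_integrable_def
    proof
      show "a \<in> borel_measurable lborel" unfolding a_def[abs_def] by measurable
      show "integrable lborel (\<lambda>t. (norm (a t))\<^sup>2)"
        using FTC by (simp add: a2 has_bochner_integral_iff)
    qed
    have "(LINT s|lborel. (a s)\<^sup>2) = (1 - exp (2 * k * (0 - t))) / (2 * k)"
      using FTC k by (simp add: a2 has_bochner_integral_iff diff_divide_distrib)
    also have "\<dots> \<le> 1 / (2 * k)" using k by (intro divide_right_mono) auto
    finally have a_int: "(LINT s|lborel. (a s)\<^sup>2) \<le> 1 / (2 * k)" .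
    have "f t = exp (- k * t) *\<^sub>R (LINT s|lborel. indicat_real {0..t} s *\<^sub>R rep_L2 (cutoff T k g) s)"
      using t by (simp add: f_def primitive_def)
    also have "\<dots> = (LINT s|lborel. exp (- k * t) *\<^sub>R (indicat_real {0..t} s *\<^sub>R rep_L2 (cutoff T k g) s))"
      by (rule integral_scaleR_right[symmetric])
    also have "\<dots> = (LINT s|lborel. a s *\<^sub>R rep_L2 g s)"
    proof (rule integral_cong_AE)
      show "AE s in lborel. exp (- k * t) *\<^sub>R (indicat_real {0..t} s *\<^sub>R rep_L2 (cutoff T k g) s) = a s *\<^sub>R rep_L2 g s"
        using rep_cutoff[of T k g] by eventually_elim
          (use t in \<open>auto simp: a_def indicator_def right_diff_distrib exp_diff exp_minus divide_inverse mult.commute\<close>)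
    qed (auto simp: a_def)
    finally have "(norm (f t))\<^sup>2 \<le> (LINT s|lborel. (a s)\<^sup>2) * (norm g)\<^sup>2"
      using square_integrable_real_weight(2)[OF a square_integrable_rep, of g] by (simp add: abs_rep)
    also have "\<dots> \<le> 1 / (2 * k) * (norm g)\<^sup>2" using a_int by (intro mult_right_mono) auto
    also have "\<dots> = (sqrt (1 / (2 * k)) * norm g)\<^sup>2" using k by (simp add: power_mult_distrib)
    finally show ?thesis by (rule power2_le_imp_le) (use k in simp)
  qed
  note B = bounded_on_interval_square_integrable[of f T, OF _ T _ bound]
  have f: "square_integrable f" using f_meas by (intro B(1)) (auto simp: f_def)
  have "cutoff T (- k) (solve0 T (cutoff T k g, 0)) = abs_L2 f"
    by (rule L2_eqI, use rep_cutoff[of T "- k" "solve0 T (cutoff T k g, 0)"] rep_solve0[OF T, of "cutoff T k g" 0]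
        rep_abs[OF f] in eventually_elim) (auto simp: f_def indicator_def)
  then have "(norm (cutoff T (- k) (solve0 T (cutoff T k g, 0))))\<^sup>2 \<le> T * (sqrt (1 / (2 * k)) * norm g)\<^sup>2"
    using B(2) f_meas by (simp add: f_def)
  also have "\<dots> = (sqrt (T / (2 * k)) * norm g)\<^sup>2" using k T by (simp add: power_mult_distrib)
  finally show ?thesis by (rule power2_le_imp_le) (use T k in simp)
qed

section \<open>The Sobolev space as the range of integration\<close>

lemma integrable_product:
  fixes g :: "real \<Rightarrow> 'a::euclidean_space" and b :: "real \<Rightarrow> real"
  assumes b: "integrable lborel b" and g: "integrable lborel g"
  shows "integrable (lborel \<Otimes>\<^sub>M lborel) (\<lambda>(t, s). b t *\<^sub>R g s)"
proof (rule lborel_pair.Fubini_integrable)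
  have [measurable]: "b \<in> borel_measurable lborel" "g \<in> borel_measurable lborel"
    using b g by (auto intro: borel_measurable_integrable)
  show "(\<lambda>(t, s). b t *\<^sub>R g s) \<in> borel_measurable (lborel \<Otimes>\<^sub>M lborel)" by measurable
  show "integrable lborel (\<lambda>t. LINT s|lborel. norm (case (t, s) of (t, s) \<Rightarrow> b t *\<^sub>R g s))"
    using b by simp
  show "AE t in lborel. integrable lborel (\<lambda>s. case (t, s) of (t, s) \<Rightarrow> b t *\<^sub>R g s)"
    using g by simp
qed

text \<open>Integration by parts through Fubini on the triangle \<open>s \<le> t\<close>: for fixed
  \<open>s\<close> the integral of \<open>\<phi>'\<close> over \<open>[s, T]\<close> is
  \<open>- \<phi> s\<close>, because \<open>\<phi> T = 0\<close>. The constant \<open>c\<close> is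
  multiplied by \<open>\<phi> T - \<phi> 0 = 0\<close>.\<close>

lemma solve0_weak_derivative:
  fixes g :: "'a::euclidean_space L2"
  assumes T: "0 \<le> T" and g: "g \<in> L2_on T"
  shows "weak_derivative T (solve0 T (g, c)) g"
  unfolding weak_derivative_def
proof (intro conjI allI impI solve0_in_L2_on T g, elim conjE)
  fix \<phi> \<phi>' :: "real \<Rightarrow> real"
  assume deriv: "\<forall>t. (\<phi> has_real_derivative \<phi>' t) (at t)" and cont: "continuous_on UNIV \<phi>'"
    and supp: "\<exists>a b. 0 < a \<and> b < T \<and> (\<forall>t. t \<notin> {a..b} \<longrightarrow> \<phi> t = 0)"
  have [measurable]: "\<phi>' \<in> borel_measurable borel" by (rule borel_measurable_continuous_onI[OF cont])
  have isc: "isCont \<phi>' t" for t using cont by (simp add: continuous_on_eq_continuous_at)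
  have ends: "\<phi> 0 = 0" "\<phi> T = 0" using supp by auto
  have FTC: "has_bochner_integral lborel (\<lambda>t. \<phi>' t * indicat_real {a..b} t) (\<phi> b - \<phi> a)" if "a \<le> b" for a b
    using that deriv isc by (intro has_bochner_integral_FTC_Icc_real) auto
  define b where "b t = \<phi>' t * indicat_real {0..T} t" for t
  have b: "has_bochner_integral lborel b 0" using FTC[OF T] by (simp add: b_def[abs_def] ends)
  have gint: "integrable lborel (rep_L2 g)" by (rule integrable_L2_on[OF g])
  define F where "F t s = (b t * indicat_real {0..t} s) *\<^sub>R rep_L2 g s" for t s
  have Fint: "integrable (lborel \<Otimes>\<^sub>M lborel) (case_prod F)"
  proof (rule Bochner_Integration.integrable_bound)
    show "integrable (lborel \<Otimes>\<^sub>M lborel) (\<lambda>(t, s). b t *\<^sub>R rep_L2 g s)"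
      using b gint by (intro integrable_product) (auto simp: has_bochner_integral_iff)
    \<comment> \<open>The indicator of a moving interval is rewritten as a condition on the pair,
      which is visibly measurable.\<close>
    have "case_prod F = (\<lambda>p. (b (fst p) * (if 0 \<le> snd p \<and> snd p \<le> fst p then 1 else 0)) *\<^sub>R rep_L2 g (snd p))"
      by (auto simp: F_def indicator_def fun_eq_iff)
    then show "case_prod F \<in> borel_measurable (lborel \<Otimes>\<^sub>M lborel)" unfolding b_def by simp
    show "AE p in lborel \<Otimes>\<^sub>M lborel. norm (case_prod F p) \<le> norm (case p of (t, s) \<Rightarrow> b t *\<^sub>R rep_L2 g s)"
      by (rule AE_I2) (auto simp: F_def indicator_def)
  qed
  have "(LINT t|lborel. \<phi>' t *\<^sub>R rep_L2 (solve0 T (g, c)) t) = (LINT t|lborel. b t *\<^sub>R c + b t *\<^sub>R primitive g t)"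
  proof (rule integral_cong_AE)
    show "AE t in lborel. \<phi>' t *\<^sub>R rep_L2 (solve0 T (g, c)) t = b t *\<^sub>R c + b t *\<^sub>R primitive g t"
      using rep_solve0[OF T, of g c] by eventually_elim (auto simp: b_def indicator_def algebra_simps)
    have "(\<lambda>t. b t *\<^sub>R c + b t *\<^sub>R primitive g t) = (\<lambda>t. \<phi>' t *\<^sub>R solve0_fun T g c t)"
      by (auto simp: b_def solve0_fun_def indicator_def fun_eq_iff algebra_simps)
    then show "(\<lambda>t. b t *\<^sub>R c + b t *\<^sub>R primitive g t) \<in> borel_measurable lborel" by simp
  qed measurable
  also have "\<dots> = (LINT t|lborel. b t *\<^sub>R c) + (LINT t|lborel. b t *\<^sub>R primitive g t)"
  proof (rule Bochner_Integration.integral_add)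
    show "integrable lborel (\<lambda>t. b t *\<^sub>R c)" using b by (auto simp: has_bochner_integral_iff)
    have "(\<lambda>t. b t *\<^sub>R primitive g t) = (\<lambda>t. LINT s|lborel. F t s)"
      by (simp add: F_def primitive_def flip: scaleR_scaleR)
    then show "integrable lborel (\<lambda>t. b t *\<^sub>R primitive g t)"
      using lborel_pair.integrable_fst'[OF Fint] by simp
  qed
  also have "(LINT t|lborel. b t *\<^sub>R c) = 0"
    using b by (simp add: has_bochner_integral_iff)
  also have "(LINT t|lborel. b t *\<^sub>R primitive g t) = (LINT t|lborel. LINT s|lborel. F t s)"
    by (simp add: F_def primitive_def flip: scaleR_scaleR)
  also have "\<dots> = (LINT s|lborel. LINT t|lborel. F t s)"
    by (rule lborel_pair.Fubini_integral[OF Fint, symmetric])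
  also have "\<dots> = (LINT s|lborel. - (\<phi> s *\<^sub>R rep_L2 g s))"
  proof (rule integral_cong_AE)
    show "AE s in lborel. (LINT t|lborel. F t s) = - (\<phi> s *\<^sub>R rep_L2 g s)"
      using L2_on_outside[OF g]
    proof eventually_elim
      case (elim s)
      show ?case
      proof (cases "s \<in> {0..T}")
        case True
        have eq: "F t s = (\<phi>' t * indicat_real {s..T} t) *\<^sub>R rep_L2 g s" for t
          using True by (auto simp: F_def b_def indicator_def)
        show ?thesis unfolding eq using FTC[of s T] True by (simp add: has_bochner_integral_iff ends)
      next
        case False
        then show ?thesis using elim by (simp add: F_def)
      qed
    qed
    have "continuous_on UNIV \<phi>" using deriv DERIV_isCont continuous_at_imp_continuous_on by blast
    then have [measurable]: "\<phi> \<in> borel_measurable borel" by (rule borel_measurable_continuous_onI)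
    show "(\<lambda>s. - (\<phi> s *\<^sub>R rep_L2 g s)) \<in> borel_measurable lborel" by measurable
    show "(\<lambda>s. LINT t|lborel. F t s) \<in> borel_measurable lborel"
      using lborel_pair.integrable_snd[OF Fint] by (rule borel_measurable_integrable)
  qed
  finally show "(LINT t|lborel. \<phi>' t *\<^sub>R rep_L2 (solve0 T (g, c)) t) = - (LINT t|lborel. \<phi> t *\<^sub>R rep_L2 g t)"
    by simp
qed

text \<open>To the left of \<open>a\<close> nothing has been integrated; to the right of
  \<open>b\<close> the whole integral has, and it is zero.\<close>

lemma signed_integral_compact_support:
  fixes f :: "real \<Rightarrow> real"
  assumes f: "continuous_on UNIV f" and supp: "\<And>t. t \<notin> {a..b} \<Longrightarrow> f t = 0"
    and ab: "0 < a" "a \<le> b" and zero: "(LINT t|lborel. f t) = 0" and t: "t \<notin> {a..b}"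
  shows "signed_integral f t = 0"
proof (cases "t < a")
  case True
  have "integral {0..t} f = integral {0..t} (\<lambda>_. 0)"
    by (intro Henstock_Kurzweil_Integration.integral_cong supp) (use True ab in auto)
  moreover have "integral {t..0} f = integral {t..0} (\<lambda>_. 0)"
    by (intro Henstock_Kurzweil_Integration.integral_cong supp) (use True ab in auto)
  ultimately show ?thesis by (simp add: signed_integral_def)
next
  case False
  then have t: "b < t" using t by auto
  have si: "set_integrable lborel {0..t} f"
    using borel_integrable_compact[of "{0..t}" f] continuous_on_subset[OF f]
    by (simp add: set_integrable_def)
  have "integral {0..t} f = (LINT s:{0..t}|lborel. f s)"
    using set_borel_integral_eq_integral(2)[OF si] by simp
  also have "\<dots> = (LINT s|lborel. f s)"
    unfolding set_lebesgue_integral_def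
  proof (intro Bochner_Integration.integral_cong refl)
    show "indicat_real {0..t} s *\<^sub>R f s = f s" for s
      using supp[of s] ab t by (cases "s \<in> {a..b}") auto
  qed
  finally have "integral {0..t} f = 0" using zero by simp
  then show ?thesis using t ab by (simp add: signed_integral_def)
qed

text \<open>Here the derivative of the test function is prescribed: a continuous
  \<open>\<psi>\<close> with mean zero and compact support in \<open>(0, T)\<close> has a primitive
  that is again compactly supported there.\<close>

lemma weak_derivative_test:
  assumes "weak_derivative T x x'" and "continuous_on UNIV \<psi>"
    and "\<And>t. t \<notin> {a..b} \<Longrightarrow> \<psi> t = 0" "0 < a" "a \<le> b" "b < T"
    and "(LINT t|lborel. \<psi> t) = 0"
  shows "(LINT t|lborel. \<psi> t *\<^sub>R rep_L2 x t) = - (LINT t|lborel. signed_integral \<psi> t *\<^sub>R rep_L2 x' t)"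
proof -
  have 1: "(signed_integral \<psi> has_real_derivative \<psi> t) (at t)" for t
    using signed_integral_has_vector_derivative[OF assms(2)]
    by (simp add: has_real_derivative_iff_has_vector_derivative)
  have 2: "\<exists>a b. 0 < a \<and> b < T \<and> (\<forall>t. t \<notin> {a..b} \<longrightarrow> signed_integral \<psi> t = 0)"
    using signed_integral_compact_support[OF assms(2,3,4,5,7)] assms(4,6) by blast
  show ?thesis using assms(1,2) 1 2 unfolding weak_derivative_def by blast
qed

lemma integrable_bump_L2:
  assumes "integrable lborel (g :: real \<Rightarrow> 'a::euclidean_space)"
  shows "integrable lborel (\<lambda>t. bump a b n t *\<^sub>R g t)"
proof (rule Bochner_Integration.integrable_bound[OF assms])
  have [measurable]: "g \<in> borel_measurable lborel" using assms by (rule borel_measurable_integrable)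
  show "(\<lambda>t. bump a b n t *\<^sub>R g t) \<in> borel_measurable lborel" by measurable
  show "AE t in lborel. norm (bump a b n t *\<^sub>R g t) \<le> norm (g t)"
    using bump_bounds[of a b n] by (intro AE_I2) (simp add: mult_left_le_one_le)
qed

lemma integrable_bump: "integrable lborel (bump a b n)"
proof (rule Bochner_Integration.integrable_bound)
  show "integrable lborel (indicat_real {a..b})"
    by (intro integrable_real_indicator) (auto simp: emeasure_lborel_Icc_eq)
  show "AE t in lborel. norm (bump a b n t) \<le> norm (indicat_real {a..b} t)"
    using bump_bounds[of a b n] bump_outside(1)[of _ a b n] by (intro AE_I2) (auto simp: indicator_def)
qed auto

lemma bump_empty: "b < a \<Longrightarrow> bump a b n t = 0"
  by (auto simp: bump_def max_def)

lemma bump_integral_pos: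
  assumes "a < b"
  shows "0 < (LINT t|lborel. bump a b 1 t)"
proof -
  have "\<not> (AE t in lborel. bump a b 1 t = 0)"
  proof
    assume "AE t in lborel. bump a b 1 t = 0"
    then have "AE t in lborel. t \<notin> {a<..<b}"
    proof eventually_elim
      case (elim t)
      show ?case
      proof
        assume "t \<in> {a<..<b}"
        then have "0 < max 0 (t - a)" "0 < max 0 (b - t)" by auto
        then show False using elim by (auto simp: bump_def)
      qed
    qed
    then have "emeasure lborel {a<..<b} = 0" by (intro AE_iff_measurable[THEN iffD1]) auto
    then show False using assms by simp
  qed
  then have "(LINT t|lborel. bump a b 1 t) \<noteq> 0"
    using integral_nonneg_eq_0_iff_AE[OF integrable_bump, of a b 1] bump_bounds(1)[of a b 1] by auto
  moreover have "0 \<le> (LINT t|lborel. bump a b 1 t)" using bump_bounds(1) by (intro integral_nonneg_AE) auto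
  ultimately show ?thesis by simp
qed

lemma AE_interval_open_closed:
  fixes P :: "real \<Rightarrow> bool"
  assumes "AE t in lborel. t \<in> {0<..<T} \<longrightarrow> P t"
  shows "AE t in lborel. t \<in> {0..T} \<longrightarrow> P t"
  using assms AE_lborel_singleton[of 0] AE_lborel_singleton[of T] by eventually_elim auto

lemma L2_on_eqI:
  assumes "x \<in> L2_on T" "y \<in> L2_on T" "AE t in lborel. t \<in> {0<..<T} \<longrightarrow> rep_L2 x t = rep_L2 y t"
  shows "x = y"
proof (rule L2_eqI)
  show "AE t in lborel. rep_L2 x t = rep_L2 y t"
    using L2_on_outside[OF assms(1)] L2_on_outside[OF assms(2)] AE_interval_open_closed[OF assms(3)]
    by eventually_elim (metis)
qed

text \<open>Justifies the definite description in \<open>deriv_H1\<close>: two weak derivatives have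
  the same integral against every bump supported inside \<open>(0, T)\<close>.\<close>

lemma weak_derivative_unique:
  fixes x :: "'a::euclidean_space L2"
  assumes 1: "weak_derivative T x x1" and 2: "weak_derivative T x x2"
  shows "x1 = x2"
proof -
  have L: "x1 \<in> L2_on T" "x2 \<in> L2_on T" using 1 2 by (auto simp: weak_derivative_def)
  note int = integrable_L2_on[OF L(1)] integrable_L2_on[OF L(2)]
  have "AE t in lborel. t \<in> {0<..<T} \<longrightarrow> rep_L2 x1 t - rep_L2 x2 t = 0"
  proof (rule fundamental_lemma)
    show "integrable lborel (\<lambda>t. rep_L2 x1 t - rep_L2 x2 t)" using int by simp
    fix a b :: real and n assume ab: "0 < a" "b < T"
    have supp: "\<exists>c d. 0 < c \<and> d < T \<and> (\<forall>t. t \<notin> {c..d} \<longrightarrow> bump a b n t = 0)"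
      using ab bump_outside(1) by blast
    have "(LINT t|lborel. bump_deriv a b n t *\<^sub>R rep_L2 x t) = - (LINT t|lborel. bump a b n t *\<^sub>R rep_L2 x' t)"
      if "weak_derivative T x x'" for x'
      using that supp bump_has_derivative[of a b n] continuous_on_bump_deriv[of UNIV a b n]
      unfolding weak_derivative_def by blast
    from this[OF 1] this[OF 2]
    have "(LINT t|lborel. bump a b n t *\<^sub>R rep_L2 x1 t) = (LINT t|lborel. bump a b n t *\<^sub>R rep_L2 x2 t)" by simp
    then show "(LINT t|lborel. bump a b n t *\<^sub>R (rep_L2 x1 t - rep_L2 x2 t)) = 0"
      using integrable_bump_L2[OF int(1), of a b n] integrable_bump_L2[OF int(2), of a b n]
      by (simp add: scaleR_diff_right)
  qed
  then show ?thesis by (intro L2_on_eqI[OF L]) simp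
qed

text \<open>Subtracting a primitive of the weak derivative will reduce the description of Sobolev
  functions to the case of zero derivative.\<close>

lemma weak_derivative_diff:
  fixes x y :: "'a::euclidean_space L2"
  assumes x: "weak_derivative T x x'" and y: "weak_derivative T y x'"
  shows "weak_derivative T (x - y) 0"
  unfolding weak_derivative_def
proof (intro conjI allI impI, goal_cases)
  case 1
  then show ?case using x y subspace_diff[OF subspace_L2_on] by (auto simp: weak_derivative_def)
next
  case 2
  then show ?case by (rule subspace_0[OF subspace_L2_on])
next
  case (3 \<phi> \<phi>')
  have cont: "continuous_on UNIV \<phi>'" using 3 by blast
  then have [measurable]: "\<phi>' \<in> borel_measurable borel" by (rule borel_measurable_continuous_onI)
  have L: "x \<in> L2_on T" "y \<in> L2_on T" using x y by (auto simp: weak_derivative_def)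
  have "(LINT t|lborel. \<phi>' t *\<^sub>R rep_L2 x t) = - (LINT t|lborel. \<phi> t *\<^sub>R rep_L2 x' t)"
    using x 3 unfolding weak_derivative_def by blast
  moreover have "(LINT t|lborel. \<phi>' t *\<^sub>R rep_L2 y t) = - (LINT t|lborel. \<phi> t *\<^sub>R rep_L2 x' t)"
    using y 3 unfolding weak_derivative_def by blast
  ultimately have eq: "(LINT t|lborel. \<phi>' t *\<^sub>R rep_L2 x t) = (LINT t|lborel. \<phi>' t *\<^sub>R rep_L2 y t)" by simp
  have bounded: "bounded (\<phi>' ` {0..T})"
    by (intro compact_imp_bounded compact_continuous_image continuous_on_subset[OF cont]) auto
  then obtain B where B: "\<And>t. t \<in> {0..T} \<Longrightarrow> norm (\<phi>' t) \<le> B" unfolding bounded_iff by blast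
  have int: "integrable lborel (\<lambda>t. \<phi>' t *\<^sub>R rep_L2 z t)" if "z \<in> L2_on T" for z :: "'a L2"
  proof (rule Bochner_Integration.integrable_bound)
    show "integrable lborel (\<lambda>t. B * norm (rep_L2 z t))" using integrable_L2_on[OF that] by simp
    show "AE t in lborel. norm (\<phi>' t *\<^sub>R rep_L2 z t) \<le> norm (B * norm (rep_L2 z t))"
      using L2_on_outside[OF that]
    proof eventually_elim
      case (elim t)
      show ?case
      proof (cases "t \<in> {0..T}")
        case True
        from B[OF this] have "\<bar>\<phi>' t\<bar> \<le> \<bar>B\<bar>" by simp
        then show ?thesis by (simp add: abs_mult mult_right_mono)
      qed (use elim in auto)
    qed
  qed measurable
  have "(LINT t|lborel. \<phi>' t *\<^sub>R rep_L2 (x - y) t) = (LINT t|lborel. \<phi>' t *\<^sub>R rep_L2 x t - \<phi>' t *\<^sub>R rep_L2 y t)"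
  proof (rule integral_cong_AE)
    show "AE t in lborel. \<phi>' t *\<^sub>R rep_L2 (x - y) t = \<phi>' t *\<^sub>R rep_L2 x t - \<phi>' t *\<^sub>R rep_L2 y t"
      using rep_arith(2)[of x y] by eventually_elim (simp add: scaleR_diff_right)
  qed measurable
  also have "\<dots> = 0" using int[OF L(1)] int[OF L(2)] eq by simp
  also have "0 = - (LINT t|lborel. \<phi> t *\<^sub>R rep_L2 (0::'a L2) t)"
  proof -
    have "continuous_on UNIV \<phi>"
      by (intro continuous_at_imp_continuous_on ballI DERIV_isCont) (use 3 in blast)
    then have [measurable]: "\<phi> \<in> borel_measurable borel" by (rule borel_measurable_continuous_onI)
    have "(LINT t|lborel. \<phi> t *\<^sub>R rep_L2 (0::'a L2) t) = (LINT t|lborel. \<phi> t *\<^sub>R (0::'a))"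
    proof (rule integral_cong_AE)
      show "AE t in lborel. \<phi> t *\<^sub>R rep_L2 (0::'a L2) t = \<phi> t *\<^sub>R 0"
        using rep_arith(4)[where 'a = 'a] by eventually_elim simp
    qed measurable
    then show ?thesis by simp
  qed
  finally show ?case .
qed

text \<open>Du Bois-Reymond: subtracting a multiple of a fixed bump \<open>\<psi>0\<close> gives every other bump mean zero,
  so that it becomes the derivative of a test function.\<close>

lemma weak_derivative_zero_constant:
  fixes x :: "'a::euclidean_space L2"
  assumes T: "0 < T" and x: "weak_derivative T x 0"
  shows "\<exists>c. x = solve0 T (0, c)"
proof -
  have L: "x \<in> L2_on T" using x by (simp add: weak_derivative_def)
  note int = integrable_L2_on[OF L]
  define \<psi>0 where "\<psi>0 = bump (T / 3) (2 * T / 3) 1"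
  define m where "m = (LINT t|lborel. \<psi>0 t)"
  have m: "m > 0" unfolding m_def \<psi>0_def using T by (intro bump_integral_pos) simp
  \<comment> \<open>If \<open>x\<close> is constant on \<open>[0, T]\<close>, this weighted mean is
    its value.\<close>
  define c where "c = (1 / m) *\<^sub>R (LINT t|lborel. \<psi>0 t *\<^sub>R rep_L2 x t)"
  have key: "(LINT t|lborel. bump a b n t *\<^sub>R rep_L2 x t) = (LINT t|lborel. bump a b n t) *\<^sub>R c"
    if ab: "0 < a" "b < T" for a b n
  proof (cases "a \<le> b")
    case True
    define r where "r = (LINT t|lborel. bump a b n t) / m"
    define \<psi> where "\<psi> t = bump a b n t - r * \<psi>0 t" for t
    have "(LINT t|lborel. \<psi> t) = (LINT t|lborel. bump a b n t) - r * m"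
      unfolding \<psi>_def m_def \<psi>0_def by (simp add: integrable_bump)
    then have zero: "(LINT t|lborel. \<psi> t) = 0" using m by (simp add: r_def)
    have "(LINT t|lborel. \<psi> t *\<^sub>R rep_L2 x t) = - (LINT t|lborel. signed_integral \<psi> t *\<^sub>R rep_L2 (0::'a L2) t)"
    proof (rule weak_derivative_test[OF x])
      show "continuous_on UNIV \<psi>" unfolding \<psi>_def \<psi>0_def by (intro continuous_intros continuous_on_bump)
      \<comment> \<open>The hull of both supports, still inside \<open>(0, T)\<close>.\<close>
      show "\<psi> t = 0" if "t \<notin> {min a (T / 3)..max b (2 * T / 3)}" for t
      proof -
        have "t \<notin> {a..b}" "t \<notin> {T / 3..2 * T / 3}" using that by auto
        then have "bump a b n t = 0" "bump (T / 3) (2 * T / 3) 1 t = 0" by (auto intro: bump_outside(1))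
        then show ?thesis by (simp add: \<psi>_def \<psi>0_def)
      qed
    qed (use ab T True zero in auto)
    also have "(LINT t|lborel. signed_integral \<psi> t *\<^sub>R rep_L2 (0::'a L2) t) = 0"
    proof (rule integral_eq_zero_AE)
      show "AE t in lborel. signed_integral \<psi> t *\<^sub>R rep_L2 (0::'a L2) t = 0"
        using rep_arith(4)[where 'a = 'a] by eventually_elim simp
    qed
    finally have "0 = (LINT t|lborel. \<psi> t *\<^sub>R rep_L2 x t)" by simp
    also have "\<dots> = (LINT t|lborel. bump a b n t *\<^sub>R rep_L2 x t - r *\<^sub>R (\<psi>0 t *\<^sub>R rep_L2 x t))"
      by (simp add: \<psi>_def scaleR_diff_left)
    also have "\<dots> = (LINT t|lborel. bump a b n t *\<^sub>R rep_L2 x t) - (LINT t|lborel. r *\<^sub>R (\<psi>0 t *\<^sub>R rep_L2 x t))"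
      unfolding \<psi>0_def by (intro Bochner_Integration.integral_diff integrable_bump_L2 integrable_scaleR_right int)
    also have "(LINT t|lborel. r *\<^sub>R (\<psi>0 t *\<^sub>R rep_L2 x t)) = r *\<^sub>R (LINT t|lborel. \<psi>0 t *\<^sub>R rep_L2 x t)"
      by (rule integral_scaleR_right)
    also have "\<dots> = (LINT t|lborel. bump a b n t) *\<^sub>R c" by (simp add: c_def r_def)
    finally show ?thesis by simp
  qed (simp add: bump_empty)
  have "AE t in lborel. t \<in> {0<..<T} \<longrightarrow> rep_L2 x t - indicat_real {0..T} t *\<^sub>R c = 0"
  proof (rule fundamental_lemma)
    have i2: "integrable lborel (\<lambda>t. indicat_real {0..T} t *\<^sub>R c)"
      by (intro integrable_scaleR_left integrable_real_indicator) (auto simp: emeasure_lborel_Icc_eq)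
    show "integrable lborel (\<lambda>t. rep_L2 x t - indicat_real {0..T} t *\<^sub>R c)" using int i2 by simp
    fix a b :: real and n assume ab: "0 < a" "b < T"
    have "(LINT t|lborel. bump a b n t *\<^sub>R (rep_L2 x t - indicat_real {0..T} t *\<^sub>R c))
        = (LINT t|lborel. bump a b n t *\<^sub>R rep_L2 x t - bump a b n t *\<^sub>R c)"
    proof (intro Bochner_Integration.integral_cong refl)
      show "bump a b n t *\<^sub>R (rep_L2 x t - indicat_real {0..T} t *\<^sub>R c) = bump a b n t *\<^sub>R rep_L2 x t - bump a b n t *\<^sub>R c" for t
        using ab bump_outside(1)[of t a b n] by (cases "t \<in> {a..b}") (auto simp: scaleR_diff_right)
    qed
    also have "\<dots> = (LINT t|lborel. bump a b n t *\<^sub>R rep_L2 x t) - (LINT t|lborel. bump a b n t *\<^sub>R c)"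
      by (intro Bochner_Integration.integral_diff integrable_bump_L2 int integrable_scaleR_left integrable_bump)
    also have "\<dots> = 0" using key[OF ab, of n] by (simp add: integrable_bump)
    finally show "(LINT t|lborel. bump a b n t *\<^sub>R (rep_L2 x t - indicat_real {0..T} t *\<^sub>R c)) = 0" .
  qed
  then have AE: "AE t in lborel. t \<in> {0<..<T} \<longrightarrow> rep_L2 x t = rep_L2 (solve0 T (0, c)) t"
    using rep_solve0[OF less_imp_le[OF T], of 0 c]
    by eventually_elim (use primitive_scaleR[of 0 "0 :: 'a L2"] in auto)
  have "x = solve0 T (0, c)" by (rule L2_on_eqI[OF L solve0_in_L2_on AE]) (use T in simp)
  then show ?thesis by blast
qed

lemma deriv_solve0:
  assumes T: "0 \<le> T" and g: "g \<in> L2_on T"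
  shows "deriv_H1 T (solve0 T (g, c)) = g"
  unfolding deriv_H1_def
  using solve0_weak_derivative[OF assms, of c] weak_derivative_unique by blast

text \<open>Subtracting a primitive of the weak derivative leaves a constant. Every Sobolev function
  thus has an explicit continuous representative, from which derivative and initial value can be
  read off.\<close>

lemma H1_on_eq:
  assumes T: "0 < T"
  shows "H1_on T = solve0 T ` (L2_on T \<times> UNIV)"
proof (intro set_eqI iffI)
  fix x :: "'a L2" assume "x \<in> H1_on T"
  then obtain g where g: "weak_derivative T x g" by (auto simp: H1_on_def)
  then have gL: "g \<in> L2_on T" by (simp add: weak_derivative_def)
  have "weak_derivative T (x - solve0 T (g, 0)) 0"
    using T by (intro weak_derivative_diff[OF g] solve0_weak_derivative gL) simp
  then obtain c where "x - solve0 T (g, 0) = solve0 T (0, c)"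
    using weak_derivative_zero_constant[OF T] by blast
  then have "x = solve0 T (g, 0) + solve0 T (0, c)" by (simp add: algebra_simps)
  also have "\<dots> = solve0 T ((g, 0) + (0, c))"
    by (rule linear_add[OF bounded_linear.linear[OF bounded_linear_solve0[OF less_imp_le[OF T]]], symmetric])
  finally have "x = solve0 T (g, c)" by simp
  then show "x \<in> solve0 T ` (L2_on T \<times> UNIV)" using gL by blast
next
  fix x :: "'a L2" assume "x \<in> solve0 T ` (L2_on T \<times> UNIV)"
  then show "x \<in> H1_on T" using solve0_weak_derivative[of T] T by (auto simp: H1_on_def)
qed

text \<open>Two continuous functions on \<open>[0, T]\<close> that agree almost everywhere agree at
  0: otherwise they would differ on some interval \<open>(0, min T e)\<close>, which has positive
  measure.\<close>

lemma eval_solve0: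
  fixes g :: "'a::euclidean_space L2"
  assumes T: "0 < T"
  shows "eval_H1 T (solve0 T (g, c)) 0 = c"
  unfolding eval_H1_def
proof (rule the_equality)
  have cont: "continuous_on {0..T} (\<lambda>t. c + primitive g t)"
    by (intro continuous_intros continuous_on_subset[OF continuous_on_primitive]) auto
  have ae: "AE s in lborel. s \<in> {0..T} \<longrightarrow> c + primitive g s = rep_L2 (solve0 T (g, c)) s"
    using rep_solve0[of T g c] T by (auto elim!: eventually_mono)
  show "\<exists>v. continuous_on {0..T} v \<and> (AE s in lborel. s \<in> {0..T} \<longrightarrow> v s = rep_L2 (solve0 T (g, c)) s) \<and> v 0 = c"
    using cont ae by (intro exI[of _ "\<lambda>t. c + primitive g t"]) simp
  fix d assume "\<exists>v. continuous_on {0..T} v \<and> (AE s in lborel. s \<in> {0..T} \<longrightarrow> v s = rep_L2 (solve0 T (g, c)) s) \<and> v 0 = d"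
  then obtain v where v: "continuous_on {0..T} v"
    "AE s in lborel. s \<in> {0..T} \<longrightarrow> v s = rep_L2 (solve0 T (g, c)) s" "v 0 = d" by blast
  define w where "w t = v t - (c + primitive g t)" for t
  have w: "continuous_on {0..T} w" unfolding w_def by (intro continuous_intros v cont)
  have wae: "AE s in lborel. s \<in> {0..T} \<longrightarrow> w s = 0"
    using v(2) ae by eventually_elim (auto simp: w_def)
  have "w 0 = 0"
  proof (rule ccontr)
    assume "w 0 \<noteq> 0"
    then obtain e where e: "e > 0" "\<And>t. t \<in> {0..T} \<Longrightarrow> dist t 0 < e \<Longrightarrow> dist (w t) (w 0) < norm (w 0)"
      using w T unfolding continuous_on_iff by (metis atLeastAtMost_iff less_imp_le order_refl zero_less_norm_iff)
    have "AE s in lborel. s \<notin> {0<..<min T e}"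
      using wae
    proof eventually_elim
      case (elim s)
      show ?case
      proof
        assume s: "s \<in> {0<..<min T e}"
        then have "dist (w s) (w 0) < norm (w 0)" by (intro e) auto
        then show False using elim s by simp
      qed
    qed
    then have "emeasure lborel {0<..<min T e} = 0" by (intro AE_iff_measurable[THEN iffD1]) auto
    then show False using T e(1) by simp
  qed
  then show "d = c" using v(3) by (simp add: w_def)
qed

text \<open>Density of the Sobolev space, in dual form. Let \<open>v\<close> be the integral of a
  bump times \<open>f\<close>. The choice of \<open>bump_deriv a b n t *\<^sub>R v\<close> for
  \<open>g\<close> makes the primitive the bump times \<open>v\<close>, and orthogonality becomes
  \<open>v \<bullet> v = 0\<close>.\<close>

lemma solve0_dense:
  fixes f :: "'a::euclidean_space L2"
  assumes T: "0 < T" and f: "f \<in> L2_on T"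
    and orth: "\<And>g c. g \<in> L2_on T \<Longrightarrow> solve0 T (g, c) \<bullet> f = 0"
  shows "f = 0"
proof -
  have int: "integrable lborel (rep_L2 f)" by (rule integrable_L2_on[OF f])
  have "AE t in lborel. t \<in> {0<..<T} \<longrightarrow> rep_L2 f t = 0"
  proof (rule fundamental_lemma[OF int])
    fix a b :: real and n assume ab: "0 < a" "b < T"
    define v where "v = (LINT t|lborel. bump a b n t *\<^sub>R rep_L2 f t)"
    define h where "h t = bump_deriv a b n t *\<^sub>R v" for t
    have [measurable]: "h \<in> borel_measurable borel" unfolding h_def[abs_def] by measurable
    have "bounded (h ` {0..T})" unfolding h_def
      by (intro compact_imp_bounded compact_continuous_image continuous_intros continuous_on_bump_deriv) auto
    then obtain B where B: "\<And>t. t \<in> {0..T} \<Longrightarrow> norm (h t) \<le> B" unfolding bounded_iff by blast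
    have out: "h t = 0" if "t \<notin> {0..T}" for t
    proof -
      have "t \<notin> {a..b}" using that ab by auto
      then show ?thesis by (simp add: h_def bump_outside(2))
    qed
    have h: "square_integrable h"
      by (rule bounded_on_interval_square_integrable(1)[OF _ _ out B]) (use T in auto)
    have hL: "abs_L2 h \<in> L2_on T" by (rule abs_in_L2_on[OF h out])
    have prim: "primitive (abs_L2 h) t = bump a b n t *\<^sub>R v" if t: "0 \<le> t" for t
    proof -
      have "primitive (abs_L2 h) t = (LINT s|lborel. indicat_real {0..t} s *\<^sub>R h s)"
        unfolding primitive_def
      proof (rule integral_cong_AE)
        show "AE s in lborel. indicat_real {0..t} s *\<^sub>R rep_L2 (abs_L2 h) s = indicat_real {0..t} s *\<^sub>R h s"
          using rep_abs[OF h] by eventually_elim simp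
      qed measurable
      also have "\<dots> = bump a b n t *\<^sub>R v - bump a b n 0 *\<^sub>R v"
      proof (rule integral_FTC_Icc[OF t])
        show "continuous_on {0..t} h" unfolding h_def by (intro continuous_intros continuous_on_bump_deriv)
        fix s
        have "(bump a b n has_vector_derivative bump_deriv a b n s) (at s within {0..t})"
          using bump_has_derivative[of a b n s]
          by (simp add: has_real_derivative_iff_has_vector_derivative has_vector_derivative_at_within)
        from bounded_linear.has_vector_derivative[OF bounded_linear_scaleR_left this]
        show "((\<lambda>t. bump a b n t *\<^sub>R v) has_vector_derivative h s) (at s within {0..t})"
          by (simp add: h_def)
      qed
      finally show ?thesis using ab by (simp add: bump_outside)
    qed
    have "0 = solve0 T (abs_L2 h, 0) \<bullet> f" using orth[OF hL] by simp
    also have "\<dots> = (LINT t|lborel. (bump a b n t *\<^sub>R rep_L2 f t) \<bullet> v)"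
      unfolding inner_L2_eq
    proof (rule integral_cong_AE)
      have "0 \<le> T" using T by simp
      show "AE t in lborel. rep_L2 (solve0 T (abs_L2 h, 0)) t \<bullet> rep_L2 f t = (bump a b n t *\<^sub>R rep_L2 f t) \<bullet> v"
        using rep_solve0[OF \<open>0 \<le> T\<close>, of "abs_L2 h" 0]
      proof eventually_elim
        case (elim t)
        show ?case
        proof (cases "t \<in> {0..T}")
          case True
          then show ?thesis using elim by (simp add: prim inner_commute)
        next
          case False
          then have "bump a b n t = 0" using ab by (intro bump_outside) auto
          then show ?thesis using elim False by simp
        qed
      qed
    qed measurable
    also have "\<dots> = v \<bullet> v"
      using integral_inner_left[of v lborel "\<lambda>t. bump a b n t *\<^sub>R rep_L2 f t"] integrable_bump_L2[OF int]
      by (simp add: v_def)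
    finally show "(LINT t|lborel. bump a b n t *\<^sub>R rep_L2 f t) = 0" by (simp add: v_def)
  qed
  then have "AE t in lborel. t \<in> {0<..<T} \<longrightarrow> rep_L2 f t = rep_L2 (0 :: 'a L2) t"
    using rep_arith(4)[where 'a = 'a] by eventually_elim simp
  then show ?thesis by (intro L2_on_eqI[OF f]) (simp_all add: subspace_0[OF subspace_L2_on])
qed

section \<open>The operator of the optimality system\<close>

lemma square_integrable_matrix:
  fixes M :: "real^'n::finite^'k::finite"
  assumes h: "square_integrable h"
  shows "square_integrable (\<lambda>t. M *v h t)"
proof (rule square_integrable_bound[OF h])
  have "h \<in> borel_measurable lborel" using h by (simp add: square_integrable_def)
  then show "(\<lambda>t. M *v h t) \<in> borel_measurable lborel"
    using borel_measurable_continuous_on[OF linear_continuous_on[OF matrix_vector_mul_bounded_linear]]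
    by blast
  show "norm (M *v h t) \<le> onorm ((*v) M) * norm (h t)" for t
    by (rule onorm) (rule matrix_vector_mul_bounded_linear)
qed

lemma rep_matrix: "AE t in lborel. rep_L2 (matrix_L2 M x) t = M *v rep_L2 x t"
proof -
  have "matrix_L2 M (abs_L2 (rep_L2 x)) = abs_L2 (\<lambda>t. M *v rep_L2 x t)"
    by (rule matrix_L2.abs_eq) (simp add: L2_eq_def square_integrable_rep)
  then show ?thesis
    using rep_abs[OF square_integrable_matrix[OF square_integrable_rep[of x], of M]] by (simp add: abs_rep)
qed

lemma bounded_linear_matrix_L2: "bounded_linear (matrix_L2 M)"
proof (rule bounded_linear_intro[where K = "onorm ((*v) M)"])
  show "matrix_L2 M (x + y) = matrix_L2 M x + matrix_L2 M y" for x y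
    by (rule L2_eqI, use rep_matrix[of M "x + y"] rep_matrix[of M x] rep_matrix[of M y]
        rep_arith(1)[of "matrix_L2 M x" "matrix_L2 M y"] rep_arith(1)[of x y] in eventually_elim)
      (simp add: matrix_vector_right_distrib)
  show "matrix_L2 M (c *\<^sub>R x) = c *\<^sub>R matrix_L2 M x" for c x
    by (rule L2_eqI, use rep_matrix[of M "c *\<^sub>R x"] rep_matrix[of M x]
        rep_arith(3)[of c "matrix_L2 M x"] rep_arith(3)[of c x] in eventually_elim)
      (simp add: matrix_vector_mult_scaleR)
  show "norm (matrix_L2 M x) \<le> norm x * onorm ((*v) M)" for x
    unfolding mult.commute[of "norm x"]
  proof (rule norm_L2_le)
    show "AE t in lborel. norm (rep_L2 (matrix_L2 M x) t) \<le> onorm ((*v) M) * norm (rep_L2 x t)"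
      using rep_matrix[of M x] by eventually_elim (simp add: onorm[OF matrix_vector_mul_bounded_linear])
    show "0 \<le> onorm ((*v) M)" by (rule onorm_pos_le) (rule matrix_vector_mul_bounded_linear)
  qed
qed

lemma inner_matrix_L2: "matrix_L2 M x \<bullet> y = x \<bullet> matrix_L2 (transpose M) y"
  unfolding inner_L2_eq
proof (rule integral_cong_AE)
  show "AE t in lborel. rep_L2 (matrix_L2 M x) t \<bullet> rep_L2 y t = rep_L2 x t \<bullet> rep_L2 (matrix_L2 (transpose M) y) t"
    using rep_matrix[of M x] rep_matrix[of "transpose M" y]
    by eventually_elim (metis dot_lmul_matrix inner_commute transpose_matrix_vector transpose_transpose)
qed measurable

lemma cutoff_matrix: "cutoff T k (matrix_L2 M x) = matrix_L2 M (cutoff T k x)"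
  by (rule L2_eqI, use rep_cutoff[of T k "matrix_L2 M x"] rep_matrix[of M x] rep_cutoff[of T k x]
      rep_matrix[of M "cutoff T k x"] in eventually_elim) (simp add: matrix_vector_mult_scaleR)

lemma matrix_in_L2_on: "x \<in> L2_on T \<Longrightarrow> matrix_L2 M x \<in> L2_on T"
  by (simp add: L2_on_iff cutoff_matrix)

text \<open>The initial value problem \<open>x' = A x + f\<close>, \<open>x 0 = c\<close> is the
  fixed point equation \<open>x = solve0 T (A x + f, c)\<close>. Its Volterra operator may be large
  on a long interval, but its conjugate \<open>Q\<close> by the exponential weight is small, so that
  the identity minus \<open>Q\<close> is coercive.\<close>

lemma solution_operator:
  fixes A :: "real^'n::finite^'n"
  assumes T: "0 < T"
  obtains K where "bounded_linear K" "\<And>z. K z \<in> L2_on T"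
    "\<And>z. K z = solve0 T (matrix_L2 A (K z) + fst z, snd z)"
    "\<And>x z. x \<in> L2_on T \<Longrightarrow> x = solve0 T (matrix_L2 A x + fst z, snd z) \<Longrightarrow> x = K z"
proof -
  have T0: "0 \<le> T" using T by simp
  interpret S: bounded_linear "solve0 T :: (real^'n) L2 \<times> (real^'n) \<Rightarrow> _" by (rule bounded_linear_solve0[OF T0])
  interpret A: bounded_linear "matrix_L2 A" by (rule bounded_linear_matrix_L2)
  interpret E: bounded_linear "cutoff T k :: (real^'n) L2 \<Rightarrow> _" for k by (rule bounded_linear_cutoff)
  obtain a where a: "a \<ge> 0" "\<And>x. norm (matrix_L2 A x) \<le> a * norm x"
    using bounded_linear_nonneg_bound[OF bounded_linear_matrix_L2] by blast
  \<comment> \<open>Chosen so that \<open>T * a\<^sup>2 / (2 * k)\<close> is at most 1/4; the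
    summand 1 keeps \<open>k\<close> positive for \<open>a = 0\<close>.\<close>
  define k where "k = 2 * T * a\<^sup>2 + 1"
  have k: "k > 0" using T by (simp add: k_def add_nonneg_pos)
  define q where "q = sqrt (T / (2 * k))"
  have qa: "q * a \<le> 1 / 2"
  proof (rule power2_le_imp_le)
    have "(q * a)\<^sup>2 = T * a\<^sup>2 / (2 * k)" using T k by (simp add: q_def power_mult_distrib)
    also have "\<dots> \<le> (1 / 2)\<^sup>2" using k by (simp add: k_def power2_eq_square field_simps)
    finally show "(q * a)\<^sup>2 \<le> (1 / 2)\<^sup>2" .
  qed simp
  define Q where "Q y = cutoff T (- k) (solve0 T (matrix_L2 A (cutoff T k y), 0))" for y
  define M where "M y = y - Q y" for y
  have Q_lin: "bounded_linear Q" unfolding Q_def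
    by (intro bounded_linear_compose[OF bounded_linear_cutoff] bounded_linear_compose[OF bounded_linear_solve0[OF T0]]
        bounded_linear_Pair bounded_linear_compose[OF bounded_linear_matrix_L2] bounded_linear_cutoff bounded_linear_zero)
  have Q_small: "norm (Q y) \<le> 1 / 2 * norm y" for y
  proof -
    have "norm (Q y) \<le> q * norm (matrix_L2 A y)"
      unfolding Q_def q_def cutoff_matrix[symmetric] by (rule solve0_conjugate_bound[OF T0 k])
    also have "\<dots> \<le> q * (a * norm y)" using T k by (intro mult_left_mono a) (simp add: q_def)
    also have "\<dots> \<le> 1 / 2 * norm y" using mult_right_mono[OF qa norm_ge_zero[of y]] by (simp add: mult.assoc)
    finally show ?thesis .
  qed
  have M: "bounded_linear M" unfolding M_def by (intro bounded_linear_sub bounded_linear_ident Q_lin)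
  have coercive: "1 / 2 * (norm y)\<^sup>2 \<le> M y \<bullet> y" for y
  proof -
    have "Q y \<bullet> y \<le> norm (Q y) * norm y" by (rule norm_cauchy_schwarz)
    also have "\<dots> \<le> 1 / 2 * norm y * norm y" by (intro mult_right_mono Q_small) simp
    finally show ?thesis by (simp add: M_def inner_diff_left power2_norm_eq_inner[symmetric] power2_eq_square)
  qed
  obtain M' where M': "bounded_linear M'" "\<And>x. M (M' x) = x" "\<And>x. M' (M x) = x"
    using lax_milgram[OF M _ coercive] by auto
  \<comment> \<open>Solves in the weighted variable and transforms back.\<close>
  define K where "K z = cutoff T k (M' (cutoff T (- k) (solve0 T z)))" for z
  have S_in: "cutoff T 0 (solve0 T z) = solve0 T z" for z :: "(real^'n) L2 \<times> (real^'n)"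
    using solve0_in_L2_on[OF T0] by (simp add: L2_on_iff)
  have K_eq: "K z = solve0 T (matrix_L2 A (K z) + fst z, snd z)" for z
  proof -
    define y where "y = M' (cutoff T (- k) (solve0 T z))"
    have "y - Q y = cutoff T (- k) (solve0 T z)" using M'(2) by (simp add: y_def M_def)
    then have "cutoff T k (y - Q y) = solve0 T z" by (simp add: cutoff_cutoff S_in)
    moreover have "cutoff T k (Q y) = solve0 T (matrix_L2 A (K z), 0)"
      by (simp add: Q_def cutoff_cutoff S_in K_def y_def)
    ultimately have "K z = solve0 T (matrix_L2 A (K z), 0) + solve0 T z"
      by (simp add: E.diff K_def y_def algebra_simps)
    also have "\<dots> = solve0 T (matrix_L2 A (K z) + fst z, snd z)"
      by (simp flip: S.add) (simp add: plus_prod_def)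
    finally show ?thesis .
  qed
  show ?thesis
  proof (rule that[of K, OF _ _ K_eq])
    show "bounded_linear K" unfolding K_def
      by (intro bounded_linear_compose[OF bounded_linear_cutoff] bounded_linear_compose[OF M'(1)]
          bounded_linear_solve0 T0)
    show K_in: "K z \<in> L2_on T" for z by (simp add: K_def)
    fix x z assume x: "x \<in> L2_on T" "x = solve0 T (matrix_L2 A x + fst z, snd z)"
    define d where "d = x - K z"
    have dL: "d \<in> L2_on T" unfolding d_def using x K_in by (intro subspace_diff[OF subspace_L2_on])
    have "d = solve0 T (matrix_L2 A x + fst z, snd z) - solve0 T (matrix_L2 A (K z) + fst z, snd z)"
      unfolding d_def using x(2) K_eq[of z] by simp
    also have "\<dots> = solve0 T (matrix_L2 A d, 0)" by (simp add: d_def A.diff flip: S.diff)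
    finally have d: "solve0 T (matrix_L2 A d, 0) = d" by simp
    define y where "y = cutoff T (- k) d"
    have y: "cutoff T k y = d" using dL by (simp add: y_def cutoff_cutoff L2_on_iff)
    have "M y = 0" by (simp add: M_def Q_def y d) (simp add: y_def)
    then have "y = 0" using M'(3)[of y] bounded_linear.linear[OF M'(1)] by (simp add: linear_0)
    then have "d = 0" using y by (simp add: E.zero)
    then show "x = K z" by (simp add: d_def)
  qed
qed

text \<open>The solution operator is precomposed with the orthogonal projection \<open>P\<close>
  onto \<open>Z_space T\<close>, so that its adjoint takes values in \<open>Z_space T\<close>. The
  adjoint is injective on \<open>L2_on T\<close> because the range of the solution operator, the
  Sobolev space, is dense there.\<close>

lemma solution_operator_inverse:
  fixes A :: "real^'n::finite^'n"
  assumes T: "0 < T"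
  obtains K K' where "bounded_linear K" "bounded_linear K'"
    "\<And>z. K z \<in> L2_on T" "\<And>y. K' y \<in> Z_space T" "\<And>z y. K z \<bullet> y = z \<bullet> K' y"
    "H1_on T = K ` Z_space T" "\<And>z. z \<in> Z_space T \<Longrightarrow> op_A T A (K z) = z"
    "\<And>y. y \<in> L2_on T \<Longrightarrow> K' y = 0 \<Longrightarrow> y = 0"
proof -
  have T0: "0 \<le> T" using T by simp
  obtain K where K: "bounded_linear K" "\<And>z. K z \<in> L2_on T"
    "\<And>z. K z = solve0 T (matrix_L2 A (K z) + fst z, snd z)"
    "\<And>x z. x \<in> L2_on T \<Longrightarrow> x = solve0 T (matrix_L2 A x + fst z, snd z) \<Longrightarrow> x = K z"
    by (rule solution_operator[OF T, of A], rule that, assumption+)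
  obtain K' where K': "bounded_linear K'" "\<And>z y. K z \<bullet> y = z \<bullet> K' y"
    using bounded_linear_adjoint[OF K(1)] by blast
  define P :: "(real^'n) L2 \<times> (real^'n) \<Rightarrow> _" where "P z = (cutoff T 0 (fst z), snd z)" for z
  have P: "bounded_linear P" unfolding P_def
    by (intro bounded_linear_Pair bounded_linear_compose[OF bounded_linear_cutoff] bounded_linear_fst bounded_linear_snd)
  have PZ: "P z \<in> Z_space T" for z by (simp add: P_def Z_space_def)
  have P_id: "P z = z" if "z \<in> Z_space T" for z using that by (auto simp: P_def Z_space_def L2_on_iff)
  have P_sym: "P z \<bullet> w = z \<bullet> P w" for z w by (simp add: P_def inner_prod_def inner_cutoff)
  have H1: "H1_on T = K ` Z_space T"
  proof (intro set_eqI iffI)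
    fix x :: "(real^'n) L2" assume "x \<in> H1_on T"
    then obtain g c where x: "x = solve0 T (g, c)" "g \<in> L2_on T" unfolding H1_on_eq[OF T] by auto
    have xL: "x \<in> L2_on T" unfolding x by (rule solve0_in_L2_on[OF T0])
    have "x = K (g - matrix_L2 A x, c)" by (rule K(4)[OF xL]) (simp add: x(1)[symmetric])
    moreover have "(g - matrix_L2 A x, c) \<in> Z_space T"
      using x(2) xL by (simp add: Z_space_def subspace_diff[OF subspace_L2_on] matrix_in_L2_on)
    ultimately show "x \<in> K ` Z_space T" by blast
  next
    fix x assume "x \<in> K ` Z_space T"
    then obtain z where z: "x = K z" "fst z \<in> L2_on T" by (auto simp: Z_space_def)
    have "matrix_L2 A (K z) + fst z \<in> L2_on T"
      using z K(2) by (simp add: subspace_add[OF subspace_L2_on] matrix_in_L2_on)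
    then show "x \<in> H1_on T" unfolding z(1) H1_on_eq[OF T] by (subst K(3)) blast
  qed
  have opA: "op_A T A (K z) = z" if z: "z \<in> Z_space T" for z
  proof -
    have zL: "fst z \<in> L2_on T" using z by (auto simp: Z_space_def)
    have g: "matrix_L2 A (K z) + fst z \<in> L2_on T"
      using zL K(2) by (simp add: subspace_add[OF subspace_L2_on] matrix_in_L2_on)
    have "deriv_H1 T (K z) = matrix_L2 A (K z) + fst z"
      by (subst K(3)) (rule deriv_solve0[OF T0 g])
    moreover have "eval_H1 T (K z) 0 = snd z" by (subst K(3)) (rule eval_solve0[OF T])
    ultimately show ?thesis by (simp add: op_A_def)
  qed
  show ?thesis
  proof (rule that[of "\<lambda>z. K (P z)" "\<lambda>y. P (K' y)"])
    show "bounded_linear (\<lambda>z. K (P z))" "bounded_linear (\<lambda>y. P (K' y))"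
      by (intro bounded_linear_compose[OF K(1) P] bounded_linear_compose[OF P K'(1)])+
    show "K (P z) \<bullet> y = z \<bullet> P (K' y)" for z y by (simp add: K' P_sym)
    show "H1_on T = (\<lambda>z. K (P z)) ` Z_space T" unfolding H1 by (intro image_cong) (simp_all add: P_id)
    show "op_A T A (K (P z)) = z" if "z \<in> Z_space T" for z using that by (simp add: P_id opA)
    show "y = 0" if y: "y \<in> L2_on T" "P (K' y) = 0" for y
    proof (rule solve0_dense[OF T y(1)])
      fix g :: "(real^'n) L2" and c assume "g \<in> L2_on T"
      then have "solve0 T (g, c) \<in> solve0 T ` (L2_on T \<times> UNIV)" by (intro imageI) simp
      also have "\<dots> = K ` Z_space T" unfolding H1[symmetric] by (rule H1_on_eq[OF T, symmetric])
      finally obtain z where "z \<in> Z_space T" "solve0 T (g, c) = K z" by (elim imageE)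
      then have z: "solve0 T (g, c) = K (P z)" by (simp add: P_id)
      have "K (P z) \<bullet> y = z \<bullet> P (K' y)" by (simp add: K' P_sym)
      then show "solve0 T (g, c) \<bullet> y = 0" by (simp add: z y(2))
    qed
  qed (rule K(2) PZ)+
qed

section \<open>The bounded inverse of the operator J\<close>

lemma subspace_Z: "subspace (Z_space T)"
  unfolding Z_space_def by (intro subspace_Times subspace_L2_on subspace_UNIV)

lemma subspace_W: "subspace (W_space T)"
  unfolding W_space_def by (intro subspace_Times subspace_L2_on subspace_Z)

lemma closed_W: "closed (W_space T)"
  unfolding W_space_def Z_space_def by (intro closed_Times closed_L2_on closed_UNIV)

text \<open>\<open>J (x, p) = (f, g)\<close> decouples into \<open>A x = g\<close> and
  \<open>A\<^sup>* p = - f\<close>, solved by \<open>x = K g\<close> and \<open>p = - K' f\<close>,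
  where \<open>K'\<close> inverts the adjoint of \<open>A\<close>. The crossing of the components
  together with the sign makes this inverse skew.\<close>

lemma op_J_inverse:
  fixes A :: "real^'n::finite^'n"
  assumes T: "0 < T"
  obtains K K' where "bounded_linear K" "bounded_linear K'"
    "\<And>z. K z \<in> L2_on T" "\<And>y. K' y \<in> Z_space T" "\<And>z y. K z \<bullet> y = z \<bullet> K' y"
    "skew_inverse (\<lambda>(f, g). (K g, - K' f)) (W_space T)"
    "dom_J T A = (\<lambda>(f, g). (K g, - K' f)) ` W_space T"
    "\<And>w. w \<in> W_space T \<Longrightarrow> op_J T A (case w of (f, g) \<Rightarrow> (K g, - K' f)) = w"
proof -
  obtain K K' where K: "bounded_linear K" "bounded_linear K'"
    "\<And>z. K z \<in> L2_on T" "\<And>y. K' y \<in> Z_space T" "\<And>z y. K z \<bullet> y = z \<bullet> K' y"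
    "H1_on T = K ` Z_space T" "\<And>z. z \<in> Z_space T \<Longrightarrow> op_A T A (K z) = z"
    "\<And>y. y \<in> L2_on T \<Longrightarrow> K' y = 0 \<Longrightarrow> y = 0"
    by (rule solution_operator_inverse[OF T, of A], rule that, assumption+)
  interpret K: bounded_linear K by (rule K)
  interpret K': bounded_linear K' by (rule K)
  define G where "G = (\<lambda>(f, g). (K g, - K' f))"
  have G_eq: "G w = (K (snd w), - K' (fst w))" for w by (simp add: G_def split_beta)
  have G: "bounded_linear G"
    unfolding G_eq[abs_def]
    by (intro bounded_linear_Pair bounded_linear_minus bounded_linear_compose[OF K(1)]
        bounded_linear_compose[OF K(2)] bounded_linear_fst bounded_linear_snd)
  have "skew_inverse G (W_space T)"
  proof (rule skew_inverse.intro)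
    show "G w \<bullet> v = - (w \<bullet> G v)" for w v
      using K(5)[of "snd w" "fst v"] K(5)[of "snd v" "fst w"] by (simp add: G_eq inner_prod_def inner_commute)
    show "G w \<in> W_space T" for w
      using K(3,4) by (simp add: G_eq W_space_def subspace_neg[OF subspace_Z])
    show "w = 0" if w: "w \<in> W_space T" "G w = 0" for w
    proof -
      have Z: "snd w \<in> Z_space T" "0 \<in> Z_space T" and L: "fst w \<in> L2_on T"
        using w(1) by (auto simp: W_space_def subspace_0[OF subspace_Z])
      have eqs: "K (snd w) = K 0" "K' (fst w) = 0" 
        using arg_cong[OF w(2), of fst] arg_cong[OF w(2), of snd] by (simp_all add: G_eq K.zero)
      have "snd w = 0" using K(7)[OF Z(1)] K(7)[OF Z(2)] by (simp add: eqs(1))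
      moreover have "fst w = 0" using K(8)[OF L eqs(2)] .
      ultimately show ?thesis by (simp add: prod_eq_iff)
    qed
  qed (rule subspace_W closed_W G)+
  \<comment> \<open>The graph of the adjoint of \<open>op_A\<close> is the inverse graph of
    \<open>K'\<close>. The test element \<open>K (z - K' y)\<close> turns the adjoint relation into
    a vanishing norm.\<close>
  moreover have rel: "(\<forall>x\<in>H1_on T. op_A T A x \<bullet> z = x \<bullet> y) \<longleftrightarrow> z = K' y" if z: "z \<in> Z_space T" for z y
  proof
    assume *: "\<forall>x\<in>H1_on T. op_A T A x \<bullet> z = x \<bullet> y"
    have d: "z - K' y \<in> Z_space T" using z K(4) by (simp add: subspace_diff[OF subspace_Z])
    then have "op_A T A (K (z - K' y)) \<bullet> z = K (z - K' y) \<bullet> y" using * by (simp add: K(6))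
    then have "(z - K' y) \<bullet> (z - K' y) = 0" by (simp add: K(7)[OF d] K(5) inner_diff_right)
    then show "z = K' y" by simp
  next
    assume "z = K' y"
    then show "\<forall>x\<in>H1_on T. op_A T A x \<bullet> z = x \<bullet> y" by (auto simp: K(5,6,7))
  qed
  have dom: "dom_A_adj T A = K' ` L2_on T"
  proof (intro set_eqI iffI)
    fix z assume "z \<in> dom_A_adj T A"
    then obtain y where "z \<in> Z_space T" "y \<in> L2_on T" "\<forall>x\<in>H1_on T. op_A T A x \<bullet> z = x \<bullet> y"
      by (auto simp: dom_A_adj_def adjoint_domain_def)
    then show "z \<in> K' ` L2_on T" using rel[of z y] by blast
  next
    fix z assume "z \<in> K' ` L2_on T"
    then obtain y where y: "z = K' y" "y \<in> L2_on T" by blast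
    then show "z \<in> dom_A_adj T A"
      unfolding dom_A_adj_def adjoint_domain_def using rel[OF K(4), of y y] K(4)[of y] by blast
  qed
  have adj: "op_A_adj T A (K' y) = y" if y: "y \<in> L2_on T" for y
    unfolding op_A_adj_def adjoint_operator_def rel[OF K(4)]
  proof (rule the_equality)
    fix x assume x: "x \<in> L2_on T \<and> K' y = K' x"
    then have "K' (x - y) = 0" by (simp add: K'.diff)
    then have "x - y = 0" using x y by (intro K(8)) (auto simp: subspace_diff[OF subspace_L2_on])
    then show "x = y" by simp
  qed (use y in simp)
  have "dom_J T A = G ` W_space T"
  proof (intro set_eqI iffI)
    fix w assume "w \<in> dom_J T A"
    then obtain g f where w: "w = (K g, K' f)" "g \<in> Z_space T" "f \<in> L2_on T"
      by (auto simp: dom_J_def dom K(6))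
    then have "w = G (- f, g)" "(- f, g) \<in> W_space T"
      by (auto simp: G_def K'.neg W_space_def subspace_neg[OF subspace_L2_on])
    then show "w \<in> G ` W_space T" by blast
  next
    fix w assume "w \<in> G ` W_space T"
    then obtain f g where w: "w = (K g, - K' f)" "f \<in> L2_on T" "g \<in> Z_space T"
      by (auto simp: G_def W_space_def)
    then have "w = (K g, K' (- f))" "- f \<in> L2_on T"
      by (auto simp: K'.neg subspace_neg[OF subspace_L2_on])
    then show "w \<in> dom_J T A" using w(3) by (auto simp: dom_J_def dom K(6))
  qed
  moreover have "op_J T A (G w) = w" if w: "w \<in> W_space T" for w
  proof -
    have wL: "fst w \<in> L2_on T" "snd w \<in> Z_space T" using w by (auto simp: W_space_def)
    have "op_A_adj T A (- K' (fst w)) = - fst w"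
      using adj[of "- fst w"] subspace_neg[OF subspace_L2_on wL(1)] by (simp add: K'.neg)
    then show ?thesis by (simp add: op_J_def G_eq K(7)[OF wL(2)])
  qed
  ultimately show ?thesis unfolding G_def by (intro that[OF K(1-5)]) auto
qed

section \<open>Gradients and projections\<close>

text \<open>Gradients are taken within \<open>X\<close>; restriction to lines in \<open>X\<close>
  reduces statements about them to real derivatives.\<close>

lemma has_gradient_on_line:
  assumes X: "subspace X" and x: "x \<in> X" "h \<in> X" and g: "has_gradient_on X f g (x + s *\<^sub>R h)"
  shows "((\<lambda>s. f (x + s *\<^sub>R h)) has_real_derivative g \<bullet> h) (at s)"
proof -
  have d: "(f has_derivative (\<lambda>h. g \<bullet> h)) (at (x + s *\<^sub>R h) within X)"
    using g by (simp add: has_gradient_on_def)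
  have in_X: "range (\<lambda>s. x + s *\<^sub>R h) \<subseteq> X" using X x by (auto simp: subspace_add subspace_scale)
  have l: "((\<lambda>s. x + s *\<^sub>R h) has_derivative (\<lambda>r. r *\<^sub>R h)) (at s)"
    by (auto intro!: derivative_eq_intros)
  have "(f has_derivative (\<lambda>h. g \<bullet> h)) (at (x + s *\<^sub>R h) within range (\<lambda>s. x + s *\<^sub>R h))"
    by (rule has_derivative_subset[OF d in_X])
  from has_derivative_in_compose[OF l this]
  have "((\<lambda>s. f (x + s *\<^sub>R h)) has_derivative (\<lambda>r. g \<bullet> (r *\<^sub>R h))) (at s)" .
  then show ?thesis by (simp add: has_field_derivative_def mult.commute[of _ "g \<bullet> h"] fun_eq_iff)
qed

lemma has_gradient_on_unique:
  assumes X: "subspace X" and x: "x \<in> X" and g: "has_gradient_on X f g x" "has_gradient_on X f g' x"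
  shows "g = g'"
proof -
  have d: "g - g' \<in> X" using g X by (auto simp: has_gradient_on_def subspace_diff)
  have "((\<lambda>s. f (x + s *\<^sub>R (g - g'))) has_real_derivative u \<bullet> (g - g')) (at 0)"
    if "has_gradient_on X f u x" for u
    using has_gradient_on_line[OF X x d, of f u 0] that by simp
  from DERIV_unique[OF this[OF g(1)] this[OF g(2)]]
  have "(g - g') \<bullet> (g - g') = 0" by (simp add: inner_diff_left)
  then show ?thesis by simp
qed

lemma gradient_on_eqI:
  assumes "subspace X" "x \<in> X" "has_gradient_on X f g x"
  shows "gradient_on X f x = g"
  unfolding gradient_on_def using assms has_gradient_on_unique by blast

lemma has_gradient_on_half_norm_sq: "z \<in> X \<Longrightarrow> has_gradient_on X half_norm_sq z z"
  unfolding has_gradient_on_def half_norm_sq_def power2_norm_eq_inner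
  by (auto intro!: derivative_eq_intros simp: inner_commute)

lemma strongly_convex_half_norm_sq:
  fixes X :: "'a::real_inner set"
  assumes "convex X"
  shows "strongly_convex_on 1 X half_norm_sq"
proof -
  have "half_norm_sq ((1 - s) *\<^sub>R x + s *\<^sub>R y)
      = (1 - s) * half_norm_sq x + s * half_norm_sq y - 1 / 2 * s * (1 - s) * (norm (x - y))\<^sup>2" for x y :: 'a and s
    unfolding half_norm_sq_def power2_norm_eq_inner
    by (simp add: algebra_simps inner_commute) (simp add: field_simps inner_commute)
  then show ?thesis using assms by (simp add: strongly_convex_on_def)
qed

lemma gradient_at_minimum:
  assumes X: "subspace X" and x: "x \<in> X" and g: "has_gradient_on X f g x"
    and min: "\<And>y. y \<in> X \<Longrightarrow> f x \<le> f y"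
  shows "g = 0"
proof -
  have gX: "g \<in> X" using g by (simp add: has_gradient_on_def)
  have "((\<lambda>s. f (x + s *\<^sub>R g)) has_real_derivative g \<bullet> g) (at 0)"
    using has_gradient_on_line[OF X x gX, of f g 0] g by simp
  then have "g \<bullet> g = 0"
    by (rule DERIV_local_min[of _ _ _ 1]) (use X x gX in \<open>auto intro!: min simp: subspace_add subspace_scale\<close>)
  then show ?thesis by simp
qed

text \<open>The upper bound on the monotonicity quotient gives the descent inequality; comparing a gradient
  step with the minimum of \<open>f - g x \<bullet> _\<close>, attained at \<open>x\<close>, yields cocoercivity of the gradient.\<close>

lemma gradient_lipschitz:
  fixes f :: "'a::real_inner \<Rightarrow> real"
  assumes X: "subspace X" and L: "L > 0"
    and g: "\<And>x. x \<in> X \<Longrightarrow> has_gradient_on X f (g x) x"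
    and mono: "\<And>x y. x \<in> X \<Longrightarrow> y \<in> X \<Longrightarrow> 0 \<le> (g x - g y) \<bullet> (x - y)"
    and upper: "\<And>x y. x \<in> X \<Longrightarrow> y \<in> X \<Longrightarrow> (g x - g y) \<bullet> (x - y) \<le> L * (norm (x - y))\<^sup>2"
    and xy: "x \<in> X" "y \<in> X"
  shows "norm (g x - g y) \<le> L * norm (x - y)"
proof -
  have gX: "g x \<in> X" if "x \<in> X" for x using g[OF that] by (simp add: has_gradient_on_def)
  \<comment> \<open>The term with \<open>k\<close> lets one auxiliary function serve twice:
    \<open>k = L * (norm h)\<^sup>2\<close> gives the descent inequality, \<open>k = 0\<close>
    convexity.\<close>
  have deriv: "((\<lambda>s. f (x + s *\<^sub>R h) - s * (g x \<bullet> h) - k * s\<^sup>2 / 2)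
      has_real_derivative (g (x + s *\<^sub>R h) - g x) \<bullet> h - k * s) (at s)"
    if "x \<in> X" "h \<in> X" for x h s k
    using has_gradient_on_line[OF X that g, of s] that X
    by (auto intro!: derivative_eq_intros simp: subspace_add subspace_scale inner_diff_left)
  have slope: "s * ((g (x + s *\<^sub>R h) - g x) \<bullet> h) = (g (x + s *\<^sub>R h) - g x) \<bullet> ((x + s *\<^sub>R h) - x)" for x h s
    by simp
  have descent: "f (x + h) \<le> f x + g x \<bullet> h + L * (norm h)\<^sup>2 / 2" if xh: "x \<in> X" "h \<in> X" for x h
  proof -
    have "f (x + 1 *\<^sub>R h) - 1 * (g x \<bullet> h) - (L * (norm h)\<^sup>2) * 1\<^sup>2 / 2
        \<le> f (x + 0 *\<^sub>R h) - 0 * (g x \<bullet> h) - (L * (norm h)\<^sup>2) * 0\<^sup>2 / 2"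
    proof (rule DERIV_nonpos_imp_decreasing_open[where f = "\<lambda>s. f (x + s *\<^sub>R h) - s * (g x \<bullet> h) - (L * (norm h)\<^sup>2) * s\<^sup>2 / 2"])
      show "continuous_on {0..1} (\<lambda>s. f (x + s *\<^sub>R h) - s * (g x \<bullet> h) - (L * (norm h)\<^sup>2) * s\<^sup>2 / 2)"
        by (intro continuous_at_imp_continuous_on ballI DERIV_isCont[OF deriv] xh)
      fix s :: real assume s: "0 < s" "s < 1"
      have in_X: "x + s *\<^sub>R h \<in> X" using xh X by (simp add: subspace_add subspace_scale)
      have "s * ((g (x + s *\<^sub>R h) - g x) \<bullet> h) \<le> L * (norm (x + s *\<^sub>R h - x))\<^sup>2"
        unfolding slope by (rule upper[OF in_X xh(1)])
      also have "\<dots> = s * (L * (norm h)\<^sup>2 * s)" by (simp add: power_mult_distrib power2_eq_square)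
      finally have "(g (x + s *\<^sub>R h) - g x) \<bullet> h - L * (norm h)\<^sup>2 * s \<le> 0" using s by simp
      then show "\<exists>y. ((\<lambda>s. f (x + s *\<^sub>R h) - s * (g x \<bullet> h) - (L * (norm h)\<^sup>2) * s\<^sup>2 / 2) has_real_derivative y) (at s) \<and> y \<le> 0"
        using deriv[OF xh] by blast
    qed simp
    then show ?thesis by simp
  qed
  have convex: "f x + g x \<bullet> h \<le> f (x + h)" if xh: "x \<in> X" "h \<in> X" for x h
  proof -
    have "f (x + 0 *\<^sub>R h) - 0 * (g x \<bullet> h) - 0 * 0\<^sup>2 / 2 \<le> f (x + 1 *\<^sub>R h) - 1 * (g x \<bullet> h) - 0 * 1\<^sup>2 / 2"
    proof (rule DERIV_nonneg_imp_increasing_open[where f = "\<lambda>s. f (x + s *\<^sub>R h) - s * (g x \<bullet> h) - 0 * s\<^sup>2 / 2"])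
      show "continuous_on {0..1} (\<lambda>s. f (x + s *\<^sub>R h) - s * (g x \<bullet> h) - 0 * s\<^sup>2 / 2)"
        by (intro continuous_at_imp_continuous_on ballI DERIV_isCont[OF deriv] xh)
      fix s :: real assume s: "0 < s" "s < 1"
      have in_X: "x + s *\<^sub>R h \<in> X" using xh X by (simp add: subspace_add subspace_scale)
      have "0 \<le> s * ((g (x + s *\<^sub>R h) - g x) \<bullet> h)"
        unfolding slope by (rule mono[OF in_X xh(1)])
      then have "0 \<le> (g (x + s *\<^sub>R h) - g x) \<bullet> h - 0 * s" using s by (simp add: zero_le_mult_iff)
      then show "\<exists>y. ((\<lambda>s. f (x + s *\<^sub>R h) - s * (g x \<bullet> h) - 0 * s\<^sup>2 / 2) has_real_derivative y) (at s) \<and> 0 \<le> y"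
        using deriv[OF xh] by blast
    qed simp
    then show ?thesis by simp
  qed
  have coco: "(norm (g y - g x))\<^sup>2 / (2 * L) \<le> f y - f x - g x \<bullet> (y - x)" if xy: "x \<in> X" "y \<in> X" for x y
  proof -
    \<comment> \<open>At \<open>y\<close> the function \<open>f\<close> minus the linear form of
      \<open>g x\<close> has gradient \<open>e\<close>. The step \<open>h\<close> minimises its
      quadratic upper bound and gains \<open>(norm e)\<^sup>2 / (2 * L)\<close>.\<close>
    define e where "e = g y - g x"
    define h where "h = - (1 / L) *\<^sub>R e"
    have hX: "h \<in> X" using xy gX X by (simp add: h_def e_def subspace_scale subspace_diff subspace_neg)
    have "f x + g x \<bullet> (y + h - x) \<le> f (x + (y + h - x))"
      using xy hX X by (intro convex) (auto simp: subspace_add subspace_diff)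
    also have "\<dots> = f (y + h)" by simp
    also have "\<dots> \<le> f y + g y \<bullet> h + L * (norm h)\<^sup>2 / 2" by (rule descent[OF xy(2) hX])
    finally have "- (e \<bullet> h) - L * (norm h)\<^sup>2 / 2 \<le> f y - f x - g x \<bullet> (y - x)"
      by (simp add: e_def inner_diff_left inner_diff_right inner_add_right)
    moreover have "e \<bullet> h = - (norm e)\<^sup>2 / L" by (simp add: h_def power2_norm_eq_inner)
    moreover have "L * (norm h)\<^sup>2 / 2 = (norm e)\<^sup>2 / (2 * L)"
      using L by (simp add: h_def power_mult_distrib power2_eq_square field_simps)
    ultimately show ?thesis using L by (simp add: e_def field_simps)
  qed
  \<comment> \<open>The estimate is used in both orders, so that the values of \<open>f\<close>
    cancel in the sum.\<close>
  have "(norm (g x - g y))\<^sup>2 / L = (norm (g y - g x))\<^sup>2 / (2 * L) + (norm (g x - g y))\<^sup>2 / (2 * L)"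
    using L by (simp add: norm_minus_commute field_simps)
  also have "\<dots> \<le> (f y - f x - g x \<bullet> (y - x)) + (f x - f y - g y \<bullet> (x - y))"
    by (intro add_mono coco xy)
  also have "\<dots> = (g x - g y) \<bullet> (x - y)" by (simp add: algebra_simps)
  also have "\<dots> \<le> norm (g x - g y) * norm (x - y)" by (rule norm_cauchy_schwarz)
  finally have "norm (g x - g y) * norm (g x - g y) \<le> norm (g x - g y) * (L * norm (x - y))"
    using L by (simp add: power2_eq_square field_simps)
  then show ?thesis using L
    by (cases "norm (g x - g y) = 0") (auto simp: mult_le_cancel_left)
qed

text \<open>The variational inequality gives \<open>(norm (u - z))\<^sup>2 \<ge> (norm (u -
  v))\<^sup>2 + (norm (z - v))\<^sup>2\<close> on \<open>F\<close>, so \<open>v\<close> is the only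
  minimiser, as the definite description requires.\<close>

lemma projection_onto_eqI:
  assumes v: "v \<in> F" and vi: "\<And>z. z \<in> F \<Longrightarrow> (u - v) \<bullet> (z - v) \<le> 0"
  shows "projection_onto F u = v"
proof -
  have key: "(norm (u - z))\<^sup>2 \<ge> (norm (u - v))\<^sup>2 + (norm (z - v))\<^sup>2" if "z \<in> F" for z
    using vi[OF that] unfolding power2_norm_eq_inner
    by (simp add: inner_diff_left inner_diff_right inner_commute)
  show ?thesis
    unfolding projection_onto_def
  proof (rule the_equality)
    show "v \<in> F \<and> (\<forall>z\<in>F. dist u v \<le> dist u z)"
    proof (intro conjI ballI v)
      fix z assume "z \<in> F"
      then have "(norm (u - v))\<^sup>2 \<le> (norm (u - z))\<^sup>2" using key[of z] zero_le_power2[of "norm (z - v)"] by linarith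
      then show "dist u v \<le> dist u z" by (simp add: dist_norm)
    qed
    fix w assume w: "w \<in> F \<and> (\<forall>z\<in>F. dist u w \<le> dist u z)"
    then have "norm (u - w) \<le> norm (u - v)" using v by (simp add: dist_norm)
    then have "(norm (u - w))\<^sup>2 \<le> (norm (u - v))\<^sup>2" by (rule power_mono) simp
    then have "(norm (w - v))\<^sup>2 \<le> 0" using key[of w] w by linarith
    then show "w = v" by simp
  qed
qed

definition clip :: "real^'m::finite \<Rightarrow> real^'m \<Rightarrow> real^'m \<Rightarrow> real^'m" where
  "clip lo hi v = (\<chi> i. max (lo $ i) (min (hi $ i) (v $ i)))"

lemma clip_variational:
  assumes z: "\<And>i. lo $ i \<le> z $ i \<and> z $ i \<le> hi $ i"
  shows "(v - clip lo hi v) \<bullet> (z - clip lo hi v) \<le> 0"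
proof -
  have "(v $ i - max (lo $ i) (min (hi $ i) (v $ i))) * (z $ i - max (lo $ i) (min (hi $ i) (v $ i))) \<le> 0" for i
    using z[of i] by (auto simp: max_def min_def mult_le_0_iff)
  then show ?thesis by (auto simp: inner_vec_def clip_def intro!: sum_nonpos)
qed

text \<open>The projection is pointwise clipping on \<open>[0, T]\<close>, extended by zero. The
  variational inequality holds pointwise and is then integrated; off \<open>[0, T]\<close> both
  \<open>z\<close> and the projection vanish.\<close>

lemma box_projection:
  assumes T: "0 \<le> T" and box: "\<And>i. lo $ i \<le> hi $ i"
  shows "projection_onto (box_controls T lo hi) u \<in> box_controls T lo hi"
    "z \<in> box_controls T lo hi \<Longrightarrow>
      (u - projection_onto (box_controls T lo hi) u) \<bullet> (z - projection_onto (box_controls T lo hi) u) \<le> 0"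
proof -
  define f where "f t = indicat_real {0..T} t *\<^sub>R clip lo hi (rep_L2 u t)" for t
  have "continuous_on UNIV (clip lo hi)" unfolding clip_def[abs_def] by (intro continuous_intros)
  then have [measurable]: "clip lo hi \<in> borel_measurable borel" by (rule borel_measurable_continuous_onI)
  have bound: "norm (clip lo hi v) \<le> norm lo + norm hi" for v
  proof -
    have "norm (clip lo hi v) \<le> norm ((\<chi> i. \<bar>lo $ i\<bar>) + (\<chi> i. \<bar>hi $ i\<bar>))"
    proof (rule norm_le_componentwise_cart)
      show "norm (clip lo hi v $ i) \<le> norm (((\<chi> i. \<bar>lo $ i\<bar>) + (\<chi> i. \<bar>hi $ i\<bar>)) $ i)" for i
        by (auto simp: clip_def)
    qed
    also have "\<dots> \<le> norm (\<chi> i. \<bar>lo $ i\<bar>) + norm (\<chi> i. \<bar>hi $ i\<bar>)" by (rule norm_triangle_ineq)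
    also have "\<dots> = norm lo + norm hi" by (simp add: norm_vec_def)
    finally show ?thesis .
  qed
  have f: "square_integrable f"
  proof (rule bounded_on_interval_square_integrable(1)[OF _ T, where B = "norm lo + norm hi"])
    show "f \<in> borel_measurable lborel" unfolding f_def[abs_def] by measurable
  qed (use bound in \<open>auto simp: f_def\<close>)
  define v where "v = abs_L2 f"
  have vF: "v \<in> box_controls T lo hi"
    unfolding box_controls_def
  proof (intro CollectI conjI)
    show "v \<in> L2_on T" unfolding v_def by (rule abs_in_L2_on[OF f]) (simp add: f_def)
    show "AE t in lborel. t \<in> {0..T} \<longrightarrow> (\<forall>i. lo $ i \<le> rep_L2 v t $ i \<and> rep_L2 v t $ i \<le> hi $ i)"
      using rep_abs[OF f] unfolding v_def
      by eventually_elim (use box in \<open>auto simp: f_def clip_def\<close>)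
  qed
  have vi: "(u - v) \<bullet> (z - v) \<le> 0" if z: "z \<in> box_controls T lo hi" for z
  proof -
    have zL: "z \<in> L2_on T" and zb: "AE t in lborel. t \<in> {0..T} \<longrightarrow> (\<forall>i. lo $ i \<le> rep_L2 z t $ i \<and> rep_L2 z t $ i \<le> hi $ i)"
      using z by (auto simp: box_controls_def)
    have "AE t in lborel. 0 \<le> - (rep_L2 (u - v) t \<bullet> rep_L2 (z - v) t)"
      using rep_abs[OF f, folded v_def] rep_arith(2)[of u v] rep_arith(2)[of z v] L2_on_outside[OF zL] zb
    proof eventually_elim
      case (elim t)
      show ?case
      proof (cases "t \<in> {0..T}")
        case True
        then have "rep_L2 v t = clip lo hi (rep_L2 u t)" using elim by (simp add: f_def)
        then show ?thesis using clip_variational[of lo "rep_L2 z t" hi "rep_L2 u t"] elim True by simp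
      next
        case False
        then show ?thesis using elim by (simp add: f_def)
      qed
    qed
    then have "0 \<le> (LINT t|lborel. - (rep_L2 (u - v) t \<bullet> rep_L2 (z - v) t))" by (rule integral_nonneg_AE)
    then show ?thesis by (simp add: inner_L2_eq)
  qed
  have eq: "projection_onto (box_controls T lo hi) u = v" by (rule projection_onto_eqI[OF vF vi])
  show "projection_onto (box_controls T lo hi) u \<in> box_controls T lo hi" using vF by (simp add: eq)
  show "z \<in> box_controls T lo hi \<Longrightarrow>
      (u - projection_onto (box_controls T lo hi) u) \<bullet> (z - projection_onto (box_controls T lo hi) u) \<le> 0"
    using vi by (simp add: eq)
qed

section \<open>The primal-dual gradient dynamics\<close>

locale optimal_control =
  fixes tf \<alpha> \<mu> L :: real
    and A :: "real^'n::finite^'n" and B :: "real^'m::finite^'n"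
    and ulo uhi :: "real^'m"
    and l :: "real^'n \<Rightarrow> real"
    and gradJ :: "(real^'n) L2 \<Rightarrow> (real^'n) L2"
    and x0 :: "real^'n"
  assumes tf: "tf > 0" and \<alpha>: "\<alpha> > 0"
    and box: "\<And>i. ulo $ i < 0 \<and> 0 < uhi $ i"
    and l0: "l 0 = 0" and l_nonneg: "\<And>v. l v \<ge> 0"
    and gradJ: "\<And>x. x \<in> L2_on tf \<Longrightarrow> has_gradient_on (L2_on tf) (running_cost tf l) (gradJ x) x"
    and \<mu>: "\<mu> > 0" and L: "L > 0"
    and gradJ_bounds: "\<And>x y. x \<in> L2_on tf \<Longrightarrow> y \<in> L2_on tf \<Longrightarrow>
           \<mu> * (norm (x - y))\<^sup>2 \<le> (gradJ x - gradJ y) \<bullet> (x - y) \<and>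
           (gradJ x - gradJ y) \<bullet> (x - y) \<le> L * (norm (x - y))\<^sup>2"
begin

abbreviation "W \<equiv> W_space tf"
abbreviation "R \<equiv> op_R tf B \<alpha> ulo uhi gradJ"
abbreviation "J \<equiv> op_J tf A"
abbreviation "D \<equiv> dom_J tf A"
abbreviation "F \<equiv> box_controls tf ulo uhi"
abbreviation "proj \<equiv> projection_onto F"
abbreviation "c \<equiv> (0, (0, x0)) :: (real^'n) L2 \<times> (real^'n) L2 \<times> (real^'n)"

lemma tf0: "0 \<le> tf" using tf by simp

lemma proj_in: "proj u \<in> F"
  and proj_variational: "z \<in> F \<Longrightarrow> (u - proj u) \<bullet> (z - proj u) \<le> 0"
  using box_projection[OF tf0, of ulo uhi] box less_trans less_imp_le by metis+

text \<open>The sum of the variational inequalities for \<open>u\<close> and \<open>v\<close>, each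
  tested with the other projection. This firm form is what makes the costate part of
  \<open>R\<close> monotone.\<close>

lemma proj_firm: "(norm (proj u - proj v))\<^sup>2 \<le> (proj u - proj v) \<bullet> (u - v)"
  using proj_variational[OF proj_in, of u v] proj_variational[OF proj_in, of v u]
  unfolding power2_norm_eq_inner by (simp add: inner_diff_left inner_diff_right inner_commute)

lemma proj_nonexpansive: "norm (proj u - proj v) \<le> norm (u - v)"
proof (cases "proj u = proj v")
  case False
  have "norm (proj u - proj v) * norm (proj u - proj v) \<le> norm (proj u - proj v) * norm (u - v)"
    using proj_firm[of u v] norm_cauchy_schwarz[of "proj u - proj v" "u - v"] by (simp add: power2_eq_square)
  then show ?thesis using False by (simp add: mult_le_cancel_left)
qed simp

lemma proj_L2_on: "proj u \<in> L2_on tf"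
  using proj_in by (auto simp: box_controls_def)

text \<open>Control bounds of opposite signs make 0 admissible. Hence \<open>R 0 = 0\<close>, and
  accretivity of \<open>R\<close> is its monotonicity tested against 0.\<close>

lemma zero_in_F: "0 \<in> F"
proof -
  have "AE t in lborel. t \<in> {0..tf} \<longrightarrow> (\<forall>i. ulo $ i \<le> rep_L2 (0 :: (real^'m) L2) t $ i \<and> rep_L2 (0 :: (real^'m) L2) t $ i \<le> uhi $ i)"
    using rep_arith(4)[where 'a = "real^'m"]
    by eventually_elim (use box in \<open>auto intro: less_imp_le\<close>)
  then show ?thesis by (simp add: box_controls_def subspace_0[OF subspace_L2_on])
qed

lemma proj_0: "proj 0 = 0"
  by (rule projection_onto_eqI[OF zero_in_F]) simp

text \<open>An explicit formula for the adjoint of \<open>op_B\<close>, linear on the whole type;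
  the definite description \<open>op_B_adj\<close> is identified with it on
  \<open>Z_space tf\<close>.\<close>

definition Bt :: "(real^'n) L2 \<times> (real^'n) \<Rightarrow> (real^'m) L2" where
  "Bt p = matrix_L2 (transpose B) (fst p)"

lemma bounded_linear_Bt: "bounded_linear Bt"
  unfolding Bt_def by (intro bounded_linear_compose[OF bounded_linear_matrix_L2] bounded_linear_fst)

lemma bounded_linear_op_B: "bounded_linear (op_B B)"
  unfolding op_B_def by (intro bounded_linear_Pair bounded_linear_matrix_L2 bounded_linear_zero)

lemma inner_op_B: "op_B B u \<bullet> p = u \<bullet> Bt p"
  by (simp add: op_B_def Bt_def inner_prod_def inner_matrix_L2)

lemma op_B_adj: "p \<in> Z_space tf \<Longrightarrow> op_B_adj tf B p = Bt p"
  unfolding op_B_adj_def adjoint_operator_def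
proof (rule the_equality)
  assume p: "p \<in> Z_space tf"
  have BtL: "Bt p \<in> L2_on tf" using p by (auto simp: Bt_def Z_space_def intro: matrix_in_L2_on)
  show "Bt p \<in> L2_on tf \<and> (\<forall>x\<in>L2_on tf. op_B B x \<bullet> p = x \<bullet> Bt p)" using BtL by (simp add: inner_op_B)
  fix y assume y: "y \<in> L2_on tf \<and> (\<forall>x\<in>L2_on tf. op_B B x \<bullet> p = x \<bullet> y)"
  then have "y - Bt p \<in> L2_on tf" using BtL by (simp add: subspace_diff[OF subspace_L2_on])
  then have "(y - Bt p) \<bullet> (y - Bt p) = 0" using y by (simp add: inner_op_B inner_diff_right)
  then show "y = Bt p" by simp
qed

lemma R_eq: "w \<in> W \<Longrightarrow> R w = (gradJ (fst w), op_B B (proj ((1 / \<alpha>) *\<^sub>R Bt (snd w))))"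
  by (auto simp: op_R_def W_space_def op_B_adj)

lemma gradJ_in: "x \<in> L2_on tf \<Longrightarrow> gradJ x \<in> L2_on tf"
  using gradJ by (simp add: has_gradient_on_def)

lemma gradJ_lipschitz:
  assumes "x \<in> L2_on tf" "y \<in> L2_on tf"
  shows "norm (gradJ x - gradJ y) \<le> L * norm (x - y)"
proof (rule gradient_lipschitz[OF subspace_L2_on L gradJ _ _ assms])
  show "0 \<le> (gradJ x - gradJ y) \<bullet> (x - y)" if "x \<in> L2_on tf" "y \<in> L2_on tf" for x y
    using gradJ_bounds[OF that] \<mu> by (meson mult_nonneg_nonneg less_imp_le order_trans zero_le_power2)
qed (use gradJ_bounds in auto)

text \<open>0 minimises the running cost, since \<open>l\<close> is nonnegative and vanishes at
  0.\<close>

lemma gradJ_0: "gradJ 0 = 0"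
proof (rule gradient_at_minimum[OF subspace_L2_on _ gradJ])
  show "0 \<in> L2_on tf" by (rule subspace_0[OF subspace_L2_on])
  then show "0 \<in> L2_on tf" .
  fix y :: "(real^'n) L2" assume "y \<in> L2_on tf"
  have "running_cost tf l 0 = 0"
    unfolding running_cost_def set_lebesgue_integral_def
  proof (rule integral_eq_zero_AE)
    show "AE t in lborel. indicat_real {0..tf} t *\<^sub>R l (rep_L2 0 t) = 0"
      using rep_arith(4)[where 'a = "real^'n"] by eventually_elim (simp add: l0)
  qed
  moreover have "0 \<le> running_cost tf l y"
    unfolding running_cost_def set_lebesgue_integral_def
    by (intro integral_nonneg_AE AE_I2) (simp add: l_nonneg)
  ultimately show "running_cost tf l 0 \<le> running_cost tf l y" by simp
qed

lemma R_in: "w \<in> W \<Longrightarrow> R w \<in> W"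
  using R_eq[of w] proj_L2_on by (auto simp: W_space_def Z_space_def op_B_def intro!: gradJ_in matrix_in_L2_on)

text \<open>The state component is strongly monotone. The costate component is a firmly nonexpansive
  map between \<open>Bt\<close> and its adjoint \<open>op_B B\<close>, which makes its contribution
  nonnegative.\<close>

lemma R_strongly_monotone:
  assumes w: "w \<in> W" "v \<in> W"
  shows "\<mu> * (norm (fst w - fst v))\<^sup>2 \<le> (R w - R v) \<bullet> (w - v)"
proof -
  have L2: "fst w \<in> L2_on tf" "fst v \<in> L2_on tf" using w by (auto simp: W_space_def)
  define p q where "p = proj ((1 / \<alpha>) *\<^sub>R Bt (snd w))" and "q = proj ((1 / \<alpha>) *\<^sub>R Bt (snd v))"
  have "0 \<le> (norm (p - q))\<^sup>2" by simp
  also have "\<dots> \<le> (p - q) \<bullet> ((1 / \<alpha>) *\<^sub>R Bt (snd w) - (1 / \<alpha>) *\<^sub>R Bt (snd v))"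
    unfolding p_def q_def by (rule proj_firm)
  also have "\<dots> = (1 / \<alpha>) * ((p - q) \<bullet> Bt (snd w - snd v))"
    using bounded_linear.linear[OF bounded_linear_Bt] by (simp add: linear_diff inner_diff_right right_diff_distrib)
  finally have "0 \<le> (p - q) \<bullet> Bt (snd w - snd v)" using \<alpha> by (simp add: zero_le_divide_iff)
  also have "\<dots> = (op_B B p - op_B B q) \<bullet> (snd w - snd v)"
    using bounded_linear.linear[OF bounded_linear_op_B] by (simp add: linear_diff flip: inner_op_B)
  finally show ?thesis
    using gradJ_bounds[OF L2] by (simp add: R_eq w inner_prod_def p_def q_def)
qed

lemma R_monotone: "w \<in> W \<Longrightarrow> v \<in> W \<Longrightarrow> 0 \<le> (R w - R v) \<bullet> (w - v)"
  using R_strongly_monotone[of w v] \<mu> by (meson mult_nonneg_nonneg less_imp_le order_trans zero_le_power2)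

lemma R_0: "R 0 = 0"
proof -
  have "R 0 = (0, 0)"
    using linear_0[OF bounded_linear.linear[OF bounded_linear_Bt]]
      linear_0[OF bounded_linear.linear[OF bounded_linear_op_B]]
    by (simp add: R_eq[OF subspace_0[OF subspace_W]] gradJ_0 proj_0)
  also have "\<dots> = 0" by (rule zero_prod_def[symmetric])
  finally show ?thesis .
qed

lemma R_lipschitz:
  obtains K where "\<And>w v. w \<in> W \<Longrightarrow> v \<in> W \<Longrightarrow> norm (R w - R v) \<le> K * norm (w - v)"
proof -
  obtain b where b: "b \<ge> 0" "\<And>u. norm (op_B B u) \<le> b * norm u"
    using bounded_linear_nonneg_bound[OF bounded_linear_op_B] by blast
  obtain d where d: "d \<ge> 0" "\<And>p. norm (Bt p) \<le> d * norm p"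
    using bounded_linear_nonneg_bound[OF bounded_linear_Bt] by blast
  have "norm (R w - R v) \<le> (L + b * (d / \<alpha>)) * norm (w - v)" if w: "w \<in> W" "v \<in> W" for w v
  proof -
    have L2: "fst w \<in> L2_on tf" "fst v \<in> L2_on tf" using w by (auto simp: W_space_def)
    define p q where "p = (1 / \<alpha>) *\<^sub>R Bt (snd w)" and "q = (1 / \<alpha>) *\<^sub>R Bt (snd v)"
    have f: "norm (fst w - fst v) \<le> norm (w - v)" and s: "norm (snd w - snd v) \<le> norm (w - v)"
      using norm_fst_le[of "fst (w - v)" "snd (w - v)", unfolded prod.collapse]
        norm_snd_le[of "snd (w - v)" "fst (w - v)", unfolded prod.collapse] by simp_all
    have "p - q = (1 / \<alpha>) *\<^sub>R Bt (snd w - snd v)"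
      using bounded_linear.linear[OF bounded_linear_Bt] by (simp add: p_def q_def linear_diff scaleR_diff_right)
    then have "norm (p - q) = norm (Bt (snd w - snd v)) / \<alpha>" using \<alpha> by simp
    also have "\<dots> \<le> d * norm (w - v) / \<alpha>"
      using \<alpha> d s by (intro divide_right_mono order_trans[OF d(2)] mult_left_mono) auto
    finally have pq: "norm (p - q) \<le> d / \<alpha> * norm (w - v)" by simp
    have "norm (op_B B (proj p) - op_B B (proj q)) \<le> b * norm (proj p - proj q)"
      using b(2)[of "proj p - proj q"] bounded_linear.linear[OF bounded_linear_op_B] by (simp add: linear_diff)
    also have "\<dots> \<le> b * (d / \<alpha> * norm (w - v))"
      using b pq by (intro mult_left_mono order_trans[OF proj_nonexpansive]) auto
    finally have 2: "norm (op_B B (proj p) - op_B B (proj q)) \<le> b * (d / \<alpha>) * norm (w - v)" by (simp add: mult.assoc)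
    have 1: "norm (gradJ (fst w) - gradJ (fst v)) \<le> L * norm (w - v)"
      using L f by (intro order_trans[OF gradJ_lipschitz[OF L2]] mult_left_mono) auto
    have "norm (R w - R v) \<le> norm (gradJ (fst w) - gradJ (fst v)) + norm (op_B B (proj p) - op_B B (proj q))"
      using norm_Pair_le[of "gradJ (fst w) - gradJ (fst v)" "op_B B (proj p) - op_B B (proj q)"]
      by (simp add: R_eq w p_def q_def)
    also have "\<dots> \<le> (L + b * (d / \<alpha>)) * norm (w - v)" using 1 2 by (simp add: distrib_right)
    finally show ?thesis .
  qed
  then show ?thesis by (rule that)
qed

section \<open>Existence and uniqueness of the steady state\<close>

lemma c_in: "c \<in> W"
  by (simp add: W_space_def Z_space_def subspace_0[OF subspace_L2_on])

lemma steady_state_exists: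
  "\<exists>w\<in>D. J w - R w - c = 0"
proof -
  obtain K K' where K: "bounded_linear K" "bounded_linear K'"
    "\<And>z. K z \<in> L2_on tf" "\<And>y. K' y \<in> Z_space tf" "\<And>z y. K z \<bullet> y = z \<bullet> K' y"
    "skew_inverse (\<lambda>(f, g). (K g, - K' f)) W"
    "D = (\<lambda>(f, g). (K g, - K' f)) ` W"
    "\<And>w. w \<in> W \<Longrightarrow> J (case w of (f, g) \<Rightarrow> (K g, - K' f)) = w"
    by (rule op_J_inverse[OF tf, of A], rule that, assumption+)
  define X where "X u = K (op_B B u + (0, x0))" for u
  have KB: "bounded_linear (\<lambda>u. K (op_B B u))" by (rule bounded_linear_compose[OF K(1) bounded_linear_op_B])
  have BK: "bounded_linear (\<lambda>y. Bt (K' y))" by (rule bounded_linear_compose[OF bounded_linear_Bt K(2)])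
  obtain a where a: "a \<ge> 0" "\<And>u. norm (K (op_B B u)) \<le> a * norm u" using bounded_linear_nonneg_bound[OF KB] by blast
  obtain b where b: "b \<ge> 0" "\<And>y. norm (Bt (K' y)) \<le> b * norm y" using bounded_linear_nonneg_bound[OF BK] by blast
  note lin = linear_diff[OF bounded_linear.linear[OF K(1)]] linear_diff[OF bounded_linear.linear[OF KB]]
    linear_diff[OF bounded_linear.linear[OF bounded_linear_op_B]] linear_diff[OF bounded_linear.linear[OF BK]]
  have X_diff: "X u - X v = K (op_B B (u - v))" for u v
    by (simp add: X_def lin(3) flip: lin(1))
  have XL: "X u \<in> L2_on tf" for u by (simp add: X_def K)
  \<comment> \<open>The gradient of the reduced objective: the running cost of \<open>X u\<close>
    plus \<open>\<alpha> / 2\<close> times the squared norm of \<open>u\<close>. The adjoint of the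
    linear part of \<open>X\<close> is \<open>Bt\<close> after \<open>K'\<close>, so monotonicity of
    \<open>gradJ\<close> passes to its term in \<open>N\<close>, and
    \<open>\<alpha> *\<^sub>R u\<close> makes \<open>N\<close> strongly monotone.\<close>
  define N where "N u = \<alpha> *\<^sub>R u + Bt (K' (gradJ (X u)))" for u
  have N_diff: "N u - N v = \<alpha> *\<^sub>R (u - v) + Bt (K' (gradJ (X u) - gradJ (X v)))" for u v
    by (simp add: N_def lin(4) scaleR_diff_right)
  have "\<exists>\<tau>>0. \<exists>u. proj (u - \<tau> *\<^sub>R N u) = u"
  proof (rule strongly_monotone_projected_fixpoint[OF \<alpha>, where L = "\<alpha> + b * (L * a)"])
    fix u v
    have "Bt (K' (gradJ (X u) - gradJ (X v))) \<bullet> (u - v) = (gradJ (X u) - gradJ (X v)) \<bullet> (X u - X v)"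
      unfolding X_diff by (metis K(5) inner_commute inner_op_B)
    moreover have "0 \<le> \<mu> * (norm (X u - X v))\<^sup>2" using \<mu> by simp
    ultimately have "0 \<le> Bt (K' (gradJ (X u) - gradJ (X v))) \<bullet> (u - v)" using gradJ_bounds[OF XL XL, of u v] by linarith
    then show "\<alpha> * (norm (u - v))\<^sup>2 \<le> (N u - N v) \<bullet> (u - v)"
      by (simp add: N_diff inner_add_left power2_norm_eq_inner)
    have "norm (N u - N v) \<le> norm (\<alpha> *\<^sub>R (u - v)) + norm (Bt (K' (gradJ (X u) - gradJ (X v))))"
      unfolding N_diff by (rule norm_triangle_ineq)
    also have "\<dots> \<le> \<alpha> * norm (u - v) + b * (L * (a * norm (u - v)))"
    proof (rule add_mono)
      have "norm (Bt (K' (gradJ (X u) - gradJ (X v)))) \<le> b * norm (gradJ (X u) - gradJ (X v))" by (rule b)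
      also have "\<dots> \<le> b * (L * norm (X u - X v))" by (intro mult_left_mono b gradJ_lipschitz XL)
      also have "\<dots> \<le> b * (L * (a * norm (u - v)))" unfolding X_diff using L b a by (intro mult_left_mono) auto
      finally show "norm (Bt (K' (gradJ (X u) - gradJ (X v)))) \<le> b * (L * (a * norm (u - v)))" .
    qed (use \<alpha> in simp)
    finally show "norm (N u - N v) \<le> (\<alpha> + b * (L * a)) * norm (u - v)" by (simp add: algebra_simps)
    show "norm (proj u - proj v) \<le> norm (u - v)" by (rule proj_nonexpansive)
  qed
  then obtain \<tau> u where \<tau>: "\<tau> > 0" and u: "proj (u - \<tau> *\<^sub>R N u) = u" by blast
  have uF: "u \<in> F" using proj_in[of "u - \<tau> *\<^sub>R N u"] by (simp add: u)
  have uL: "u \<in> L2_on tf" using uF by (simp add: box_controls_def)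
  have vi: "0 \<le> N u \<bullet> (z - u)" if "z \<in> F" for z
    using proj_variational[OF that, of "u - \<tau> *\<^sub>R N u"] \<tau> by (simp add: u zero_le_mult_iff)
  \<comment> \<open>The costate belonging to \<open>u\<close>. With it the variational inequality
    for \<open>N u\<close> becomes the one that characterises \<open>u\<close> as the projection of
    \<open>(1 / \<alpha>) *\<^sub>R Bt p\<close>.\<close>
  define p where "p = - K' (gradJ (X u))"
  have Btp: "Bt p = - Bt (K' (gradJ (X u)))"
    by (simp add: p_def linear_neg[OF bounded_linear.linear[OF bounded_linear_Bt]])
  have proj_p: "proj ((1 / \<alpha>) *\<^sub>R Bt p) = u"
  proof (rule projection_onto_eqI[OF uF])
    fix z assume z: "z \<in> F"
    have "(1 / \<alpha>) *\<^sub>R Bt p - u = - ((1 / \<alpha>) *\<^sub>R N u)"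
      using \<alpha> by (simp add: Btp N_def scaleR_add_right)
    then show "((1 / \<alpha>) *\<^sub>R Bt p - u) \<bullet> (z - u) \<le> 0" using vi[OF z] \<alpha> by simp
  qed
  \<comment> \<open>The value that \<open>J\<close> must take at the steady state, namely
    \<open>R\<close> of the steady state plus \<open>c\<close>; the inverse of \<open>J\<close> maps
    it to \<open>(X u, p)\<close>.\<close>
  define v where "v = (gradJ (X u), op_B B u + (0, x0))"
  have vW: "v \<in> W"
    using uL XL by (auto simp: v_def W_space_def Z_space_def op_B_def intro: gradJ_in matrix_in_L2_on)
  have w: "(X u, p) = (case v of (f, g) \<Rightarrow> (K g, - K' f))" by (simp add: v_def X_def p_def)
  have wD: "(X u, p) \<in> D" unfolding K(7) w using vW by blast
  have wW: "(X u, p) \<in> W"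
    unfolding p_def using XL K(4) by (simp add: W_space_def subspace_neg[OF subspace_Z])
  have "J (X u, p) = v" unfolding w by (rule K(8)[OF vW])
  moreover have "R (X u, p) = (gradJ (X u), op_B B u)" using R_eq[OF wW] by (simp add: proj_p)
  ultimately have "J (X u, p) - R (X u, p) - c = 0" by (simp add: v_def op_B_def zero_prod_def)
  with wD show ?thesis by blast
qed

text \<open>Testing the difference of the two equations with \<open>w - v\<close> removes
  \<open>J\<close> by skewness, and strong monotonicity gives equal states. The first component
  \<open>f\<close> of \<open>J (w - v)\<close> is then a difference of equal gradients, so the
  costate difference \<open>- K' f\<close> vanishes.\<close>

lemma steady_state_unique:
  assumes w: "w \<in> D" "J w - R w - c = 0" and v: "v \<in> D" "J v - R v - c = 0"
  shows "w = v"
proof -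
  obtain K K' where K: "bounded_linear K" "bounded_linear K'"
    "\<And>z. K z \<in> L2_on tf" "\<And>y. K' y \<in> Z_space tf" "\<And>z y. K z \<bullet> y = z \<bullet> K' y"
    "skew_inverse (\<lambda>(f, g). (K g, - K' f)) W"
    "D = (\<lambda>(f, g). (K g, - K' f)) ` W"
    "\<And>w. w \<in> W \<Longrightarrow> J (case w of (f, g) \<Rightarrow> (K g, - K' f)) = w"
    by (rule op_J_inverse[OF tf, of A], rule that, assumption+)
  interpret G: skew_inverse "\<lambda>(f, g). (K g, - K' f)" W by (rule K(6))
  have J: "linear_operator D J" "\<And>z. z \<in> D \<Longrightarrow> J z \<bullet> z = 0" "D \<subseteq> W"
    using G.inverse_skew_adjoint[OF K(7) K(8)] by blast+
  have W: "w \<in> W" "v \<in> W" using w v J(3) by auto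
  have d: "w - v \<in> D" using w v J(1) by (simp add: linear_operator_def subspace_diff)
  have "J w = J (v + (w - v))" by simp
  also have "\<dots> = J v + J (w - v)" using v d J(1) unfolding linear_operator_def by blast
  finally have "J (w - v) = J w - J v" by simp
  also have "\<dots> = R w - R v" using w(2) v(2) by (simp add: algebra_simps)
  finally have Jd: "J (w - v) = R w - R v" .
  then have "(R w - R v) \<bullet> (w - v) = 0" using J(2)[OF d] by simp
  then have "\<mu> * (norm (fst w - fst v))\<^sup>2 \<le> 0" using R_strongly_monotone[OF W] by simp
  then have x: "fst w = fst v" using \<mu> by (simp add: mult_le_0_iff)
  obtain f g where fg: "(f, g) \<in> W" "w - v = (K g, - K' f)" using d unfolding K(7) by auto
  have "(f, g) = R w - R v" using K(8)[OF fg(1)] by (simp add: fg(2)[symmetric] Jd)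
  then have "f = fst (R w - R v)" by (metis fst_conv)
  then have "f = 0" by (simp add: R_eq W x)
  then have "snd (w - v) = 0" using linear_0[OF bounded_linear.linear[OF K(2)]] by (simp add: fg(2))
  then show ?thesis using x by (simp add: prod_eq_iff)
qed

end

theorem theorem4p1:
  fixes tf \<alpha> \<mu> L :: real
    and A :: "real^'n::finite^'n" and B :: "real^'m::finite^'n"
    and ulo uhi :: "real^'m"
    and l :: "real^'n \<Rightarrow> real"
    and gradJ :: "(real^'n) L2 \<Rightarrow> (real^'n) L2"
    and x0 :: "real^'n"
  assumes "tf > 0" and "\<alpha> > 0"
    and "\<And>i. ulo $ i < 0 \<and> 0 < uhi $ i"
    and "continuous_on UNIV l" and "convex_on UNIV l" and "l 0 = 0" and "\<And>v. l v \<ge> 0"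
    and "\<And>x. x \<in> L2_on tf \<Longrightarrow> set_integrable lborel {0..tf} (\<lambda>t. l (rep_L2 x t))"
    and "\<And>x. x \<in> L2_on tf \<Longrightarrow>
           has_gradient_on (L2_on tf) (running_cost tf l) (gradJ x) x"
    and "\<mu> > 0" and "L > 0"
    and "\<And>x y. x \<in> L2_on tf \<Longrightarrow> y \<in> L2_on tf \<Longrightarrow>
           \<mu> * (norm (x - y))\<^sup>2 \<le> (gradJ x - gradJ y) \<bullet> (x - y) \<and>
           (gradJ x - gradJ y) \<bullet> (x - y) \<le> L * (norm (x - y))\<^sup>2"
  shows "let W = W_space tf; D = dom_J tf A; J = op_J tf A;
             R = op_R tf B \<alpha> ulo uhi gradJ; c = (0, (0, x0));
             H = half_norm_sq
         in
           (incrementally_monotone_port_hamiltonian W H D J R \<and>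
            (\<forall>w\<in>D. J w - R w - c = port_hamiltonian_rhs W H J R w - c)) \<and>
           (\<forall>w0\<in>W. \<exists>w. mild_solution W D J R c w0 w \<and>
              (\<forall>v. mild_solution W D J R c w0 v \<longrightarrow> (\<forall>t\<ge>0. v t = w t))) \<and>
           (\<exists>ws\<in>W.
              (\<forall>w. steady_state D J R c w \<longleftrightarrow> w = ws) \<and>
              (\<forall>w. w \<in> D \<and> op_S tf A B \<alpha> ulo uhi gradJ w = (0, (0, x0)) \<longleftrightarrow> w = ws) \<and>
              (\<forall>w\<in>W. shifted_hamiltonian W H ws w = (norm (w - ws))\<^sup>2 / 2) \<and>
              (\<forall>w0\<in>W. \<forall>w. mild_solution W D J R c w0 w \<longrightarrow>
                 (\<forall>t\<ge>0. shifted_hamiltonian W H ws (w t) \<le> shifted_hamiltonian W H ws w0)))"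
proof -
  interpret C: optimal_control tf \<alpha> \<mu> L A B ulo uhi l gradJ x0
    by unfold_locales (use assms in blast)+
  let ?W = "W_space tf :: ((real^'n) L2 \<times> (real^'n) L2 \<times> (real^'n)) set"
  let ?c = "(0, (0, x0)) :: (real^'n) L2 \<times> (real^'n) L2 \<times> (real^'n)"
  let ?D = "dom_J tf A" and ?J = "op_J tf A" and ?R = "op_R tf B \<alpha> ulo uhi gradJ"
  obtain K K' where K: "bounded_linear K" "bounded_linear K'"
    "\<And>z. K z \<in> L2_on tf" "\<And>y. K' y \<in> Z_space tf" "\<And>z y. K z \<bullet> y = z \<bullet> K' y"
    "skew_inverse (\<lambda>(f, g). (K g, - K' f)) ?W"
    "?D = (\<lambda>(f, g). (K g, - K' f)) ` ?W"
    "\<And>w. w \<in> ?W \<Longrightarrow> ?J (case w of (f, g) \<Rightarrow> (K g, - K' f)) = w"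
    by (rule op_J_inverse[OF assms(1), of A], rule that, assumption+)
  interpret G: skew_inverse "\<lambda>(f, g). (K g, - K' f)" ?W by (rule K(6))
  have J: "skew_adjoint ?W ?D ?J" "linear_operator ?D ?J" "\<And>z. z \<in> ?D \<Longrightarrow> ?J z \<bullet> z = 0"
    "?D \<subseteq> ?W" "?J ` ?D \<subseteq> ?W"
    using G.inverse_skew_adjoint[OF K(7) K(8)] by blast+
  have S: "unitary_C0_group ?W (unitary_group_of ?W ?D ?J)" "generates ?W ?D ?J (unitary_group_of ?W ?D ?J)"
    using G.unitary_group_of_inverse[OF K(7) K(8)] by blast+
  obtain M where M: "\<And>w v. w \<in> ?W \<Longrightarrow> v \<in> ?W \<Longrightarrow> norm (?R w - ?R v) \<le> M * norm (w - v)"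
    using C.R_lipschitz by blast
  interpret E: monotone_evolution ?W ?D ?J ?R ?c M
    by (intro monotone_evolution.intro unitary_group.intro monotone_evolution_axioms.intro
        subspace_W closed_W S C.R_in C.c_in C.R_monotone M)
  have grad: "gradient_on ?W half_norm_sq z = z" if "z \<in> ?W" for z
    by (rule gradient_on_eqI[OF subspace_W that has_gradient_on_half_norm_sq[OF that]])
  have pH: "port_hamiltonian ?W half_norm_sq ?D ?J ?R"
    unfolding port_hamiltonian_def
  proof (intro conjI ballI)
    show "hilbert_space ?W"
      by (simp add: hilbert_space_def complete_eq_closed subspace_W closed_W)
    show "half_norm_sq differentiable_on ?W"
      unfolding differentiable_on_def differentiable_def
      using has_gradient_on_half_norm_sq unfolding has_gradient_on_def by blast
    show "\<exists>\<mu>>0. strongly_convex_on \<mu> ?W half_norm_sq"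
      using strongly_convex_half_norm_sq[OF subspace_imp_convex[OF subspace_W]] zero_less_one by blast
    show "0 \<le> ?R z \<bullet> z" if "z \<in> ?W" for z
      using C.R_monotone[OF that subspace_0[OF subspace_W]] by (simp add: C.R_0)
  qed (use J C.R_in E.R_continuous in auto)
  have part1: "incrementally_monotone_port_hamiltonian ?W half_norm_sq ?D ?J ?R \<and>
      (\<forall>w\<in>?D. ?J w - ?R w - ?c = port_hamiltonian_rhs ?W half_norm_sq ?J ?R w - ?c)"
    unfolding incrementally_monotone_port_hamiltonian_def port_hamiltonian_rhs_def
    using pH J C.R_monotone grad by auto
  have part2: "\<exists>w. mild_solution ?W ?D ?J ?R ?c w0 w \<and>
      (\<forall>v. mild_solution ?W ?D ?J ?R ?c w0 v \<longrightarrow> (\<forall>t\<ge>0. v t = w t))" if w0: "w0 \<in> ?W" for w0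
  proof -
    obtain w where w: "mild_solution ?W ?D ?J ?R ?c w0 w" using E.mild_solution_exists[OF w0] by blast
    have "v t = w t" if "mild_solution ?W ?D ?J ?R ?c w0 v" "t \<ge> 0" for v t
      using E.mild_solution_contraction[OF that(1) w w0 w0 that(2)] by simp
    with w show ?thesis by blast
  qed
  obtain ws where ws: "ws \<in> ?D" "?J ws - ?R ws - ?c = 0" using C.steady_state_exists by blast
  have steady: "w \<in> ?D \<and> ?J w - ?R w - ?c = 0 \<longleftrightarrow> w = ws" for w
    using ws C.steady_state_unique by blast
  have wsW: "ws \<in> ?W" using ws J(4) by blast
  have shifted: "shifted_hamiltonian ?W half_norm_sq ws w = (norm (w - ws))\<^sup>2 / 2" for w
    unfolding shifted_hamiltonian_def grad[OF wsW] half_norm_sq_def power2_norm_eq_inner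
    by (simp add: inner_diff_left inner_diff_right inner_commute field_simps)
  have ss: "steady_state ?D ?J ?R ?c ws" using ws by (simp add: steady_state_def)
  have "ws \<in> ?W \<and> (\<forall>w. steady_state ?D ?J ?R ?c w \<longleftrightarrow> w = ws) \<and>
      (\<forall>w. w \<in> ?D \<and> op_S tf A B \<alpha> ulo uhi gradJ w = ?c \<longleftrightarrow> w = ws) \<and>
      (\<forall>w\<in>?W. shifted_hamiltonian ?W half_norm_sq ws w = (norm (w - ws))\<^sup>2 / 2) \<and>
      (\<forall>w0\<in>?W. \<forall>w. mild_solution ?W ?D ?J ?R ?c w0 w \<longrightarrow>
        (\<forall>t\<ge>0. shifted_hamiltonian ?W half_norm_sq ws (w t) \<le> shifted_hamiltonian ?W half_norm_sq ws w0))"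
  proof (intro conjI allI ballI impI)
    show "steady_state ?D ?J ?R ?c w \<longleftrightarrow> w = ws" for w
      unfolding steady_state_def by (rule steady)
    show "w \<in> ?D \<and> op_S tf A B \<alpha> ulo uhi gradJ w = ?c \<longleftrightarrow> w = ws" for w
      using steady[of w] by (simp add: op_S_def)
    \<comment> \<open>The shifted Hamiltonian is half the squared distance to \<open>ws\<close>, so
      the claim compares \<open>w\<close> with the constant mild solution \<open>ws\<close>.\<close>
    fix w0 w and t :: real assume w: "w0 \<in> ?W" "mild_solution ?W ?D ?J ?R ?c w0 w" "0 \<le> t"
    have "norm (w t - ws) \<le> norm (w0 - ws)"
      by (rule E.mild_solution_contraction[OF w(2) E.steady_state_mild_solution[OF ss] w(1) wsW w(3)])
    then show "shifted_hamiltonian ?W half_norm_sq ws (w t) \<le> shifted_hamiltonian ?W half_norm_sq ws w0"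
      by (simp add: shifted)
  qed (use wsW shifted in auto)
  then show ?thesis
    unfolding Let_def using part1 part2 by blast
qed

end
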